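(* Every $k$-symplectic manifold $(M,\omega^1,\ldots,\omega^k,V)$ admits, locally (i.e. on a neighbourhood of every point of $M$), an integrable distribution $V'$ supplementary to $V$, that is $V\oplus V'=TM$, such that $\omega^\alpha|_{V'\times V'}=0$ for $\alpha=1,\ldots,k$.
   Context: All manifolds are real, smooth, Hausdorff, connected, second countable and finite-dimensional; all structures are smooth. Let $M$ be an $n(k+1)$-dimensional manifold. A $k$-symplectic structure on $M$ is a family $(\omega^1,\ldots,\omega^k,V)$, where $V$ is an integrable distribution on $M$ of rank $nk$ and $\omega^1,\ldots,\omega^k$ are closed differential two-forms on $M$ such that (1) $\omega^\alpha|_{V\times V}=0$ for $1\leq\alpha\leq k$, and (2) $\bigcap_{\alpha=1}^k\ker\omega^\alpha=\{0\}$, where $\ker\omega^\alpha=\{v\in TM\mid \omega^\alpha(v,\cdot)=0\}$. Then $(M,\omega^1,\ldots,\omega^k,V)$ is called a $k$-symplectic manifold. *)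

theory Defs
  imports "HOL-Analysis.Analysis" "HOL-Library.Function_Algebras"
begin

text \<open>Functions into a real vector space form a real vector space pointwise; the additive
  structure is the one of \<open>HOL-Library.Function_Algebras\<close>. Tangent vectors are represented as
  such functions (see below).\<close>

instantiation "fun" :: (type, scaleR) scaleR
begin

definition scaleR_fun_def: "a *\<^sub>R f = (\<lambda>x. a *\<^sub>R f x)"

instance ..

end

lemma scaleR_fun_apply [simp]: "(a *\<^sub>R f) x = a *\<^sub>R f x"
  by (simp add: scaleR_fun_def)

instance "fun" :: (type, real_vector) real_vector
  by standard (simp_all add: fun_eq_iff scaleR_add_right scaleR_add_left)


section \<open>Smooth functions and smooth manifolds\<close>

text \<open>These are meant for open \<open>S\<close> and a finite-dimensional domain, where being \<open>C\<^sup>m\<^sup>+\<^sup>1\<close> means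
  being differentiable with all directional derivatives of class \<open>C\<^sup>m\<close>.\<close>

primrec Cm_on ::
    "nat \<Rightarrow> ('e::euclidean_space \<Rightarrow> 'f::real_normed_vector) \<Rightarrow> 'e set \<Rightarrow> bool" where
  "Cm_on 0 = (\<lambda>f S. continuous_on S f)"
| "Cm_on (Suc m) = (\<lambda>f S. (\<forall>x\<in>S. f differentiable (at x)) \<and>
      (\<forall>v. Cm_on m (\<lambda>x. frechet_derivative f (at x) v) S))"

definition smooth_on :: "('e::euclidean_space \<Rightarrow> 'f::real_normed_vector) \<Rightarrow> 'e set \<Rightarrow> bool" where
  "smooth_on f S \<longleftrightarrow> (\<forall>m. Cm_on m f S)"

text \<open>A chart \<open>(U, \<phi>)\<close>; only the values of \<open>\<phi>\<close> on \<open>U\<close> matter.\<close>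

type_synonym ('a, 'e) chart = "'a set \<times> ('a \<Rightarrow> 'e)"

definition is_chart :: "'a topology \<Rightarrow> ('a, 'e::euclidean_space) chart \<Rightarrow> bool" where
  "is_chart X c \<longleftrightarrow> openin X (fst c) \<and> open (snd c ` fst c) \<and>
     homeomorphic_map (subtopology X (fst c)) (top_of_set (snd c ` fst c)) (snd c)"

definition chart_inv :: "('a, 'e) chart \<Rightarrow> 'e \<Rightarrow> 'a" where
  "chart_inv c = inv_into (fst c) (snd c)"

definition transition :: "('a, 'e) chart \<Rightarrow> ('a, 'e) chart \<Rightarrow> 'e \<Rightarrow> 'e" where
  "transition c d = snd d \<circ> chart_inv c"

definition smoothly_compatible ::
    "('a, 'e::euclidean_space) chart \<Rightarrow> ('a, 'e) chart \<Rightarrow> bool" where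
  "smoothly_compatible c d \<longleftrightarrow>
     smooth_on (transition c d) (snd c ` (fst c \<inter> fst d)) \<and>
     smooth_on (transition d c) (snd d ` (fst c \<inter> fst d))"

text \<open>The smooth structure \<open>A\<close> is a maximal atlas. The dimension of the manifold is
  \<open>DIM('e)\<close>.\<close>

locale smooth_manifold =
  fixes X :: "'a topology" and A :: "('a, 'e::euclidean_space) chart set"
  assumes Hausdorff: "Hausdorff_space X"
    and connected: "connected_space X"
    and second_countable: "second_countable X"
    and charts: "\<And>c. c \<in> A \<Longrightarrow> is_chart X c"
    and cover: "(\<Union>c\<in>A. fst c) = topspace X"
    and compatible: "\<And>c d. c \<in> A \<Longrightarrow> d \<in> A \<Longrightarrow> smoothly_compatible c d"
    and maximal: "\<And>c. is_chart X c \<Longrightarrow> (\<And>d. d \<in> A \<Longrightarrow> smoothly_compatible c d) \<Longrightarrow> c \<in> A"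


section \<open>Tangent vectors, vector fields and distributions\<close>

text \<open>A tangent vector at \<open>p\<close> assigns to each chart around \<open>p\<close> a coordinate vector, with coordinate
  vectors in different charts related by the derivatives of the transition maps. It takes the value 0
  on all other charts, so that distinct functions are distinct tangent vectors.\<close>

type_synonym ('a, 'e) tvec = "('a, 'e) chart \<Rightarrow> 'e"

definition tangent_space ::
    "('a, 'e::euclidean_space) chart set \<Rightarrow> 'a \<Rightarrow> ('a, 'e) tvec set" where
  "tangent_space A p = {v.
     (\<forall>c. \<not> (c \<in> A \<and> p \<in> fst c) \<longrightarrow> v c = 0) \<and>
     (\<forall>c\<in>A. \<forall>d\<in>A. p \<in> fst c \<inter> fst d \<longrightarrow>
        v d = frechet_derivative (transition c d) (at (snd c p)) (v c))}"

text \<open>The tangent vector at \<open>p\<close> with coordinate vector \<open>u\<close> in the chart \<open>c\<close>.\<close>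

definition coord_vec ::
    "('a, 'e::euclidean_space) chart set \<Rightarrow> ('a, 'e) chart \<Rightarrow> 'a \<Rightarrow> 'e \<Rightarrow> ('a, 'e) tvec" where
  "coord_vec A c p u = (\<lambda>d. if d \<in> A \<and> p \<in> fst d
     then frechet_derivative (transition c d) (at (snd c p)) u else 0)"

definition smooth_vector_field ::
    "('a, 'e::euclidean_space) chart set \<Rightarrow> 'a set \<Rightarrow> ('a \<Rightarrow> ('a, 'e) tvec) \<Rightarrow> bool" where
  "smooth_vector_field A U Y \<longleftrightarrow>
     (\<forall>p\<in>U. Y p \<in> tangent_space A p) \<and>
     (\<forall>c\<in>A. smooth_on (\<lambda>x. Y (chart_inv c x) c) (snd c ` (fst c \<inter> U)))"

text \<open>A smooth distribution of constant rank \<open>r\<close> on the open set \<open>U\<close>.\<close>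

definition distribution ::
    "'a topology \<Rightarrow> ('a, 'e::euclidean_space) chart set \<Rightarrow> 'a set \<Rightarrow> nat \<Rightarrow>
     ('a \<Rightarrow> ('a, 'e) tvec set) \<Rightarrow> bool" where
  "distribution X A U r D \<longleftrightarrow>
     (\<forall>p\<in>U. subspace (D p) \<and> D p \<subseteq> tangent_space A p \<and> dim (D p) = r) \<and>
     (\<forall>p\<in>U. \<exists>W Y. openin X W \<and> p \<in> W \<and> W \<subseteq> U \<and>
        (\<forall>i<r. smooth_vector_field A W (Y i)) \<and>
        (\<forall>q\<in>W. D q = span ((\<lambda>i. Y i q) ` {..<r})))"

text \<open>The chart \<open>c\<close> around \<open>q\<close> maps \<open>N\<close> onto the slice through the image of \<open>q\<close> in which exactly the
  coordinates belonging to the basis vectors in \<open>B\<close> vary. In such a chart the tangent space of \<open>N\<close>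
  at \<open>q\<close> consists of the tangent vectors whose coordinate vector lies in the span of \<open>B\<close>.\<close>

definition slice_chart ::
    "('a, 'e::euclidean_space) chart set \<Rightarrow> nat \<Rightarrow> 'a set \<Rightarrow> 'a \<Rightarrow> ('a, 'e) chart \<Rightarrow> 'e set \<Rightarrow> bool"
  where
  "slice_chart A r N q c B \<longleftrightarrow> c \<in> A \<and> q \<in> fst c \<and> B \<subseteq> Basis \<and> card B = r \<and>
     snd c ` (fst c \<inter> N) = {x \<in> snd c ` fst c. \<forall>b\<in>Basis - B. x \<bullet> b = snd c q \<bullet> b}"

text \<open>\<open>N\<close> is an \<open>r\<close>-dimensional embedded submanifold whose tangent space at every point \<open>q\<close> is
  \<open>D q\<close>.\<close>

definition integral_manifold ::
    "('a, 'e::euclidean_space) chart set \<Rightarrow> nat \<Rightarrow> ('a \<Rightarrow> ('a, 'e) tvec set) \<Rightarrow> 'a set \<Rightarrow> bool" where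
  "integral_manifold A r D N \<longleftrightarrow>
     (\<forall>q\<in>N. \<exists>c B. slice_chart A r N q c B \<and> D q = {v \<in> tangent_space A q. v c \<in> span B})"

text \<open>Integrability: there is an integral manifold through every point. Since immersed submanifolds
  are locally embedded, it makes no difference that integral manifolds are required to be
  embedded.\<close>

definition integrable_distribution ::
    "'a topology \<Rightarrow> ('a, 'e::euclidean_space) chart set \<Rightarrow> 'a set \<Rightarrow> nat \<Rightarrow>
     ('a \<Rightarrow> ('a, 'e) tvec set) \<Rightarrow> bool" where
  "integrable_distribution X A U r D \<longleftrightarrow> distribution X A U r D \<and>
     (\<forall>p\<in>U. \<exists>N. p \<in> N \<and> N \<subseteq> U \<and> integral_manifold A r D N)"

definition supplementary_on ::
    "('a, 'e::euclidean_space) chart set \<Rightarrow> 'a set \<Rightarrow> ('a \<Rightarrow> ('a, 'e) tvec set) \<Rightarrow>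
     ('a \<Rightarrow> ('a, 'e) tvec set) \<Rightarrow> bool" where
  "supplementary_on A U D D' \<longleftrightarrow>
     (\<forall>p\<in>U. D p \<inter> D' p = {0} \<and> {v + w |v w. v \<in> D p \<and> w \<in> D' p} = tangent_space A p)"


section \<open>Differential two-forms\<close>

type_synonym ('a, 'e) form2 = "'a \<Rightarrow> ('a, 'e) tvec \<Rightarrow> ('a, 'e) tvec \<Rightarrow> real"

definition form2_coeff ::
    "('a, 'e::euclidean_space) chart set \<Rightarrow> ('a, 'e) form2 \<Rightarrow> ('a, 'e) chart \<Rightarrow> 'e \<Rightarrow> 'e \<Rightarrow> 'e \<Rightarrow> real"
  where
  "form2_coeff A \<omega> c u v x =
     \<omega> (chart_inv c x) (coord_vec A c (chart_inv c x) u) (coord_vec A c (chart_inv c x) v)"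

definition differential_form2 ::
    "'a topology \<Rightarrow> ('a, 'e::euclidean_space) chart set \<Rightarrow> ('a, 'e) form2 \<Rightarrow> bool" where
  "differential_form2 X A \<omega> \<longleftrightarrow>
     (\<forall>p\<in>topspace X.
        (\<forall>u\<in>tangent_space A p. \<forall>v\<in>tangent_space A p. \<forall>w\<in>tangent_space A p. \<forall>a b.
           \<omega> p (a *\<^sub>R u + b *\<^sub>R v) w = a * \<omega> p u w + b * \<omega> p v w) \<and>
        (\<forall>u\<in>tangent_space A p. \<forall>v\<in>tangent_space A p. \<omega> p u v = - \<omega> p v u)) \<and>
     (\<forall>c\<in>A. \<forall>u v. smooth_on (form2_coeff A \<omega> c u v) (snd c ` fst c))"

text \<open>The exterior derivative in the chart \<open>c\<close>, evaluated at the point with coordinates \<open>x\<close> on the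
  constant coordinate vector fields \<open>u\<close>, \<open>v\<close>, \<open>w\<close>, whose brackets vanish.\<close>

definition ext_deriv2 ::
    "('a, 'e::euclidean_space) chart set \<Rightarrow> ('a, 'e) form2 \<Rightarrow> ('a, 'e) chart \<Rightarrow>
     'e \<Rightarrow> 'e \<Rightarrow> 'e \<Rightarrow> 'e \<Rightarrow> real" where
  "ext_deriv2 A \<omega> c x u v w =
     frechet_derivative (form2_coeff A \<omega> c v w) (at x) u
   - frechet_derivative (form2_coeff A \<omega> c u w) (at x) v
   + frechet_derivative (form2_coeff A \<omega> c u v) (at x) w"

definition closed_form2 ::
    "('a, 'e::euclidean_space) chart set \<Rightarrow> ('a, 'e) form2 \<Rightarrow> bool" where
  "closed_form2 A \<omega> \<longleftrightarrow> (\<forall>c\<in>A. \<forall>x\<in>snd c ` fst c. \<forall>u v w. ext_deriv2 A \<omega> c x u v w = 0)"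

definition form2_ker ::
    "('a, 'e::euclidean_space) chart set \<Rightarrow> ('a, 'e) form2 \<Rightarrow> 'a \<Rightarrow> ('a, 'e) tvec set" where
  "form2_ker A \<omega> p = {v \<in> tangent_space A p. \<forall>w\<in>tangent_space A p. \<omega> p v w = 0}"

definition vanishes_on :: "'a set \<Rightarrow> ('a, 'e) form2 \<Rightarrow> ('a \<Rightarrow> ('a, 'e) tvec set) \<Rightarrow> bool" where
  "vanishes_on U \<omega> D \<longleftrightarrow> (\<forall>p\<in>U. \<forall>v\<in>D p. \<forall>w\<in>D p. \<omega> p v w = 0)"


section \<open>k-symplectic manifolds\<close>

locale k_symplectic_manifold = smooth_manifold X A
  for X :: "'a topology" and A :: "('a, 'e::euclidean_space) chart set" +
  fixes n k :: nat
    and \<omega> :: "nat \<Rightarrow> ('a, 'e) form2"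
    and V :: "'a \<Rightarrow> ('a, 'e) tvec set"
  assumes k_pos: "k \<ge> 1"
    and dimension: "DIM('e) = n * (k + 1)"
    and integrable: "integrable_distribution X A (topspace X) (n * k) V"
    and forms: "\<And>\<alpha>. \<alpha> \<in> {1..k} \<Longrightarrow> differential_form2 X A (\<omega> \<alpha>)"
    and closed: "\<And>\<alpha>. \<alpha> \<in> {1..k} \<Longrightarrow> closed_form2 A (\<omega> \<alpha>)"
    and isotropic: "\<And>\<alpha>. \<alpha> \<in> {1..k} \<Longrightarrow> vanishes_on (topspace X) (\<omega> \<alpha>) V"
    and nondegenerate: "\<And>p. p \<in> topspace X \<Longrightarrow> (\<Inter>\<alpha>\<in>{1..k}. form2_ker A (\<omega> \<alpha>) p) = {0}"

end

theory Submission
  imports Defs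
begin

text \<open>
  Near a given point choose coordinates \<open>(x, z)\<close> in which \<open>V\<close> is spanned by the \<open>\<partial>/\<partial>z\<close>
  (\<open>foliated_chart\<close>). Each \<open>\<omega>\<^sup>\<alpha>\<close> is closed and vanishes on the leaves \<open>x = const\<close>, so by the
  relative Poincare lemma \<open>-\<omega>\<^sup>\<alpha>\<close> has a primitive that vanishes on \<open>V\<close>. Such a primitive is of the
  form \<open>\<Sum>\<^sub>b y\<^sup>\<alpha>\<^sub>b dx\<^sub>b\<close>, whence \<open>\<omega>\<^sup>\<alpha> = \<Sum>\<^sub>b dx\<^sub>b \<and> dy\<^sup>\<alpha>\<^sub>b\<close> (\<open>form_in_coordinates\<close>). A vector
  that is annihilated by all \<open>dx\<^sub>b\<close> and \<open>dy\<^sup>\<alpha>\<^sub>b\<close> lies in the kernel of every \<open>\<omega>\<^sup>\<alpha>\<close> and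
  is therefore 0; as there are \<open>n + n k\<close> of these functions, \<open>(x, y)\<close> is a coordinate system. In it
  \<open>V\<close> is still given by \<open>dx = 0\<close>, and the distribution \<open>dy = 0\<close> is integrable, supplementary to
  \<open>V\<close>, and each summand \<open>dx\<^sub>b \<and> dy\<^sup>\<alpha>\<^sub>b\<close> vanishes on it.

  The analytic work is in the coordinates \<open>(x, z)\<close>. Write \<open>V\<close> near a point as a graph, with \<open>L q\<close>
  the projection onto \<open>V\<close> at \<open>q\<close> along the transversal directions. The point with leaf coordinates
  \<open>(x, z)\<close> is reached from \<open>(x, 0)\<close> by the curve in \<open>V\<close> that lies over the segment from \<open>0\<close>
  to \<open>z\<close>, so it satisfies \<open>F(x, z) = x + \<integral>\<^sub>0\<^sup>1 L(F(x, s z)) z ds\<close>. A contraction argument gives a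
  continuous solution. Its partial derivatives solve the linearised equation, which has the same form,
  and so the solution is smooth by induction on the order (\<open>ray_solution_Cm_on\<close>). That the derivative
  of \<open>F\<close> in the \<open>z\<close>-directions is \<open>L\<close> follows from involutivity and the uniqueness of solutions of
  the linearised equation (\<open>foliated_coordinates\<close>). Involutivity, in turn, is the symmetry of the second
  derivatives of a parametrised integral manifold (\<open>integrable_imp_involutive\<close>).
\<close>

section \<open>Calculus of smooth functions\<close>

abbreviation fderiv :: "('a::real_normed_vector \<Rightarrow> 'b::real_normed_vector) \<Rightarrow> 'a \<Rightarrow> 'a \<Rightarrow> 'b" where
  "fderiv f x \<equiv> frechet_derivative f (at x)"

lemma fderiv_eq: "(f has_derivative f') (at x) \<Longrightarrow> fderiv f x = f'"
  by (metis frechet_derivative_at)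

lemma Cm_on_SucD:
  "Cm_on (Suc m) f S \<Longrightarrow> x \<in> S \<Longrightarrow> (f has_derivative fderiv f x) (at x)"
  using frechet_derivative_works by auto

lemma Cm_on_Suc_fderiv: "Cm_on (Suc m) f S \<Longrightarrow> Cm_on m (\<lambda>x. fderiv f x v) S"
  by simp

lemma Cm_on_subset: "Cm_on m f S \<Longrightarrow> T \<subseteq> S \<Longrightarrow> Cm_on m f T"
  by (induction m arbitrary: f) (auto intro: continuous_on_subset)

lemma Cm_on_lower: "Cm_on (Suc m) f S \<Longrightarrow> Cm_on m f S"
proof (induction m arbitrary: f)
  case 0
  then show ?case
    by (auto intro!: continuous_at_imp_continuous_on differentiable_imp_continuous_within)
qed auto

lemma Cm_on_le: "Cm_on m f S \<Longrightarrow> k \<le> m \<Longrightarrow> Cm_on k f S"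
proof (induction m)
  case (Suc m)
  then show ?case
    by (metis Cm_on_lower le_Suc_eq)
qed auto

lemma Cm_on_cong:
  assumes "open S" "\<And>x. x \<in> S \<Longrightarrow> f x = g x" "Cm_on m f S"
  shows "Cm_on m g S"
  using assms(2,3)
proof (induction m arbitrary: f g)
  case 0
  then show ?case by (simp cong: continuous_on_cong)
next
  case (Suc m)
  have d: "(g has_derivative fderiv f x) (at x)" if "x \<in> S" for x
    by (rule has_derivative_transform_within_open[OF Cm_on_SucD[OF Suc.prems(2) that] assms(1) that])
       (use Suc.prems in auto)
  have "Cm_on m (\<lambda>x. fderiv g x v) S" for v
    by (rule Suc.IH[of "\<lambda>x. fderiv f x v"]) (use fderiv_eq[OF d] Suc.prems(2) in auto)
  then show ?case
    using d by (auto simp: differentiable_def)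
qed

lemma Cm_on_SucI:
  assumes "open S" "\<And>x. x \<in> S \<Longrightarrow> (f has_derivative f' x) (at x)"
    "\<And>v. Cm_on m (\<lambda>x. f' x v) S"
  shows "Cm_on (Suc m) f S"
proof -
  have "Cm_on m (\<lambda>x. fderiv f x v) S" for v
    by (rule Cm_on_cong[OF assms(1) _ assms(3)[of v]]) (simp add: fderiv_eq[OF assms(2)])
  then show ?thesis
    using assms(2) by (auto simp: differentiable_def)
qed

lemma Cm_on_const: "Cm_on m (\<lambda>x. c) S"
proof (induction m arbitrary: c)
  case (Suc m)
  have "fderiv (\<lambda>x. c) x = (\<lambda>v. 0)" for x
    by (rule fderiv_eq) simp
  then show ?case using Suc by simp
qed simp

lemma linear_has_derivative:
  fixes f :: "'a::euclidean_space \<Rightarrow> 'b::real_normed_vector"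
  shows "linear f \<Longrightarrow> (f has_derivative f) F"
  by (simp add: bounded_linear_imp_has_derivative linear_conv_bounded_linear)

lemma Cm_on_linear:
  assumes "linear f" shows "Cm_on m f S"
proof (cases m)
  case 0
  then show ?thesis
    using assms by (simp add: linear_continuous_on linear_conv_bounded_linear)
next
  case (Suc k)
  have "(f has_derivative f) (at x)" for x
    by (rule linear_has_derivative[OF assms])
  then have "fderiv f x = f" "f differentiable at x" for x
    by (auto simp: fderiv_eq differentiable_def)
  then show ?thesis
    using Suc by (simp add: Cm_on_const)
qed

lemma Cm_on_add:
  assumes "open S" "Cm_on m f S" "Cm_on m g S"
  shows "Cm_on m (\<lambda>x. f x + g x) S"
  using assms(2,3)
proof (induction m arbitrary: f g)
  case 0
  then show ?case by (simp add: continuous_on_add)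
next
  case (Suc m)
  show ?case
    by (rule Cm_on_SucI[OF assms(1), where f' = "\<lambda>x v. fderiv f x v + fderiv g x v"])
       (rule has_derivative_add Cm_on_SucD Cm_on_Suc_fderiv Suc Suc.IH | assumption)+
qed

lemma Cm_on_sum:
  assumes "open S" "\<And>i. i \<in> I \<Longrightarrow> Cm_on m (f i) S"
  shows "Cm_on m (\<lambda>x. \<Sum>i\<in>I. f i x) S"
  using assms(2)
  by (induction I rule: infinite_finite_induct) (auto simp: Cm_on_const intro!: Cm_on_add[OF assms(1)])

lemma Cm_on_bounded_bilinear:
  assumes "bounded_bilinear h" "open S" "Cm_on m f S" "Cm_on m g S"
  shows "Cm_on m (\<lambda>x. h (f x) (g x)) S"
  using assms(3,4)
proof (induction m arbitrary: f g)
  case 0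
  then show ?case by (simp add: bounded_bilinear.continuous_on[OF assms(1)])
next
  case (Suc m)
  show ?case
  proof (rule Cm_on_SucI[OF assms(2), where f' = "\<lambda>x v. h (f x) (fderiv g x v) + h (fderiv f x v) (g x)"])
    fix x assume "x \<in> S"
    then show "((\<lambda>x. h (f x) (g x)) has_derivative
        (\<lambda>v. h (f x) (fderiv g x v) + h (fderiv f x v) (g x))) (at x)"
      by (intro bounded_bilinear.FDERIV[OF assms(1)] Cm_on_SucD[OF Suc.prems(1)] Cm_on_SucD[OF Suc.prems(2)])
  next
    fix v
    show "Cm_on m (\<lambda>x. h (f x) (fderiv g x v) + h (fderiv f x v) (g x)) S"
      using Suc.prems
      by (intro Cm_on_add[OF assms(2)] Suc.IH Cm_on_lower[OF Suc.prems(1)] Cm_on_lower[OF Suc.prems(2)]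
          Cm_on_Suc_fderiv)
  qed
qed

lemmas Cm_on_scaleR = Cm_on_bounded_bilinear[OF bounded_bilinear_scaleR]
lemmas Cm_on_mult = Cm_on_bounded_bilinear[OF bounded_bilinear_mult]
lemmas Cm_on_inner = Cm_on_bounded_bilinear[OF bounded_bilinear_inner]

lemma linear_Basis_expansion:
  fixes f :: "'a::euclidean_space \<Rightarrow> 'b::real_vector"
  assumes "linear f"
  shows "f x = (\<Sum>b\<in>Basis. (x \<bullet> b) *\<^sub>R f b)"
proof -
  have "f x = f (\<Sum>b\<in>Basis. (x \<bullet> b) *\<^sub>R b)"
    by (simp add: euclidean_representation)
  also have "\<dots> = (\<Sum>b\<in>Basis. (x \<bullet> b) *\<^sub>R f b)"
    by (simp add: linear_sum[OF assms] linear_scale[OF assms])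
  finally show ?thesis .
qed

lemma linear_norm_le_Basis_sum:
  fixes f :: "'a::euclidean_space \<Rightarrow> 'b::real_normed_vector"
  assumes "linear f"
  shows "norm (f v) \<le> (\<Sum>b\<in>Basis. norm (f b)) * norm v"
proof -
  have "norm (f v) \<le> (\<Sum>b\<in>Basis. norm v * norm (f b))"
    unfolding linear_Basis_expansion[OF assms, of v]
    by (rule sum_norm_le) (simp add: Basis_le_norm mult_right_mono)
  then show ?thesis by (simp add: sum_distrib_left[symmetric] mult.commute)
qed

text \<open>The chain rule yields the derivative of \<open>g\<close> at \<open>f x\<close> in a direction that varies with \<open>x\<close>,
  whereas smoothness concerns fixed directions. Expanding the direction in the standard basis leaves
  finitely many fixed directions, to which the induction hypothesis applies with the same \<open>f\<close>.\<close>

lemma Cm_on_compose: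
  fixes f :: "'a::euclidean_space \<Rightarrow> 'b::euclidean_space" and g :: "'b \<Rightarrow> 'c::real_normed_vector"
  assumes "open S" "open T" "\<And>x. x \<in> S \<Longrightarrow> f x \<in> T" "Cm_on m f S" "Cm_on m g T"
  shows "Cm_on m (\<lambda>x. g (f x)) S"
  using assms(4,5)
proof (induction m arbitrary: g)
  case 0
  have "f ` S \<subseteq> T" using assms(3) by auto
  then show ?case using 0 by (auto intro: continuous_on_compose2)
next
  case (Suc m)
  have lin: "linear (fderiv g (f x))" if "x \<in> S" for x
    using Cm_on_SucD[OF Suc.prems(2) assms(3)[OF that]] has_derivative_linear by blast
  show ?case
  proof (rule Cm_on_SucI[OF assms(1), where f' = "\<lambda>x v. fderiv g (f x) (fderiv f x v)"])
    fix x assume "x \<in> S"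
    then show "((\<lambda>x. g (f x)) has_derivative (\<lambda>v. fderiv g (f x) (fderiv f x v))) (at x)"
      using has_derivative_compose[OF Cm_on_SucD[OF Suc.prems(1)] Cm_on_SucD[OF Suc.prems(2)]] assms(3)
      by blast
  next
    fix v
    show "Cm_on m (\<lambda>x. fderiv g (f x) (fderiv f x v)) S"
    proof (rule Cm_on_cong[OF assms(1), where f = "\<lambda>x. \<Sum>b\<in>Basis. (fderiv f x v \<bullet> b) *\<^sub>R fderiv g (f x) b"])
      show "Cm_on m (\<lambda>x. \<Sum>b\<in>Basis. (fderiv f x v \<bullet> b) *\<^sub>R fderiv g (f x) b) S"
        using Suc.prems Cm_on_lower[OF Suc.prems(1)]
        by (intro Cm_on_sum[OF assms(1)] Cm_on_scaleR[OF assms(1)] Cm_on_inner[OF assms(1)] Cm_on_const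
            Suc.IH Cm_on_Suc_fderiv)
    qed (use linear_Basis_expansion[OF lin] in simp)
  qed
qed

lemma Cm_on_linear_compose:
  fixes f :: "'a::euclidean_space \<Rightarrow> 'b::euclidean_space" and g :: "'b \<Rightarrow> 'c::real_normed_vector"
  assumes "open S" "linear g" "Cm_on m f S"
  shows "Cm_on m (\<lambda>x. g (f x)) S"
  by (rule Cm_on_compose[OF assms(1) open_UNIV _ assms(3) Cm_on_linear[OF assms(2)]]) simp

lemma Cm_on_linear_family:
  fixes M :: "'a::euclidean_space \<Rightarrow> 'b::euclidean_space \<Rightarrow> 'c::real_normed_vector"
  assumes "open S" "\<And>x. x \<in> S \<Longrightarrow> linear (M x)" "\<And>b. Cm_on m (\<lambda>x. M x b) S" "Cm_on m f S"
  shows "Cm_on m (\<lambda>x. M x (f x)) S"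
proof (rule Cm_on_cong[OF assms(1), where f = "\<lambda>x. \<Sum>b\<in>Basis. (f x \<bullet> b) *\<^sub>R M x b"])
  show "Cm_on m (\<lambda>x. \<Sum>b\<in>Basis. (f x \<bullet> b) *\<^sub>R M x b) S"
    using assms by (intro Cm_on_sum Cm_on_scaleR Cm_on_inner Cm_on_const)
qed (use linear_Basis_expansion[OF assms(2)] in simp)

lemma Cm_on_Pair:
  fixes f :: "'a::euclidean_space \<Rightarrow> 'b::euclidean_space" and g :: "'a \<Rightarrow> 'c::euclidean_space"
  assumes "open S" "Cm_on m f S" "Cm_on m g S"
  shows "Cm_on m (\<lambda>x. (f x, g x)) S"
proof -
  have "Cm_on m (\<lambda>x. (f x, 0) + (0, g x)) S"
    using assms by (intro Cm_on_add Cm_on_linear_compose[of S "\<lambda>y. (y, 0)" m f]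
      Cm_on_linear_compose[of S "\<lambda>y. (0, y)" m g]) (auto intro!: linearI)
  then show ?thesis by simp
qed

lemma Cm_on_uminus: "open S \<Longrightarrow> Cm_on m f S \<Longrightarrow> Cm_on m (\<lambda>x. - f x) S"
  using Cm_on_scaleR[OF _ Cm_on_const[of m "-1"], of S f] by simp

lemma Cm_on_diff: "open S \<Longrightarrow> Cm_on m f S \<Longrightarrow> Cm_on m g S \<Longrightarrow> Cm_on m (\<lambda>x. f x - g x) S"
  using Cm_on_add[OF _ _ Cm_on_uminus, of S m f g] by simp

lemma smooth_onD: "smooth_on f S \<Longrightarrow> Cm_on m f S" by (simp add: smooth_on_def)

lemma smooth_on_has_derivative:
  "smooth_on f S \<Longrightarrow> x \<in> S \<Longrightarrow> (f has_derivative fderiv f x) (at x)"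
  using Cm_on_SucD[OF smooth_onD] .

lemma smooth_on_imp_continuous_on: "smooth_on f S \<Longrightarrow> continuous_on S f"
  using smooth_onD[of f S 0] by simp

lemma smooth_on_fderiv: "smooth_on f S \<Longrightarrow> smooth_on (\<lambda>x. fderiv f x v) S"
  unfolding smooth_on_def using Cm_on_Suc_fderiv by blast

lemma linear_fderiv_smooth_on: "smooth_on f S \<Longrightarrow> x \<in> S \<Longrightarrow> linear (fderiv f x)"
  using smooth_on_has_derivative has_derivative_linear by blast

lemma smooth_on_subset: "smooth_on f S \<Longrightarrow> T \<subseteq> S \<Longrightarrow> smooth_on f T"
  unfolding smooth_on_def using Cm_on_subset by blast

lemma smooth_on_cong: "open S \<Longrightarrow> (\<And>x. x \<in> S \<Longrightarrow> f x = g x) \<Longrightarrow> smooth_on f S \<Longrightarrow> smooth_on g S"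
  unfolding smooth_on_def using Cm_on_cong[of S f g] by blast

lemma smooth_on_const: "smooth_on (\<lambda>x. c) S"
  unfolding smooth_on_def using Cm_on_const by blast

lemma smooth_on_linear: "linear f \<Longrightarrow> smooth_on f S"
  unfolding smooth_on_def using Cm_on_linear by blast

lemma smooth_on_ident: "smooth_on (\<lambda>x. x) S"
  by (rule smooth_on_linear) (rule linear_ident)

lemma smooth_on_add: "open S \<Longrightarrow> smooth_on f S \<Longrightarrow> smooth_on g S \<Longrightarrow> smooth_on (\<lambda>x. f x + g x) S"
  unfolding smooth_on_def by (intro allI Cm_on_add) auto

lemma smooth_on_diff: "open S \<Longrightarrow> smooth_on f S \<Longrightarrow> smooth_on g S \<Longrightarrow> smooth_on (\<lambda>x. f x - g x) S"
  unfolding smooth_on_def by (intro allI Cm_on_diff) auto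

lemma smooth_on_sum:
  "open S \<Longrightarrow> (\<And>i. i \<in> I \<Longrightarrow> smooth_on (f i) S) \<Longrightarrow> smooth_on (\<lambda>x. \<Sum>i\<in>I. f i x) S"
  unfolding smooth_on_def by (intro allI Cm_on_sum) auto

lemma smooth_on_scaleR:
  "open S \<Longrightarrow> smooth_on f S \<Longrightarrow> smooth_on g S \<Longrightarrow> smooth_on (\<lambda>x. f x *\<^sub>R g x) S"
  unfolding smooth_on_def using Cm_on_scaleR[of S _ f g] by simp

lemma smooth_on_mult:
  fixes g :: "_ \<Rightarrow> real"
  shows "open S \<Longrightarrow> smooth_on f S \<Longrightarrow> smooth_on g S \<Longrightarrow> smooth_on (\<lambda>x. f x * g x) S"
  unfolding smooth_on_def using Cm_on_mult[of S _ f g] by simp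

lemma smooth_on_inner:
  "open S \<Longrightarrow> smooth_on f S \<Longrightarrow> smooth_on g S \<Longrightarrow> smooth_on (\<lambda>x. f x \<bullet> g x) S"
  unfolding smooth_on_def using Cm_on_inner[of S _ f g] by simp

lemma smooth_on_compose:
  fixes f :: "'a::euclidean_space \<Rightarrow> 'b::euclidean_space" and g :: "'b \<Rightarrow> 'c::real_normed_vector"
  shows "open S \<Longrightarrow> open T \<Longrightarrow> (\<And>x. x \<in> S \<Longrightarrow> f x \<in> T) \<Longrightarrow> smooth_on f S \<Longrightarrow> smooth_on g T
    \<Longrightarrow> smooth_on (\<lambda>x. g (f x)) S"
  unfolding smooth_on_def using Cm_on_compose[of S T f _ g] by simp

lemma smooth_on_linear_family:
  fixes M :: "'a::euclidean_space \<Rightarrow> 'b::euclidean_space \<Rightarrow> 'c::real_normed_vector"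
  assumes "open S" "\<And>x. x \<in> S \<Longrightarrow> linear (M x)" "\<And>b. smooth_on (\<lambda>x. M x b) S" "smooth_on f S"
  shows "smooth_on (\<lambda>x. M x (f x)) S"
  using assms unfolding smooth_on_def by (intro allI Cm_on_linear_family[of S M _ f]) simp_all

lemma fderiv_linear_family_expansion:
  fixes M :: "'a::euclidean_space \<Rightarrow> 'b::euclidean_space \<Rightarrow> 'c::real_normed_vector"
  assumes \<Omega>: "open \<Omega>" and lin: "\<And>w. w \<in> \<Omega> \<Longrightarrow> linear (M w)"
    and M: "\<And>b. smooth_on (\<lambda>w. M w b) \<Omega>" and w: "w \<in> \<Omega>"
  shows "fderiv (\<lambda>w. M w v) w k = (\<Sum>b\<in>Basis. (v \<bullet> b) *\<^sub>R fderiv (\<lambda>w. M w b) w k)"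
proof -
  have "((\<lambda>w. \<Sum>b\<in>Basis. (v \<bullet> b) *\<^sub>R M w b) has_derivative
      (\<lambda>k. \<Sum>b\<in>Basis. (v \<bullet> b) *\<^sub>R fderiv (\<lambda>w. M w b) w k)) (at w)"
    by (intro has_derivative_sum has_derivative_scaleR_right smooth_on_has_derivative[OF M w])
  then have "((\<lambda>w. M w v) has_derivative
      (\<lambda>k. \<Sum>b\<in>Basis. (v \<bullet> b) *\<^sub>R fderiv (\<lambda>w. M w b) w k)) (at w)"
    by (rule has_derivative_transform_within_open[OF _ \<Omega> w])
      (simp flip: linear_Basis_expansion[OF lin])
  from fun_cong[OF fderiv_eq[OF this]] show ?thesis .
qed

text \<open>The smoothness of a family of linear maps is recorded vector by vector. Expanding the moving
  argument in the standard basis makes this sufficient for a product rule.\<close>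

lemma has_derivative_linear_family:
  fixes M :: "'a::euclidean_space \<Rightarrow> 'b::euclidean_space \<Rightarrow> 'c::real_normed_vector"
    and x :: "'d::real_normed_vector"
  assumes \<Omega>: "open \<Omega>" and lin: "\<And>w. w \<in> \<Omega> \<Longrightarrow> linear (M w)"
    and M: "\<And>b. smooth_on (\<lambda>w. M w b) \<Omega>"
    and g: "(g has_derivative g') (at x)" "g x \<in> \<Omega>" and f: "(f has_derivative f') (at x)"
  shows "((\<lambda>y. M (g y) (f y)) has_derivative
    (\<lambda>u. fderiv (\<lambda>w. M w (f x)) (g x) (g' u) + M (g x) (f' u))) (at x)"
proof -
  let ?DM = "\<lambda>b. fderiv (\<lambda>w. M w b) (g x)"
  have expand: "?DM v k = (\<Sum>b\<in>Basis. (v \<bullet> b) *\<^sub>R ?DM b k)" for v k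
    by (rule fderiv_linear_family_expansion[OF \<Omega> lin M g(2)])
  have Mb: "((\<lambda>y. M (g y) b) has_derivative (\<lambda>u. ?DM b (g' u))) (at x)" for b
    by (rule has_derivative_compose[where g = "\<lambda>w. M w b", OF g(1) smooth_on_has_derivative[OF M g(2)]])
  have "((\<lambda>y. \<Sum>b\<in>Basis. (f y \<bullet> b) *\<^sub>R M (g y) b) has_derivative
      (\<lambda>u. \<Sum>b\<in>Basis. (f x \<bullet> b) *\<^sub>R ?DM b (g' u) + (f' u \<bullet> b) *\<^sub>R M (g x) b)) (at x)"
    by (intro has_derivative_sum has_derivative_scaleR has_derivative_inner_left Mb f)
  moreover have "(\<lambda>u. \<Sum>b\<in>Basis. (f x \<bullet> b) *\<^sub>R ?DM b (g' u) + (f' u \<bullet> b) *\<^sub>R M (g x) b)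
      = (\<lambda>u. ?DM (f x) (g' u) + M (g x) (f' u))"
    unfolding sum.distrib expand[symmetric] linear_Basis_expansion[OF lin[OF g(2)], symmetric] ..
  ultimately have *: "((\<lambda>y. \<Sum>b\<in>Basis. (f y \<bullet> b) *\<^sub>R M (g y) b) has_derivative
      (\<lambda>u. ?DM (f x) (g' u) + M (g x) (f' u))) (at x)" by simp
  have "eventually (\<lambda>y. g y \<in> \<Omega>) (at x)"
    using has_derivative_continuous[OF g(1)] \<Omega> g(2)
    by (simp add: continuous_within topological_tendstoD)
  then have ev: "eventually (\<lambda>y. (\<Sum>b\<in>Basis. (f y \<bullet> b) *\<^sub>R M (g y) b) = M (g y) (f y)) (at x)"
    by eventually_elim (simp flip: linear_Basis_expansion[OF lin])
  show ?thesis
    by (rule has_derivative_transform_eventually[OF * ev])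
      (simp_all flip: linear_Basis_expansion[OF lin[OF g(2)]])
qed

lemma fderiv_compose:
  assumes "(f has_derivative f') (at x)" "(g has_derivative g') (at (f x))"
  shows "fderiv (\<lambda>x. g (f x)) x v = g' (f' v)"
  using fderiv_eq[OF has_derivative_compose[OF assms]] by simp

section \<open>Linear systems with smooth data and smooth inverse functions\<close>

text \<open>The solution is a component of the inverse of the map \<open>(x, y) \<mapsto> (x, M x y)\<close>, which makes it
  continuous and differentiable. Its partial derivatives solve the system with the same \<open>M\<close> and the
  right-hand side \<open>\<partial>c - (\<partial>M) w\<close>, and so \<open>w\<close> gains one order of differentiability at a time.\<close>

lemma Cm_on_solve_linear:
  fixes M :: "'a::euclidean_space \<Rightarrow> 'b::euclidean_space \<Rightarrow> 'b"
  assumes S: "open S" and lin: "\<And>x. x \<in> S \<Longrightarrow> linear (M x)" and inj: "\<And>x. x \<in> S \<Longrightarrow> inj (M x)"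
    and M: "\<And>b. Cm_on m (\<lambda>x. M x b) S" and c: "Cm_on m c S" and w: "\<And>x. x \<in> S \<Longrightarrow> M x (w x) = c x"
  shows "Cm_on m w S"
  using M c w
proof (induction m arbitrary: c w)
  case 0
  define f where "f = (\<lambda>z. (fst z, \<Sum>b\<in>Basis. (snd z \<bullet> b) *\<^sub>R M (fst z) b))"
  have f: "f (x, y) = (x, M x y)" if "x \<in> S" for x y
    using linear_Basis_expansion[OF lin[OF that], of y] by (simp add: f_def)
  have "continuous_on (S \<times> UNIV) (\<lambda>z. M (fst z) b)" for b
    using 0(1)[of b] using continuous_on_compose2[of S "\<lambda>x. M x b" "S \<times> UNIV" fst] continuous_on_fst[OF continuous_on_id]
    by auto
  then have "continuous_on (S \<times> UNIV) f"
    unfolding f_def by (intro continuous_intros)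
  moreover have "inj_on f (S \<times> UNIV)"
    unfolding inj_on_def
  proof clarify
    fix x y x' y' assume "x \<in> S" "x' \<in> S" "f (x, y) = f (x', y')"
    then have "(x, M x y) = (x', M x' y')" using f by metis
    then have "x = x'" "M x y = M x y'" by auto
    then show "x = x' \<and> y = y'" using injD[OF inj[OF \<open>x \<in> S\<close>]] by simp
  qed
  ultimately obtain g where g: "homeomorphism (S \<times> UNIV) (f ` (S \<times> UNIV)) f g"
    using invariance_of_domain_homeomorphism[of "S \<times> UNIV" f] S by (auto simp: open_Times)
  have eq: "snd (g (x, c x)) = w x" if "x \<in> S" for x
    using homeomorphism_apply1[OF g, of "(x, w x)"] that 0(3) by (simp add: f)
  have "continuous_on S (\<lambda>x. g (x, c x))"
  proof (rule continuous_on_compose2[OF homeomorphism_cont2[OF g]])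
    show "continuous_on S (\<lambda>x. (x, c x))" using 0 by (auto intro!: continuous_intros)
    show "(\<lambda>x. (x, c x)) ` S \<subseteq> f ` (S \<times> UNIV)"
    proof clarify
      fix x assume "x \<in> S"
      then have "(x, c x) = f (x, w x)" using 0(3) by (simp add: f)
      then show "(x, c x) \<in> f ` (S \<times> UNIV)" using \<open>x \<in> S\<close> by auto
    qed
  qed
  then have "continuous_on S (\<lambda>x. snd (g (x, c x)))" by (rule continuous_on_snd)
  then show ?case using eq by (simp cong: continuous_on_cong)
next
  case (Suc m)
  define M' where "M' = (\<lambda>x b. fderiv (\<lambda>x. M x b) x)"
  have M': "((\<lambda>x. M x b) has_derivative M' x b) (at x)" if "x \<in> S" for x b
    using Cm_on_SucD[OF Suc.prems(1) that] by (simp add: M'_def)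
  define f where "f = (\<lambda>z. (fst z, \<Sum>b\<in>Basis. (snd z \<bullet> b) *\<^sub>R M (fst z) b))"
  have f: "f (x, y) = (x, M x y)" if "x \<in> S" for x y
    using linear_Basis_expansion[OF lin[OF that], of y] by (simp add: f_def)
  define f' where "f' = (\<lambda>x y v. (fst v, \<Sum>b\<in>Basis. (y \<bullet> b) *\<^sub>R M' x b (fst v) + (snd v \<bullet> b) *\<^sub>R M x b))"
  have derf: "(f has_derivative f' x y) (at (x, y))" if "x \<in> S" for x y
    unfolding f_def f'_def
    by (rule has_derivative_eq_rhs,
        (rule derivative_intros has_derivative_compose[OF has_derivative_fst[OF has_derivative_ident]]
          | (simp, rule M'[OF that]))+) auto
  define g where "g = (\<lambda>z. (fst z, inv (M (fst z)) (snd z)))"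
  have gf: "g (f z) = z" if "z \<in> S \<times> UNIV" for z
  proof -
    have "f z = (fst z, M (fst z) (snd z))" using f[of "fst z" "snd z"] that by auto
    then show ?thesis using inj[of "fst z"] that by (auto simp: g_def inv_f_f)
  qed
  have contf: "continuous_on (S \<times> UNIV) f"
    using derf by (intro differentiable_imp_continuous_on)
      (auto simp: differentiable_on_def differentiable_def intro: has_derivative_at_withinI)
  have dw: "w differentiable (at x)" if x: "x \<in> S" for x
  proof -
    have linf': "linear (f' x (w x))" using derf[OF x] has_derivative_linear by blast
    have inj_f': "inj (f' x (w x))"
      unfolding linear_injective_0[OF linf']
    proof clarify
      fix h k assume "f' x (w x) (h, k) = 0"
      then have "h = 0" and "(\<Sum>b\<in>Basis. (k \<bullet> b) *\<^sub>R M x b) = 0"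
        using linear_0[OF has_derivative_linear[OF M'[OF x]]] by (auto simp: f'_def zero_prod_def)
      then have "M x k = 0" using linear_Basis_expansion[OF lin[OF x], of k] by simp
      then have "k = 0" using linear_injective_0[OF lin[OF x]] inj[OF x] by blast
      with \<open>h = 0\<close> show "(h, k) = 0" by (simp add: zero_prod_def)
    qed
    obtain g' where "linear g'" and "f' x (w x) \<circ> g' = id"
      using linear_injective_isomorphism[OF linf' inj_f'] by (auto simp: fun_eq_iff)
    then have "(g has_derivative g') (at (f (x, w x)))"
      using has_derivative_inverse_strong[of "S \<times> UNIV" "(x, w x)" f g "f' x (w x)" g']
        S x contf gf derf[OF x] by (auto simp: open_Times)
    moreover have "((\<lambda>x. (x, c x)) has_derivative (\<lambda>v. (v, fderiv c x v))) (at x)"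
      by (intro has_derivative_Pair has_derivative_ident Cm_on_SucD[OF Suc.prems(2) x])
    ultimately have "((\<lambda>x. g (x, c x)) has_derivative (\<lambda>v. g' (v, fderiv c x v))) (at x)"
      using has_derivative_compose[where f = "\<lambda>x. (x, c x)" and g = g] Suc.prems(3)[OF x] f[OF x] by simp
    from has_derivative_snd[OF this]
    have "(w has_derivative (\<lambda>v. snd (g' (v, fderiv c x v)))) (at x)"
    proof (rule has_derivative_transform_within_open[OF _ S x])
      fix x' assume "x' \<in> S"
      then show "snd (g (x', c x')) = w x'"
        using inj by (simp add: g_def flip: Suc.prems(3))
    qed
    then show ?thesis by (auto simp: differentiable_def)
  qed
  have "Cm_on m w S"
    by (rule Suc.IH[OF Cm_on_lower[OF Suc.prems(1)] Cm_on_lower[OF Suc.prems(2)] Suc.prems(3)])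
  have eq: "M x (fderiv w x v) = fderiv c x v - (\<Sum>b\<in>Basis. (w x \<bullet> b) *\<^sub>R M' x b v)"
    if x: "x \<in> S" for x v
  proof -
    have w': "(w has_derivative fderiv w x) (at x)" using dw[OF x] frechet_derivative_works by blast
    have "((\<lambda>x. \<Sum>b\<in>Basis. (w x \<bullet> b) *\<^sub>R M x b) has_derivative
       (\<lambda>v. \<Sum>b\<in>Basis. (w x \<bullet> b) *\<^sub>R M' x b v + (fderiv w x v \<bullet> b) *\<^sub>R M x b)) (at x)"
      by (intro has_derivative_sum has_derivative_scaleR has_derivative_inner_left M'[OF x] w')
    then have "(c has_derivative
       (\<lambda>v. \<Sum>b\<in>Basis. (w x \<bullet> b) *\<^sub>R M' x b v + (fderiv w x v \<bullet> b) *\<^sub>R M x b)) (at x)"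
    proof (rule has_derivative_transform_within_open[OF _ S x])
      fix x' assume "x' \<in> S"
      then show "(\<Sum>b\<in>Basis. (w x' \<bullet> b) *\<^sub>R M x' b) = c x'"
        using linear_Basis_expansion[OF lin] by (simp flip: Suc.prems(3))
    qed
    from fderiv_eq[OF this] have "fderiv c x v =
      (\<Sum>b\<in>Basis. (w x \<bullet> b) *\<^sub>R M' x b v) + (\<Sum>b\<in>Basis. (fderiv w x v \<bullet> b) *\<^sub>R M x b)"
      by (simp add: sum.distrib)
    then show ?thesis
      using linear_Basis_expansion[OF lin[OF x], of "fderiv w x v"] by simp
  qed
  have "Cm_on m (\<lambda>x. fderiv w x v) S" for v
  proof (rule Suc.IH[OF Cm_on_lower[OF Suc.prems(1)] _ eq])
    show "Cm_on m (\<lambda>x. fderiv c x v - (\<Sum>b\<in>Basis. (w x \<bullet> b) *\<^sub>R M' x b v)) S"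
      unfolding M'_def using \<open>Cm_on m w S\<close> Suc.prems(1,2) S
      by (intro Cm_on_diff Cm_on_sum Cm_on_scaleR Cm_on_inner Cm_on_const Cm_on_Suc_fderiv)
  qed
  then show ?case using dw by simp
qed

lemma smooth_on_solve_linear:
  fixes M :: "'a::euclidean_space \<Rightarrow> 'b::euclidean_space \<Rightarrow> 'b"
  assumes "open S" and "\<And>x. x \<in> S \<Longrightarrow> linear (M x)" and "\<And>x. x \<in> S \<Longrightarrow> inj (M x)"
    and "\<And>b. smooth_on (\<lambda>x. M x b) S" and "smooth_on c S" and "\<And>x. x \<in> S \<Longrightarrow> M x (w x) = c x"
  shows "smooth_on w S"
  unfolding smooth_on_def
  by (intro allI Cm_on_solve_linear[OF assms(1-3) _ _ assms(6)] smooth_onD assms(4,5))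

lemma continuous_on_linear_family:
  fixes M :: "'a::topological_space \<Rightarrow> 'b::euclidean_space \<Rightarrow> 'c::real_normed_vector"
  assumes "\<And>x. x \<in> S \<Longrightarrow> linear (M x)" "\<And>b. continuous_on S (\<lambda>x. M x b)" "continuous_on S f"
  shows "continuous_on S (\<lambda>x. M x (f x))"
proof -
  have "continuous_on S (\<lambda>x. \<Sum>b\<in>Basis. (f x \<bullet> b) *\<^sub>R M x b)"
    using assms(2,3) by (intro continuous_intros)
  then show ?thesis
    using linear_Basis_expansion[OF assms(1)] by (simp cong: continuous_on_cong)
qed

text \<open>The derivative of the inverse \<open>g\<close> at \<open>y\<close> solves a linear system with the coefficients
  \<open>fderiv f (g y)\<close>, which are as smooth as \<open>g\<close>; so \<open>g\<close> is one order smoother than already known.\<close>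

lemma smooth_inverse_function:
  fixes f :: "'e::euclidean_space \<Rightarrow> 'e"
  assumes S: "open S" "x0 \<in> S" and f: "smooth_on f S" and inj: "inj (fderiv f x0)"
  obtains U V g where "open U" "U \<subseteq> S" "x0 \<in> U" "open V" "homeomorphism U V f g" "smooth_on g V"
    "\<And>y. y \<in> V \<Longrightarrow> (g has_derivative inv (fderiv f (g y))) (at y)"
    "\<And>x. x \<in> U \<Longrightarrow> bij (fderiv f x)"
proof -
  define f' where "f' = (\<lambda>x. Blinfun (fderiv f x))"
  have lin: "linear (fderiv f x)" if "x \<in> S" for x
    using linear_fderiv_smooth_on[OF f that] .
  have f': "blinfun_apply (f' x) = fderiv f x" if "x \<in> S" for x
    unfolding f'_def using lin[OF that]
    by (simp add: bounded_linear_Blinfun_apply linear_conv_bounded_linear)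
  have der: "(f has_derivative blinfun_apply (f' x)) (at x)" if "x \<in> S" for x
    unfolding f'[OF that] by (rule smooth_on_has_derivative[OF f that])
  have "continuous_on S (\<lambda>x. blinfun_apply (f' x) i)" for i
    using smooth_on_imp_continuous_on[OF smooth_on_fderiv[OF f, of i]] f' by (simp cong: continuous_on_cong)
  then have cont: "continuous_on S f'"
    using continuous_on_blinfun_componentwise by blast
  obtain h where h: "linear h" "\<And>x. h (fderiv f x0 x) = x"
    using linear_injective_left_inverse[OF lin[OF S(2)] inj] by (auto simp: fun_eq_iff)
  have "Blinfun h o\<^sub>L f' x0 = id_blinfun"
    using h S f' by (intro blinfun_eqI)
      (simp add: bounded_linear_Blinfun_apply linear_conv_bounded_linear)
  from inverse_function_theorem[OF S(1) der cont S(2) this]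
  obtain U V g g' where g: "open U" "U \<subseteq> S" "x0 \<in> U" "open V" "f x0 \<in> V" and hom: "homeomorphism U V f g"
    and g': "\<And>y. y \<in> V \<Longrightarrow> (g has_derivative (g' y)) (at y)"
    "\<And>y. y \<in> V \<Longrightarrow> g' y = inv (blinfun_apply (f'(g y)))"
    and bij: "\<And>y. y \<in> V \<Longrightarrow> bij (blinfun_apply (f'(g y)))"
    by metis
  have gU: "g y \<in> U" "g y \<in> S" if "y \<in> V" for y
    using hom that g(2) by (auto simp: homeomorphism_def)
  have derg: "(g has_derivative inv (fderiv f (g y))) (at y)" if "y \<in> V" for y
    using g'[OF that] f'[OF gU(2)[OF that]] by simp
  have bij': "bij (fderiv f (g y))" if "y \<in> V" for y
    using bij[OF that] f'[OF gU(2)[OF that]] by simp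
  have Cm: "Cm_on m g V" for m
  proof (induction m)
    case 0
    then show ?case using hom by (simp add: homeomorphism_def)
  next
    case (Suc m)
    show ?case
    proof (rule Cm_on_SucI[OF g(4) derg])
      fix v
      show "Cm_on m (\<lambda>y. inv (fderiv f (g y)) v) V"
      proof (rule Cm_on_solve_linear[OF g(4), where M = "\<lambda>y. fderiv f (g y)" and c = "\<lambda>y. v"])
        show "Cm_on m (\<lambda>y. fderiv f (g y) b) V" for b
          using gU(2) by (intro Cm_on_compose[OF g(4) S(1) _ Suc] smooth_onD smooth_on_fderiv[OF f])
      next
        fix y assume "y \<in> V"
        then show "linear (fderiv f (g y))" "inj (fderiv f (g y))" "fderiv f (g y) (inv (fderiv f (g y)) v) = v"
          using lin gU bij' by (auto simp: bij_is_inj bij_is_surj surj_f_inv_f)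
      qed (rule Cm_on_const)
    qed
  qed
  have "bij (fderiv f x)" if "x \<in> U" for x
    using bij'[of "f x"] hom that by (auto simp: homeomorphism_def)
  with that[OF g(1-4) hom] Cm derg show ?thesis
    by (simp add: smooth_on_def)
qed

section \<open>Integral equations along rays\<close>

text \<open>The retraction \<open>\<rho>\<close> onto \<open>D\<close> extends the equation to the whole space, and the right-hand
  side becomes a contraction of the Banach space of bounded continuous functions.\<close>

lemma integral_fixed_point:
  fixes H :: "real \<Rightarrow> 'e::euclidean_space \<Rightarrow> 'f::euclidean_space \<Rightarrow> 'f" and \<sigma> :: "real \<Rightarrow> 'e \<Rightarrow> 'e"
  assumes D: "compact D" "convex D" "D \<noteq> {}"
    and \<sigma>: "continuous_on ({0..1} \<times> D) (\<lambda>(s, p). \<sigma> s p)"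
      "\<And>s p. s \<in> {0..1} \<Longrightarrow> p \<in> D \<Longrightarrow> \<sigma> s p \<in> D"
    and H: "continuous_on ({0..1} \<times> D \<times> UNIV) (\<lambda>(s, p, w). H s p w)"
    and \<theta>: "0 \<le> \<theta>" "\<theta> < 1"
    and contr: "\<And>s p w w'. s \<in> {0..1} \<Longrightarrow> p \<in> D \<Longrightarrow> norm (H s p w - H s p w') \<le> \<theta> * norm (w - w')"
  obtains \<psi> where "continuous_on D \<psi>"
    "\<And>p. p \<in> D \<Longrightarrow> \<psi> p = integral {0..1} (\<lambda>s. H s p (\<psi> (\<sigma> s p)))"
proof -
  define \<rho> where "\<rho> = closest_point D"
  have "closed D" using D(1) compact_imp_closed by blast
  then have \<rho>: "\<rho> p \<in> D" "continuous_on UNIV \<rho>" for p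
    unfolding \<rho>_def using D by (auto intro!: closest_point_in_set continuous_on_closest_point)
  have \<rho>_id: "\<rho> p = p" if "p \<in> D" for p
    unfolding \<rho>_def using that by (rule closest_point_self)
  define T where "T = (\<lambda>g :: 'e \<Rightarrow>\<^sub>C 'f. \<lambda>p. integral {0..1} (\<lambda>s. H s p (g (\<sigma> s p))))"
  have contH: "continuous_on (D \<times> {0..1}) (\<lambda>(p, s). H s p (g (\<sigma> s p)))" for g :: "'e \<Rightarrow>\<^sub>C 'f"
  proof -
    have "continuous_on (D \<times> {0..1}) (\<lambda>x. \<sigma> (snd x) (fst x))"
    proof -
      have a: "continuous_on (D \<times> {0..1}) (\<lambda>x. (snd x :: real, fst x))"
        by (intro continuous_intros)
      have b: "(\<lambda>x. (snd x :: real, fst x)) ` (D \<times> {0..1}) \<subseteq> {0..1} \<times> D" by auto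
      show ?thesis using continuous_on_compose2[OF \<sigma>(1) a b] by simp
    qed
    then have "continuous_on (D \<times> {0..1}) (\<lambda>x. g (\<sigma> (snd x) (fst x)))"
      using continuous_on_compose2[of UNIV "apply_bcontfun g"] continuous_on_apply_bcontfun[of UNIV g]
      by auto
    then show ?thesis
    proof -
      assume c: "continuous_on (D \<times> {0..1}) (\<lambda>x. g (\<sigma> (snd x) (fst x)))"
      have a: "continuous_on (D \<times> {0..1}) (\<lambda>x. (snd x, fst x, g (\<sigma> (snd x) (fst x))))"
        by (intro continuous_intros c)
      have b: "(\<lambda>x. (snd x, fst x, g (\<sigma> (snd x) (fst x)))) ` (D \<times> {0..1}) \<subseteq> {0..1} \<times> D \<times> UNIV"
        by auto
      show ?thesis using continuous_on_compose2[OF H a b] by (simp add: split_beta)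
    qed
  qed
  have contT: "continuous_on D (T g)" for g
    unfolding T_def using integral_continuous_on_param[of D 0 "1::real"] contH[of g] by simp
  have contHs: "continuous_on {0..1} (\<lambda>s. H s p (g (\<sigma> s p)))" if "p \<in> D" for g :: "'e \<Rightarrow>\<^sub>C 'f" and p
  proof -
    have a: "continuous_on {0..1} (\<lambda>s::real. (p, s))" by (intro continuous_intros)
    have b: "(\<lambda>s::real. (p, s)) ` {0..1} \<subseteq> D \<times> {0..1}" using that by auto
    show ?thesis using continuous_on_compose2[OF contH[of g] a b] by simp
  qed
  have bc: "(\<lambda>p. T g (\<rho> p)) \<in> bcontfun" for g
  proof -
    have "bounded (T g ` D)"
      by (intro compact_imp_bounded compact_continuous_image contT D)
    then obtain b where "\<And>p. p \<in> D \<Longrightarrow> norm (T g p) \<le> b" by (auto simp: bounded_iff)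
    moreover have "continuous_on UNIV (\<lambda>p. T g (\<rho> p))"
      using continuous_on_compose2[OF contT \<rho>(2)] \<rho>(1) by auto
    ultimately show ?thesis using \<rho>(1) by (intro bcontfun_normI[of _ b]) auto
  qed
  define \<Phi> where "\<Phi> = (\<lambda>g. Bcontfun (\<lambda>p. T g (\<rho> p)))"
  have \<Phi>: "apply_bcontfun (\<Phi> g) = (\<lambda>p. T g (\<rho> p))" for g
    unfolding \<Phi>_def by (rule Bcontfun_inverse[OF bc])
  have "dist (\<Phi> g) (\<Phi> h) \<le> \<theta> * dist g h" for g h
  proof (rule dist_bound)
    fix p
    have p: "\<rho> p \<in> D" by (rule \<rho>)
    have "T g (\<rho> p) - T h (\<rho> p) = integral {0..1} (\<lambda>s. H s (\<rho> p) (g (\<sigma> s (\<rho> p))) - H s (\<rho> p) (h (\<sigma> s (\<rho> p))))"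
      unfolding T_def
      by (rule integral_diff[symmetric]) (intro integrable_continuous_real contHs p)+
    also have "norm \<dots> \<le> (\<theta> * dist g h) * (1 - 0)"
    proof (rule integral_bound)
      show "continuous_on {0..1} (\<lambda>s. H s (\<rho> p) (g (\<sigma> s (\<rho> p))) - H s (\<rho> p) (h (\<sigma> s (\<rho> p))))"
        by (intro continuous_on_diff contHs p)
      fix t :: real assume t: "t \<in> {0..1}"
      have "norm (H t (\<rho> p) (g (\<sigma> t (\<rho> p))) - H t (\<rho> p) (h (\<sigma> t (\<rho> p))))
          \<le> \<theta> * norm (g (\<sigma> t (\<rho> p)) - h (\<sigma> t (\<rho> p)))"
        by (rule contr[OF t p])
      also have "\<dots> \<le> \<theta> * dist g h"
        using \<theta>(1) dist_bounded[of g _ h] by (intro mult_left_mono) (auto simp: dist_norm)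
      finally show "norm (H t (\<rho> p) (g (\<sigma> t (\<rho> p))) - H t (\<rho> p) (h (\<sigma> t (\<rho> p)))) \<le> \<theta> * dist g h" .
    qed simp
    finally show "dist (\<Phi> g p) (\<Phi> h p) \<le> \<theta> * dist g h"
      by (simp add: \<Phi> dist_norm)
  qed
  then obtain g where g: "\<Phi> g = g"
    using banach_fix_type[OF \<theta>, of \<Phi>] by blast
  then have "g p = T g p" if "p \<in> D" for p
    using \<Phi>[of g] \<rho>_id[OF that] by metis
  then show ?thesis
    using that[OF continuous_on_apply_bcontfun[of D g]] by (simp add: T_def)
qed

text \<open>Uniformity over \<open>K\<close> permits linearising an integrand at all points of a ray at the same time.\<close>

lemma uniform_linearization:
  fixes f :: "'a::euclidean_space \<Rightarrow> 'b::real_normed_vector"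
  assumes f: "Cm_on (Suc 0) f W" and W: "open W" and K: "compact K" "K \<subseteq> W" and e: "e > 0"
  obtains d where "d > 0" "\<And>x h. x \<in> K \<Longrightarrow> norm h \<le> d \<Longrightarrow>
    x + h \<in> W \<and> norm (f (x + h) - f x - fderiv f x h) \<le> e * norm h"
proof -
  obtain r where r: "r > 0" "(\<Union>x\<in>K. cball x r) \<subseteq> W"
    using compact_subset_open_imp_cball_epsilon_subset[OF K(1) W K(2)] .
  define K' where "K' = (\<Union>x\<in>K. cball x r)"
  have "compact K'"
    unfolding K'_def by (rule compact_minkowski_sum_cball[OF K(1)])
  have "\<exists>d>0. \<forall>x\<in>K'. \<forall>y\<in>K'. dist y x < d \<longrightarrow> dist (fderiv f y b) (fderiv f x b) < e / DIM('a)" for b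
  proof -
    have "continuous_on K' (\<lambda>x. fderiv f x b)"
      using Cm_on_subset[OF Cm_on_Suc_fderiv[OF f], of K' b] r(2) by (simp add: K'_def)
    then have "uniformly_continuous_on K' (\<lambda>x. fderiv f x b)"
      using \<open>compact K'\<close> compact_uniformly_continuous by blast
    then show ?thesis
      unfolding uniformly_continuous_on_def using e by simp
  qed
  then obtain d where d: "\<And>b. d b > 0"
    "\<And>b x y. x \<in> K' \<Longrightarrow> y \<in> K' \<Longrightarrow> dist y x < d b \<Longrightarrow> dist (fderiv f y b) (fderiv f x b) < e / DIM('a)"
    by metis
  define \<delta> where "\<delta> = min r (Min (d ` Basis) / 2)"
  have "Min (d ` Basis) > 0" using d(1) by simp
  then have \<delta>: "\<delta> > 0" "\<delta> \<le> r" using r(1) by (auto simp: \<delta>_def)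
  have \<delta>b: "\<delta> < d b" if "b \<in> Basis" for b
  proof -
    have "\<delta> \<le> Min (d ` Basis) / 2" unfolding \<delta>_def by (rule min.cobounded2)
    also have "\<dots> < Min (d ` Basis)" using \<open>Min (d ` Basis) > 0\<close> by simp
    also have "\<dots> \<le> d b" using that by simp
    finally show ?thesis .
  qed
  show ?thesis
  proof (rule that[OF \<delta>(1)])
    fix x h :: 'a assume x: "x \<in> K" and h: "norm h \<le> \<delta>"
    have sub: "cball x \<delta> \<subseteq> K'" using x \<delta>(2) by (auto simp: K'_def)
    have subW: "cball x \<delta> \<subseteq> W" using sub r(2) by (auto simp: K'_def)
    have xc: "x \<in> cball x \<delta>" using \<delta> by simp
    have "norm (f (x + h) - f x - fderiv f x (x + h - x)) \<le> norm (x + h - x) * e"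
    proof (rule differentiable_bound_linearization[where S = "cball x \<delta>"])
      fix t :: real assume "t \<in> {0..1}"
      then have "\<bar>t\<bar> * norm h \<le> 1 * \<delta>" using h \<delta>(1) by (intro mult_mono) auto
      then show "x + t *\<^sub>R (x + h - x) \<in> cball x \<delta>"
        by (simp add: dist_norm)
    next
      fix y assume y: "y \<in> cball x \<delta>"
      have "y \<in> W" "x \<in> W" using subW y xc by auto
      note der = Cm_on_SucD[OF f this(1)] Cm_on_SucD[OF f this(2)]
      show "(f has_derivative fderiv f y) (at y within cball x \<delta>)"
        by (rule has_derivative_at_withinI[OF der(1)])
      note lin = has_derivative_linear[OF der(1)] has_derivative_linear[OF der(2)]
      show "onorm (fderiv f y - fderiv f x) \<le> e"
      proof (rule onorm_le)
        fix v
        have "norm (fderiv f y v - fderiv f x v) \<le> (\<Sum>b\<in>Basis. norm (fderiv f y b - fderiv f x b)) * norm v"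
          by (rule linear_norm_le_Basis_sum[OF linear_compose_sub[OF lin]])
        also have "\<dots> \<le> (\<Sum>b\<in>(Basis::'a set). e / DIM('a)) * norm v"
        proof (intro mult_right_mono sum_mono)
          fix b :: 'a assume b: "b \<in> Basis"
          have "dist y x < d b" using y \<delta>b[OF b] by (simp add: dist_commute)
          then have "dist (fderiv f y b) (fderiv f x b) < e / DIM('a)"
            using d(2) sub y xc by (meson subsetD)
          then show "norm (fderiv f y b - fderiv f x b) \<le> e / DIM('a)" by (simp add: dist_norm)
        qed simp
        also have "\<dots> = e * norm v" by simp
        finally show "norm ((fderiv f y - fderiv f x) v) \<le> e * norm v" by simp
      qed
    qed (rule xc)
    moreover have "x + h \<in> W" using subW h by (auto simp: dist_norm)
    ultimately show "x + h \<in> W \<and> norm (f (x + h) - f x - fderiv f x h) \<le> e * norm h"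
      by (simp add: mult.commute)
  qed
qed

text \<open>This takes the place of Gronwall's inequality: at a point where \<open>f\<close> is maximal the hypothesis
  bounds the maximum \<open>M\<close> by \<open>a + \<theta> M\<close>.\<close>

lemma bound_by_own_maximum:
  fixes f :: "real \<Rightarrow> real"
  assumes "continuous_on {0..1} f" "\<theta> < 1"
    and "\<And>r M. r \<in> {0..1} \<Longrightarrow> (\<And>s. s \<in> {0..1} \<Longrightarrow> f s \<le> M) \<Longrightarrow> f r \<le> a + \<theta> * M"
    and "r \<in> {0..1}"
  shows "f r \<le> a / (1 - \<theta>)"
proof -
  obtain r0 where r0: "r0 \<in> {0..1}" "\<And>s. s \<in> {0..1} \<Longrightarrow> f s \<le> f r0"
    using continuous_attains_sup[OF compact_Icc _ assms(1)] by auto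
  have "f r0 \<le> a + \<theta> * f r0" by (rule assms(3)[OF r0])
  then have "f r0 \<le> a / (1 - \<theta>)" using assms(2) by (simp add: field_simps)
  then show ?thesis using r0(2)[OF assms(4)] by simp
qed

definition proj :: "'e::euclidean_space set \<Rightarrow> 'e \<Rightarrow> 'e" where
  "proj B p = (\<Sum>b\<in>B. (p \<bullet> b) *\<^sub>R b)"

text \<open>For \<open>s\<close> from 0 to 1 this is the segment parallel to \<open>span B\<close> from the transversal
  \<open>span (Basis - B)\<close> to \<open>p\<close>, the ray of \<open>p\<close>.\<close>

definition shrink :: "'e::euclidean_space set \<Rightarrow> real \<Rightarrow> 'e \<Rightarrow> 'e" where
  "shrink B s p = p + (s - 1) *\<^sub>R proj B p"

lemma linear_proj: "linear (proj B)"
  unfolding proj_def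
  by (intro linearI) (simp_all add: inner_add_left scaleR_add_left sum.distrib scaleR_sum_right)

lemma linear_shrink: "linear (shrink B s)"
  unfolding shrink_def
  by (intro linearI) (simp_all add: linear_add[OF linear_proj] linear_scale[OF linear_proj] algebra_simps)

lemma proj_inner:
  assumes "B \<subseteq> Basis" "b \<in> Basis"
  shows "proj B p \<bullet> b = (if b \<in> B then p \<bullet> b else 0)"
proof -
  have fin: "finite B" using assms(1) finite_Basis finite_subset by blast
  have "proj B p \<bullet> b = (\<Sum>c\<in>B. if c = b then p \<bullet> b else 0)"
    unfolding proj_def inner_sum_left
    by (rule sum.cong) (use assms in \<open>auto simp: inner_Basis\<close>)
  then show ?thesis using fin by simp
qed

lemma shrink_inner:
  assumes "B \<subseteq> Basis" "b \<in> Basis"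
  shows "shrink B s p \<bullet> b = (if b \<in> B then s else 1) * (p \<bullet> b)"
  using proj_inner[OF assms, of p] by (simp add: shrink_def inner_add_left algebra_simps)

lemma proj_Basis:
  assumes "B \<subseteq> Basis" "b \<in> Basis"
  shows "proj B b = (if b \<in> B then b else 0)"
  by (rule euclidean_eqI) (use assms in \<open>auto simp: proj_inner inner_Basis\<close>)

lemma proj_proj: "B \<subseteq> Basis \<Longrightarrow> proj B (proj B p) = proj B p"
  by (rule euclidean_eqI) (simp add: proj_inner)

lemma norm_proj_le: "B \<subseteq> Basis \<Longrightarrow> norm (proj B p) \<le> norm p"
  by (rule norm_le_componentwise) (simp add: proj_inner)

lemma shrink_shrink: "B \<subseteq> Basis \<Longrightarrow> shrink B s (shrink B r p) = shrink B (s * r) p"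
  by (rule euclidean_eqI) (simp add: shrink_inner)

lemma shrink_1 [simp]: "shrink B 1 p = p"
  by (simp add: shrink_def)

lemma proj_shrink: "B \<subseteq> Basis \<Longrightarrow> proj B (shrink B s p) = s *\<^sub>R proj B p"
  by (rule euclidean_eqI) (simp add: shrink_inner proj_inner)

lemma norm_shrink_le: "B \<subseteq> Basis \<Longrightarrow> s \<in> {0..1} \<Longrightarrow> norm (shrink B s p) \<le> norm p"
  by (rule norm_le_componentwise) (auto simp: shrink_inner abs_mult mult_left_le_one_le)

lemma continuous_on_proj [continuous_intros]:
  "continuous_on S f \<Longrightarrow> continuous_on S (\<lambda>x. proj B (f x))"
  unfolding proj_def by (intro continuous_intros)

lemma continuous_on_shrink [continuous_intros]:
  "continuous_on S f \<Longrightarrow> continuous_on S g \<Longrightarrow> continuous_on S (\<lambda>x. shrink B (f x) (g x))"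
  unfolding shrink_def by (intro continuous_intros)

lemma fderiv_bound_on_compact:
  fixes f :: "'a::euclidean_space \<Rightarrow> 'b::real_normed_vector"
  assumes f: "Cm_on (Suc 0) f W" and K: "compact K" "K \<subseteq> W"
  obtains C where "C \<ge> 0" "\<And>x v. x \<in> K \<Longrightarrow> norm (fderiv f x v) \<le> C * norm v"
proof -
  have "\<exists>c. \<forall>x\<in>K. norm (fderiv f x b) \<le> c" for b
  proof -
    have "continuous_on K (\<lambda>x. fderiv f x b)"
      using Cm_on_subset[OF Cm_on_Suc_fderiv[OF f] K(2), of b] by simp
    then have "bounded ((\<lambda>x. fderiv f x b) ` K)"
      by (intro compact_imp_bounded compact_continuous_image K)
    then show ?thesis by (auto simp: bounded_iff)
  qed
  then obtain c where c: "\<And>x b. x \<in> K \<Longrightarrow> norm (fderiv f x b) \<le> c b" by metis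
  show ?thesis
  proof (rule that[of "\<Sum>b\<in>Basis. \<bar>c b\<bar>"])
    fix x v assume x: "x \<in> K"
    have lin: "linear (fderiv f x)"
      using Cm_on_SucD[OF f] K x has_derivative_linear by blast
    have "norm (fderiv f x v) \<le> (\<Sum>b\<in>Basis. norm (fderiv f x b)) * norm v"
      by (rule linear_norm_le_Basis_sum[OF lin])
    also have "\<dots> \<le> (\<Sum>b\<in>Basis. \<bar>c b\<bar>) * norm v"
      using c[OF x] by (intro mult_right_mono sum_mono) (auto intro: order_trans[OF _ abs_ge_self])
    finally show "norm (fderiv f x v) \<le> (\<Sum>b\<in>Basis. \<bar>c b\<bar>) * norm v" .
  qed (simp add: sum_nonneg)
qed

text \<open>An equation that expresses the value of \<open>\<psi>\<close> at \<open>p\<close> through its values on the ray of \<open>p\<close>.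
  Initial value problems with parameters have this form when time is rescaled to the unit interval; if
  \<open>H\<close> does not depend on its last argument, then \<open>\<psi>\<close> is a parametric integral. Since \<open>\<theta> < 1\<close>, the
  linearised equation is a contraction as well.\<close>

locale ray_integral_equation =
  fixes B :: "'e::euclidean_space set" and H :: "real \<times> 'e \<times> 'f::euclidean_space \<Rightarrow> 'f"
    and W :: "(real \<times> 'e \<times> 'f) set" and \<psi> :: "'e \<Rightarrow> 'f" and R \<theta> :: real
  assumes B: "B \<subseteq> Basis" and W: "open W" and H: "Cm_on (Suc 0) H W"
    and \<theta>: "0 \<le> \<theta>" "\<theta> < 1"
    and cont: "continuous_on (ball 0 R) \<psi>"
    and graph: "\<And>s p. s \<in> {0..1} \<Longrightarrow> p \<in> ball 0 R \<Longrightarrow> (s, p, \<psi> (shrink B s p)) \<in> W"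
    and contr: "\<And>s p k. s \<in> {0..1} \<Longrightarrow> p \<in> ball 0 R \<Longrightarrow>
      norm (fderiv H (s, p, \<psi> (shrink B s p)) (0, 0, k)) \<le> \<theta> * norm k"
    and eq: "\<And>p. p \<in> ball 0 R \<Longrightarrow> \<psi> p = integral {0..1} (\<lambda>s. H (s, p, \<psi> (shrink B s p)))"
begin

definition graph_point :: "real \<Rightarrow> 'e \<Rightarrow> real \<times> 'e \<times> 'f" where
  "graph_point s p = (s, p, \<psi> (shrink B s p))"

text \<open>The factor by which \<open>shrink B s\<close> scales the basis vector \<open>b\<close>.\<close>

definition weight :: "'e \<Rightarrow> real \<Rightarrow> real" where
  "weight b s = (if b \<in> B then s else 1)"

lemma linear_fderiv_H: "x \<in> W \<Longrightarrow> linear (fderiv H x)"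
  using Cm_on_SucD[OF H] has_derivative_linear by blast

lemma continuous_on_fderiv_H:
  assumes "continuous_on S x" "x ` S \<subseteq> W" "continuous_on S u"
  shows "continuous_on S (\<lambda>z. fderiv H (x z) (u z))"
proof (rule continuous_on_linear_family[OF _ _ assms(3)])
  show "linear (fderiv H (x z))" if "z \<in> S" for z
    using linear_fderiv_H assms(2) that by blast
  have "continuous_on W (\<lambda>y. fderiv H y b)" for b
    using Cm_on_Suc_fderiv[OF H, of b] by simp
  then show "continuous_on S (\<lambda>z. fderiv H (x z) b)" for b
    using continuous_on_compose2[OF _ assms(1,2)] by blast
qed

lemma shrink_in_ball: "s \<in> {0..1} \<Longrightarrow> p \<in> ball 0 r \<Longrightarrow> shrink B s p \<in> ball 0 r"
  using norm_shrink_le[OF B, of s p] by simp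

lemma shrink_in_cball: "s \<in> {0..1} \<Longrightarrow> p \<in> cball 0 r \<Longrightarrow> shrink B s p \<in> cball 0 r"
  using norm_shrink_le[OF B, of s p] by simp

lemma graph_point_in_W: "s \<in> {0..1} \<Longrightarrow> p \<in> ball 0 R \<Longrightarrow> graph_point s p \<in> W"
  unfolding graph_point_def by (rule graph)

lemma continuous_on_graph_point:
  assumes "continuous_on S s" "continuous_on S p" "s ` S \<subseteq> {0..1}" "p ` S \<subseteq> ball 0 R"
  shows "continuous_on S (\<lambda>z. graph_point (s z) (p z))"
proof -
  have "(\<lambda>z. shrink B (s z) (p z)) ` S \<subseteq> ball 0 R"
    using assms(3,4) shrink_in_ball by blast
  then have "continuous_on S (\<lambda>z. \<psi> (shrink B (s z) (p z)))"
    by (intro continuous_on_compose2[OF cont] continuous_intros assms)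
  then show ?thesis unfolding graph_point_def by (intro continuous_intros assms)
qed

lemma continuous_on_weight: "continuous_on S s \<Longrightarrow> continuous_on S (\<lambda>z. weight b (s z))"
  by (cases "b \<in> B") (simp_all add: weight_def)

text \<open>The candidate \<open>D b\<close> for the partial derivative in the direction \<open>b\<close> is the solution of the
  linearised equation. Let \<open>\<delta> r\<close> be the increment of \<open>\<psi>\<close> and \<open>\<Delta> r\<close> the increment predicted by
  \<open>D\<close> at the parameter \<open>r\<close> of the ray. The contraction property bounds \<open>\<delta>\<close> by a multiple of the
  displacement \<open>h\<close>. Then \<open>\<delta> - \<Delta>\<close> satisfies the linearised equation up to an error of smaller
  order than \<open>h\<close>, and is therefore itself of smaller order.\<close>

lemma solution_has_derivative:
  assumes \<rho>: "0 < \<rho>" "\<rho> < R"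
  shows "\<exists>D. (\<forall>b. continuous_on (cball 0 \<rho>) (D b)) \<and>
    (\<forall>b. \<forall>p\<in>cball 0 \<rho>.
       D b p = integral {0..1} (\<lambda>s. fderiv H (graph_point s p) (0, b, weight b s *\<^sub>R D b (shrink B s p)))) \<and>
    (\<forall>p\<in>ball 0 \<rho>. (\<psi> has_derivative (\<lambda>h. \<Sum>b\<in>Basis. (h \<bullet> b) *\<^sub>R D b p)) (at p))"
proof -
  have sub: "cball 0 \<rho> \<subseteq> (ball 0 R :: 'e set)" using \<rho> by auto
  have wt01: "\<bar>weight b s\<bar> \<le> 1" if "s \<in> {0..1}" for b s using that by (auto simp: weight_def)
  have "\<exists>D. continuous_on (cball 0 \<rho>) D \<and> (\<forall>p\<in>cball 0 \<rho>.
     D p = integral {0..1} (\<lambda>s. fderiv H (graph_point s p) (0, b, weight b s *\<^sub>R D (shrink B s p))))" for b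
  proof -
    let ?F = "\<lambda>s p w. fderiv H (graph_point s p) (0, b, weight b s *\<^sub>R w)"
    have 1: "continuous_on ({0..1} \<times> cball 0 \<rho> \<times> UNIV) (\<lambda>(s, p, w). ?F s p w)"
    proof -
      have im: "fst ` ({0..1} \<times> cball 0 \<rho> \<times> (UNIV :: 'f set)) \<subseteq> {0..1::real}"
        "(\<lambda>z. fst (snd z)) ` ({0..1::real} \<times> cball 0 \<rho> \<times> (UNIV :: 'f set)) \<subseteq> (ball 0 R :: 'e set)"
        using sub by auto
      have "(\<lambda>z. graph_point (fst z) (fst (snd z))) ` ({0..1} \<times> cball 0 \<rho> \<times> (UNIV :: 'f set)) \<subseteq> W"
        using sub graph_point_in_W by auto
      then show ?thesis
        unfolding split_beta
        by (intro continuous_on_fderiv_H continuous_on_graph_point im continuous_intros continuous_on_weight)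
    qed
    have 2: "norm (?F s p w - ?F s p w') \<le> \<theta> * norm (w - w')"
      if s: "s \<in> {0..1}" and p: "p \<in> cball 0 \<rho>" for s p w w'
    proof -
      have p': "p \<in> ball 0 R" using p sub by auto
      have "?F s p w - ?F s p w' = fderiv H (graph_point s p) (0, 0, weight b s *\<^sub>R (w - w'))"
        using linear_diff[OF linear_fderiv_H[OF graph_point_in_W[OF s p']],
            of "(0, b, weight b s *\<^sub>R w)" "(0, b, weight b s *\<^sub>R w')"]
        by (simp add: scaleR_diff_right)
      also have "norm \<dots> \<le> \<theta> * norm (weight b s *\<^sub>R (w - w'))"
        unfolding graph_point_def by (rule contr[OF s p'])
      also have "\<dots> \<le> \<theta> * norm (w - w')"
        using wt01[OF s, of b] \<theta>(1) by (intro mult_left_mono) (auto simp: mult_left_le_one_le)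
      finally show ?thesis .
    qed
    have 3: "continuous_on ({0..1} \<times> cball 0 \<rho>) (\<lambda>(s, p). shrink B s p)"
      unfolding split_beta by (intro continuous_intros)
    have ne: "cball 0 \<rho> \<noteq> ({} :: 'e set)" using \<rho> by simp
    show ?thesis
    proof (rule integral_fixed_point[where H = ?F and \<sigma> = "shrink B", OF compact_cball convex_cball ne 3 shrink_in_cball 1 \<theta> 2])
      fix D :: "'e \<Rightarrow> 'f"
      assume "continuous_on (cball 0 \<rho>) D"
        and "\<And>p. p \<in> cball 0 \<rho> \<Longrightarrow> D p = integral {0..1} (\<lambda>s. ?F s p (D (shrink B s p)))"
      then show ?thesis by (intro exI[of _ D] conjI ballI)
    qed
  qed
  then have "\<forall>b. \<exists>D. continuous_on (cball 0 \<rho>) D \<and> (\<forall>p\<in>cball 0 \<rho>.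
     D p = integral {0..1} (\<lambda>s. fderiv H (graph_point s p) (0, b, weight b s *\<^sub>R D (shrink B s p))))" ..
  from choice[OF this] obtain D where "\<forall>b. continuous_on (cball 0 \<rho>) (D b) \<and> (\<forall>p\<in>cball 0 \<rho>.
     D b p = integral {0..1} (\<lambda>s. fderiv H (graph_point s p) (0, b, weight b s *\<^sub>R D b (shrink B s p))))" ..
  then have contD: "continuous_on (cball 0 \<rho>) (D b)"
    and D: "p \<in> cball 0 \<rho> \<Longrightarrow>
       D b p = integral {0..1} (\<lambda>s. fderiv H (graph_point s p) (0, b, weight b s *\<^sub>R D b (shrink B s p)))" for b p
    by simp_all
  define K where "K = (\<lambda>z. graph_point (fst z) (snd z)) ` ({0..1} \<times> cball 0 \<rho>)"
  have "continuous_on ({0..1} \<times> cball 0 \<rho>) (\<lambda>z. graph_point (fst z) (snd z))"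
    by (rule continuous_on_graph_point) (use sub in \<open>auto intro!: continuous_intros\<close>)
  then have K: "compact K" "K \<subseteq> W"
    unfolding K_def using sub graph_point_in_W by (auto intro!: compact_continuous_image compact_Times)
  have ptK: "graph_point s q \<in> K" if "s \<in> {0..1}" "q \<in> cball 0 \<rho>" for s q
    unfolding K_def using that by (auto intro!: image_eqI[of _ _ "(s, q)"])
  obtain C where C: "C \<ge> 0" "\<And>x v. x \<in> K \<Longrightarrow> norm (fderiv H x v) \<le> C * norm v"
    using fderiv_bound_on_compact[OF H K] by blast
  have "(\<psi> has_derivative (\<lambda>h. \<Sum>b\<in>Basis. (h \<bullet> b) *\<^sub>R D b p)) (at p)" if p: "p \<in> ball 0 \<rho>" for p
    unfolding has_derivative_at_alt
  proof (intro conjI allI impI)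
    show "bounded_linear (\<lambda>h. \<Sum>b\<in>Basis. (h \<bullet> b) *\<^sub>R D b p)"
      by (intro bounded_linear_sum bounded_linear_scaleR_left[THEN bounded_linear_compose]
          bounded_linear_inner_left)
    fix e :: real assume e: "e > 0"
    \<comment> \<open>\<open>C1 * norm h\<close> will bound the increments of \<open>\<psi>\<close> along the ray.\<close>
    define C1 where "C1 = 2 * (C + 1) / (1 - \<theta>)"
    have C1: "C1 \<ge> 0" using C \<theta> by (simp add: C1_def)
    \<comment> \<open>The first bound keeps \<open>\<theta> + \<epsilon>\<close> away from 1, the last makes the final error at most \<open>e * norm h\<close>.\<close>
    define \<epsilon> where "\<epsilon> = min ((1 - \<theta>) / 2) (min 1 (e * (1 - \<theta>) / (1 + C1)))"
    have \<epsilon>: "\<epsilon> > 0" "\<epsilon> \<le> (1 - \<theta>) / 2" "\<epsilon> \<le> 1" "\<epsilon> \<le> e * (1 - \<theta>) / (1 + C1)"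
    proof -
      show "\<epsilon> > 0" using e \<theta> C1 by (simp add: \<epsilon>_def)
      show "\<epsilon> \<le> (1 - \<theta>) / 2" "\<epsilon> \<le> 1" "\<epsilon> \<le> e * (1 - \<theta>) / (1 + C1)"
        unfolding \<epsilon>_def by linarith+
    qed
    obtain d0 where d0: "d0 > 0" and lin: "\<And>x h. x \<in> K \<Longrightarrow> norm h \<le> d0 \<Longrightarrow>
        x + h \<in> W \<and> norm (H (x + h) - H x - fderiv H x h) \<le> \<epsilon> * norm h"
      using uniform_linearization[OF H W K \<epsilon>(1)] by metis
    have "uniformly_continuous_on (cball 0 \<rho>) \<psi>"
      by (intro compact_uniformly_continuous continuous_on_subset[OF cont sub] compact_cball)
    then obtain \<eta> where \<eta>: "\<eta> > 0" "\<And>x y. x \<in> cball 0 \<rho> \<Longrightarrow> y \<in> cball 0 \<rho> \<Longrightarrow> dist y x < \<eta> \<Longrightarrow>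
        dist (\<psi> y) (\<psi> x) < d0 / 2"
      using d0 unfolding uniformly_continuous_on_def by (metis half_gt_zero_iff)
    define d where "d = min (\<rho> - norm p) (min \<eta> (d0 / 2))"
    have "d > 0" using p \<eta> d0 by (simp add: d_def)
    moreover have "norm (\<psi> y - \<psi> p - (\<Sum>b\<in>Basis. ((y - p) \<bullet> b) *\<^sub>R D b p)) \<le> e * norm (y - p)"
      if y: "norm (y - p) < d" for y
    proof -
      define h where "h = y - p"
      have y_eq: "y = p + h" by (simp add: h_def)
      have h: "norm h < \<rho> - norm p" "norm h < \<eta>" "norm h < d0 / 2"
        using y by (auto simp: h_def d_def)
      have pc: "p \<in> cball 0 \<rho>" using p by simp
      have yc: "p + h \<in> cball 0 \<rho>" using h norm_triangle_ineq[of p h] by simp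
      define \<delta> where "\<delta> = (\<lambda>r. \<psi> (shrink B r (p + h)) - \<psi> (shrink B r p))"
      define \<Delta> where "\<Delta> = (\<lambda>r. \<Sum>b\<in>Basis. (shrink B r h \<bullet> b) *\<^sub>R D b (shrink B r p))"
      have sh: "shrink B r (p + h) = shrink B r p + shrink B r h" for r
        by (rule linear_add[OF linear_shrink])
      have \<delta>_small: "norm (\<delta> r) \<le> d0 / 2" if r: "r \<in> {0..1}" for r
      proof -
        have "dist (shrink B r (p + h)) (shrink B r p) < \<eta>"
          using norm_shrink_le[OF B r, of h] h by (simp add: sh dist_norm)
        from \<eta>(2)[OF shrink_in_cball[OF r pc] shrink_in_cball[OF r yc] this]
        show ?thesis by (simp add: \<delta>_def dist_norm)
      qed
      have cont_sh: "continuous_on {0..1} (\<lambda>r. g (shrink B r q))"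
        if "continuous_on (cball 0 \<rho>) g" "q \<in> cball 0 \<rho>" for g :: "'e \<Rightarrow> 'f" and q
        by (rule continuous_on_compose2[OF that(1)])
          (use shrink_in_cball that(2) in \<open>auto intro!: continuous_intros\<close>)
      have cont\<delta>: "continuous_on {0..1} \<delta>"
        unfolding \<delta>_def by (intro continuous_on_diff cont_sh continuous_on_subset[OF cont sub] yc pc)
      have cont\<Delta>: "continuous_on {0..1} \<Delta>"
        unfolding \<Delta>_def by (intro continuous_intros cont_sh contD pc)
      have cont_mult: "continuous_on {0..1} (\<lambda>s. g (s * r))"
        if "continuous_on {0..1} g" "r \<in> {0..1}" for g :: "real \<Rightarrow> 'f" and r
        by (rule continuous_on_compose2[OF that(1)])
          (use that(2) in \<open>auto intro!: continuous_intros mult_le_one\<close>)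
      have cont_graph_point: "continuous_on {0..1} (\<lambda>s. graph_point s q)" if "q \<in> cball 0 \<rho>" for q
        by (rule continuous_on_graph_point) (use that sub in \<open>auto intro!: continuous_intros\<close>)
      have cont_H: "continuous_on {0..1} (\<lambda>s. H (graph_point s q))" if "q \<in> cball 0 \<rho>" for q
        by (rule continuous_on_compose2[OF _ cont_graph_point[OF that]])
          (use Cm_on_lower[OF H] that sub graph_point_in_W in auto)
      have cont_DH: "continuous_on {0..1} (\<lambda>s. fderiv H (graph_point s q) (u s))"
        if "q \<in> cball 0 \<rho>" "continuous_on {0..1} u" for q u
        by (rule continuous_on_fderiv_H[OF cont_graph_point[OF that(1)] _ that(2)])
          (use that sub graph_point_in_W in auto)
      define inc where "inc = (\<lambda>s r. (0::real, shrink B r h, \<delta> (s * r)))"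
      have graph_point_inc: "graph_point s (shrink B r (p + h)) = graph_point s (shrink B r p) + inc s r" for s r
        by (simp add: graph_point_def inc_def \<delta>_def shrink_shrink[OF B] flip: sh)
      have norm_inc: "norm (inc s r) \<le> norm h + norm (\<delta> (s * r))" if "r \<in> {0..1}" for s r
        using norm_Pair_le[of "0::real" "(shrink B r h, \<delta> (s * r))"]
          norm_Pair_le[of "shrink B r h" "\<delta> (s * r)"] norm_shrink_le[OF B that, of h]
        by (simp add: inc_def)
      have mult01: "s * r \<in> {0..1}" if "s \<in> {0..1}" "r \<in> {0..1}" for s r :: real
        using that by (auto intro: mult_le_one)
      have lin': "norm (H (graph_point s (shrink B r (p + h))) - H (graph_point s (shrink B r p))
          - fderiv H (graph_point s (shrink B r p)) (inc s r)) \<le> \<epsilon> * (norm h + norm (\<delta> (s * r)))"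
        if s: "s \<in> {0..1}" and r: "r \<in> {0..1}" for s r
      proof -
        have "norm (inc s r) \<le> d0"
          using norm_inc[OF r, of s] \<delta>_small[OF mult01[OF s r]] h(3) by linarith
        from lin[OF ptK[OF s shrink_in_cball[OF r pc]] this]
        have "norm (H (graph_point s (shrink B r (p + h))) - H (graph_point s (shrink B r p))
          - fderiv H (graph_point s (shrink B r p)) (inc s r)) \<le> \<epsilon> * norm (inc s r)"
          unfolding graph_point_inc by simp
        also have "\<dots> \<le> \<epsilon> * (norm h + norm (\<delta> (s * r)))"
          using norm_inc[OF r, of s] \<epsilon>(1) by simp
        finally show ?thesis .
      qed
      have ball_r: "shrink B r p \<in> ball 0 R" "shrink B r (p + h) \<in> ball 0 R" if "r \<in> {0..1}" for r
        using shrink_in_cball[OF that] pc yc sub by blast+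
      have \<delta>_eq: "\<delta> r = integral {0..1} (\<lambda>s. H (graph_point s (shrink B r (p + h))) - H (graph_point s (shrink B r p)))"
        if r: "r \<in> {0..1}" for r
        unfolding \<delta>_def eq[OF ball_r(1)[OF r]] eq[OF ball_r(2)[OF r]] graph_point_def[symmetric]
        by (rule integral_diff[symmetric])
          (intro integrable_continuous_real cont_H shrink_in_cball r pc yc)+
      have contr': "norm (fderiv H (graph_point s (shrink B r p)) (0, 0, k)) \<le> \<theta> * norm k"
        if "s \<in> {0..1}" "r \<in> {0..1}" for s r k
        unfolding graph_point_def by (rule contr[OF that(1) ball_r(1)[OF that(2)]])
      have lin_r: "linear (fderiv H (graph_point s (shrink B r p)))" if "s \<in> {0..1}" "r \<in> {0..1}" for s r
        by (rule linear_fderiv_H[OF graph_point_in_W[OF that(1) ball_r(1)[OF that(2)]]])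
      have \<delta>_bound: "norm (\<delta> r) \<le> C1 * norm h" if r: "r \<in> {0..1}" for r
      proof -
        have "norm (\<delta> r) \<le> (C + \<epsilon>) * norm h / (1 - (\<theta> + \<epsilon>))"
        proof (rule bound_by_own_maximum[OF _ _ _ r])
          show "continuous_on {0..1} (\<lambda>r. norm (\<delta> r))" by (intro continuous_intros cont\<delta>)
          show "\<theta> + \<epsilon> < 1" using \<epsilon>(2) \<theta>(2) by (simp add: field_simps)
          fix r M assume r: "r \<in> {0..1::real}" and M: "\<And>s. s \<in> {0..1} \<Longrightarrow> norm (\<delta> s) \<le> M"
          have "norm (\<delta> r) \<le> ((C + \<epsilon>) * norm h + (\<theta> + \<epsilon>) * M) * (1 - 0)"
            unfolding \<delta>_eq[OF r]
          proof (rule integral_bound)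
            show "continuous_on {0..1} (\<lambda>s. H (graph_point s (shrink B r (p + h))) - H (graph_point s (shrink B r p)))"
              by (intro continuous_on_diff cont_H shrink_in_cball r pc yc)
            fix s :: real assume s: "s \<in> {0..1}"
            let ?x = "graph_point s (shrink B r p)"
            have "norm (fderiv H ?x (inc s r)) = norm (fderiv H ?x (0, shrink B r h, 0) + fderiv H ?x (0, 0, \<delta> (s * r)))"
              using linear_add[OF lin_r[OF s r], of "(0, shrink B r h, 0)" "(0, 0, \<delta> (s * r))"]
              by (simp add: inc_def)
            moreover have "norm (fderiv H ?x (0, shrink B r h, 0)) \<le> C * norm h"
            proof -
              have "norm (fderiv H ?x (0, shrink B r h, 0)) \<le> C * norm ((0, shrink B r h, 0) :: real \<times> 'e \<times> 'f)"
                by (rule C(2)[OF ptK[OF s shrink_in_cball[OF r pc]]])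
              also have "\<dots> \<le> C * norm h"
                using norm_shrink_le[OF B r, of h] C(1) by (simp add: norm_Pair mult_left_mono)
              finally show ?thesis .
            qed
            moreover have "norm (fderiv H ?x (0, 0, \<delta> (s * r))) \<le> \<theta> * M"
              using contr'[OF s r, of "\<delta> (s * r)"] M[OF mult01[OF s r]] \<theta>(1)
              by (meson mult_left_mono order_trans)
            moreover have "\<epsilon> * (norm h + norm (\<delta> (s * r))) \<le> \<epsilon> * (norm h + M)"
              using M[OF mult01[OF s r]] \<epsilon>(1) by simp
            moreover have "norm (H (graph_point s (shrink B r (p + h))) - H ?x)
               \<le> norm (H (graph_point s (shrink B r (p + h))) - H ?x - fderiv H ?x (inc s r)) + norm (fderiv H ?x (inc s r))"
              by (metis diff_add_cancel norm_triangle_ineq)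
            moreover have "norm (fderiv H ?x (0, shrink B r h, 0) + fderiv H ?x (0, 0, \<delta> (s * r)))
               \<le> norm (fderiv H ?x (0, shrink B r h, 0)) + norm (fderiv H ?x (0, 0, \<delta> (s * r)))"
              by (rule norm_triangle_ineq)
            ultimately have "norm (H (graph_point s (shrink B r (p + h))) - H ?x)
                \<le> \<epsilon> * (norm h + M) + (C * norm h + \<theta> * M)"
              using lin'[OF s r] by linarith
            then show "norm (H (graph_point s (shrink B r (p + h))) - H ?x) \<le> (C + \<epsilon>) * norm h + (\<theta> + \<epsilon>) * M"
              by (simp add: algebra_simps)
          qed simp
          then show "norm (\<delta> r) \<le> (C + \<epsilon>) * norm h + (\<theta> + \<epsilon>) * M" by simp
        qed
        also have "\<dots> \<le> (C + 1) * norm h / ((1 - \<theta>) / 2)"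
          using \<epsilon> C(1) \<theta> by (intro frac_le mult_right_mono mult_nonneg_nonneg) (auto simp: field_simps)
        also have "\<dots> = C1 * norm h" by (simp add: C1_def)
        finally show ?thesis .
      qed
      have \<Delta>_eq: "\<Delta> r = integral {0..1} (\<lambda>s. fderiv H (graph_point s (shrink B r p)) (0, shrink B r h, \<Delta> (s * r)))"
        if r: "r \<in> {0..1}" for r
      proof -
        let ?q = "shrink B r p"
        let ?g = "\<lambda>b s. fderiv H (graph_point s ?q) (0, b, weight b s *\<^sub>R D b (shrink B s ?q))"
        have qc: "?q \<in> cball 0 \<rho>" by (rule shrink_in_cball[OF r pc])
        have int_g: "?g b integrable_on {0..1}" for b
          by (intro integrable_continuous_real cont_DH qc continuous_intros continuous_on_weight cont_sh contD)
        have "\<Delta> r = (\<Sum>b\<in>Basis. (shrink B r h \<bullet> b) *\<^sub>R integral {0..1} (?g b))"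
          unfolding \<Delta>_def by (intro sum.cong refl) (subst D[OF qc], rule refl)
        also have "\<dots> = integral {0..1} (\<lambda>s. \<Sum>b\<in>Basis. (shrink B r h \<bullet> b) *\<^sub>R ?g b s)"
          by (subst integral_sum) (auto intro!: integrable_cmul int_g)
        also have "\<dots> = integral {0..1} (\<lambda>s. fderiv H (graph_point s ?q) (0, shrink B r h, \<Delta> (s * r)))"
        proof (rule integral_cong)
          fix s :: real assume s: "s \<in> {0..1}"
          have "(\<Sum>b\<in>Basis. (shrink B r h \<bullet> b) *\<^sub>R ?g b s)
            = fderiv H (graph_point s ?q) (\<Sum>b\<in>Basis. (shrink B r h \<bullet> b) *\<^sub>R (0, b, weight b s *\<^sub>R D b (shrink B s ?q)))"
            by (simp only: linear_sum[OF lin_r[OF s r]] linear_scale[OF lin_r[OF s r]])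
          also have "(\<Sum>b\<in>Basis. (shrink B r h \<bullet> b) *\<^sub>R (0::real, b, weight b s *\<^sub>R D b (shrink B s ?q)))
            = (0, \<Sum>b\<in>Basis. (shrink B r h \<bullet> b) *\<^sub>R b,
               \<Sum>b\<in>Basis. (shrink B r h \<bullet> b) *\<^sub>R weight b s *\<^sub>R D b (shrink B s ?q))"
            by (simp add: sum_prod)
          also have "(\<Sum>b\<in>Basis. (shrink B r h \<bullet> b) *\<^sub>R b) = shrink B r h"
            by (rule euclidean_representation)
          also have "(\<Sum>b\<in>Basis. (shrink B r h \<bullet> b) *\<^sub>R weight b s *\<^sub>R D b (shrink B s ?q)) = \<Delta> (s * r)"
            unfolding \<Delta>_def shrink_shrink[OF B]
            by (intro sum.cong refl) (simp add: shrink_inner[OF B] weight_def)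
          finally show "(\<Sum>b\<in>Basis. (shrink B r h \<bullet> b) *\<^sub>R ?g b s)
            = fderiv H (graph_point s ?q) (0, shrink B r h, \<Delta> (s * r))" .
        qed
        finally show ?thesis .
      qed
      have "norm (\<delta> 1 - \<Delta> 1) \<le> \<epsilon> * (1 + C1) * norm h / (1 - \<theta>)"
      proof (rule bound_by_own_maximum[where f = "\<lambda>r. norm (\<delta> r - \<Delta> r)" and \<theta> = \<theta>])
        show "continuous_on {0..1} (\<lambda>r. norm (\<delta> r - \<Delta> r))" by (intro continuous_intros cont\<delta> cont\<Delta>)
        fix r M assume r: "r \<in> {0..1::real}" and M: "\<And>s. s \<in> {0..1} \<Longrightarrow> norm (\<delta> s - \<Delta> s) \<le> M"
        let ?x = "\<lambda>s. graph_point s (shrink B r p)"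
        let ?i = "\<lambda>s. H (graph_point s (shrink B r (p + h))) - H (?x s) - fderiv H (?x s) (0, shrink B r h, \<Delta> (s * r))"
        have ci: "continuous_on {0..1} ?i"
          by (intro continuous_on_diff cont_H cont_DH shrink_in_cball r pc yc continuous_intros
              cont_mult cont\<Delta>)
        have "\<delta> r - \<Delta> r = integral {0..1} ?i"
          unfolding \<delta>_eq[OF r] \<Delta>_eq[OF r]
          by (rule integral_diff[symmetric])
            (intro integrable_continuous_real continuous_on_diff cont_H cont_DH shrink_in_cball r pc yc
              continuous_intros cont_mult cont\<Delta>)+
        also have "norm \<dots> \<le> (\<epsilon> * (1 + C1) * norm h + \<theta> * M) * (1 - 0)"
        proof (rule integral_bound[OF _ ci])
          fix s :: real assume s: "s \<in> {0..1}"
          have "fderiv H (?x s) (inc s r) - fderiv H (?x s) (0, shrink B r h, \<Delta> (s * r))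
              = fderiv H (?x s) (0, 0, \<delta> (s * r) - \<Delta> (s * r))"
            using linear_diff[OF lin_r[OF s r], of "inc s r" "(0, shrink B r h, \<Delta> (s * r))"]
            by (simp add: inc_def)
          then have "?i s = (H (graph_point s (shrink B r (p + h))) - H (?x s) - fderiv H (?x s) (inc s r))
              + fderiv H (?x s) (0, 0, \<delta> (s * r) - \<Delta> (s * r))"
            by (simp add: algebra_simps)
          then have "norm (?i s) \<le> norm (H (graph_point s (shrink B r (p + h))) - H (?x s) - fderiv H (?x s) (inc s r))
              + norm (fderiv H (?x s) (0, 0, \<delta> (s * r) - \<Delta> (s * r)))"
            by (metis norm_triangle_ineq)
          moreover have "norm (fderiv H (?x s) (0, 0, \<delta> (s * r) - \<Delta> (s * r))) \<le> \<theta> * M"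
            using contr'[OF s r, of "\<delta> (s * r) - \<Delta> (s * r)"] M[OF mult01[OF s r]] \<theta>(1)
            by (meson mult_left_mono order_trans)
          moreover have "\<epsilon> * (norm h + norm (\<delta> (s * r))) \<le> \<epsilon> * (norm h + C1 * norm h)"
            using \<delta>_bound[OF mult01[OF s r]] \<epsilon>(1) by simp
          ultimately have "norm (?i s) \<le> \<epsilon> * (norm h + C1 * norm h) + \<theta> * M"
            using lin'[OF s r] by linarith
          then show "norm (?i s) \<le> \<epsilon> * (1 + C1) * norm h + \<theta> * M"
            by (simp add: algebra_simps)
        qed simp
        finally show "norm (\<delta> r - \<Delta> r) \<le> \<epsilon> * (1 + C1) * norm h + \<theta> * M" by simp
      qed (use \<theta> in auto)
      also have "\<dots> = \<epsilon> * ((1 + C1) / (1 - \<theta>)) * norm h" by simp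
      also have "\<dots> \<le> e * norm h"
        using \<epsilon>(4) C1 \<theta>(2) by (intro mult_right_mono) (simp_all add: field_simps)
      finally have "norm (\<delta> 1 - \<Delta> 1) \<le> e * norm h" .
      then show ?thesis by (simp add: \<delta>_def \<Delta>_def h_def)
    qed
    ultimately show "\<exists>d>0. \<forall>y. norm (y - p) < d \<longrightarrow>
        norm (\<psi> y - \<psi> p - (\<Sum>b\<in>Basis. ((y - p) \<bullet> b) *\<^sub>R D b p)) \<le> e * norm (y - p)"
      by blast
  qed
  then show ?thesis using contD D by (intro exI[of _ D] conjI allI ballI)
qed

lemma solution_differentiable:
  assumes p: "p \<in> ball 0 R"
  shows "(\<psi> has_derivative fderiv \<psi> p) (at p)"
    and "b \<in> Basis \<Longrightarrow> fderiv \<psi> p b = integral {0..1} (\<lambda>s. fderiv H (graph_point s p) (0, b, weight b s *\<^sub>R fderiv \<psi> (shrink B s p) b))"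
    and "b \<in> Basis \<Longrightarrow> isCont (\<lambda>p. fderiv \<psi> p b) p"
proof -
  obtain \<rho> where \<rho>: "norm p < \<rho>" "\<rho> < R"
    using p dense[of "norm p" R] by auto
  then have \<rho>0: "0 < \<rho>" using norm_ge_zero[of p] by linarith
  obtain D where "(\<forall>b. continuous_on (cball 0 \<rho>) (D b)) \<and>
    (\<forall>b. \<forall>p\<in>cball 0 \<rho>.
       D b p = integral {0..1} (\<lambda>s. fderiv H (graph_point s p) (0, b, weight b s *\<^sub>R D b (shrink B s p)))) \<and>
    (\<forall>p\<in>ball 0 \<rho>. (\<psi> has_derivative (\<lambda>h. \<Sum>b\<in>Basis. (h \<bullet> b) *\<^sub>R D b p)) (at p))"
    using solution_has_derivative[OF \<rho>0 \<rho>(2)] by (rule exE)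
  then have contD: "continuous_on (cball 0 \<rho>) (D b)"
    and D: "p \<in> cball 0 \<rho> \<Longrightarrow>
       D b p = integral {0..1} (\<lambda>s. fderiv H (graph_point s p) (0, b, weight b s *\<^sub>R D b (shrink B s p)))"
    and der: "p \<in> ball 0 \<rho> \<Longrightarrow> (\<psi> has_derivative (\<lambda>h. \<Sum>b\<in>Basis. (h \<bullet> b) *\<^sub>R D b p)) (at p)" for b p
    by blast+
  have p': "p \<in> ball 0 \<rho>" using \<rho> by simp
  show "(\<psi> has_derivative fderiv \<psi> p) (at p)"
    using der[OF p'] fderiv_eq by metis
  have eqD: "fderiv \<psi> q b = D b q" if "b \<in> Basis" "q \<in> ball 0 \<rho>" for b q
    using that by (simp add: fderiv_eq[OF der] inner_Basis if_distrib[where f = "\<lambda>x. x *\<^sub>R _"] cong: if_cong)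
  show "fderiv \<psi> p b = integral {0..1} (\<lambda>s. fderiv H (graph_point s p) (0, b, weight b s *\<^sub>R fderiv \<psi> (shrink B s p) b))"
    if b: "b \<in> Basis"
  proof -
    have "fderiv \<psi> p b = integral {0..1} (\<lambda>s. fderiv H (graph_point s p) (0, b, weight b s *\<^sub>R D b (shrink B s p)))"
      using eqD[OF b p'] D[of p b] p' by simp
    also have "\<dots> = integral {0..1} (\<lambda>s. fderiv H (graph_point s p) (0, b, weight b s *\<^sub>R fderiv \<psi> (shrink B s p) b))"
      by (rule integral_cong) (simp add: eqD[OF b shrink_in_ball[OF _ p']])
    finally show ?thesis .
  qed
  show "isCont (\<lambda>p. fderiv \<psi> p b) p" if b: "b \<in> Basis"
  proof -
    have "continuous_on (ball 0 \<rho>) (D b)"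
      by (rule continuous_on_subset[OF contD[of b]]) auto
    then have "continuous_on (ball 0 \<rho>) (\<lambda>p. fderiv \<psi> p b)"
      by (rule continuous_on_eq) (simp add: eqD[OF b])
    then show ?thesis using p' by (simp add: continuous_on_eq_continuous_at)
  qed
qed

end

lemma Cm_on_Suc_BasisI:
  fixes f :: "'a::euclidean_space \<Rightarrow> 'b::real_normed_vector"
  assumes "open S" "\<And>x. x \<in> S \<Longrightarrow> (f has_derivative fderiv f x) (at x)"
    "\<And>b. b \<in> Basis \<Longrightarrow> Cm_on m (\<lambda>x. fderiv f x b) S"
  shows "Cm_on (Suc m) f S"
proof (rule Cm_on_SucI[OF assms(1,2)])
  fix v
  have "fderiv f x v = (\<Sum>b\<in>Basis. (v \<bullet> b) *\<^sub>R fderiv f x b)" if "x \<in> S" for x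
    using linear_Basis_expansion[OF has_derivative_linear[OF assms(2)[OF that]]] .
  then show "Cm_on m (\<lambda>x. fderiv f x v) S"
    by (intro Cm_on_cong[OF assms(1) _ Cm_on_sum[OF assms(1) Cm_on_scaleR[OF assms(1) Cm_on_const assms(3)]]])
      auto
qed

lemma has_derivative_affine_line:
  assumes "(f has_derivative f') (at x)" and "\<And>t::real. f (x + t *\<^sub>R v) = f x + t *\<^sub>R d"
  shows "f' v = d"
proof -
  have "((\<lambda>t::real. x + t *\<^sub>R v) has_derivative (\<lambda>t. t *\<^sub>R v)) (at 0)"
    by (auto intro!: derivative_eq_intros)
  moreover have "(f has_derivative f') (at (x + 0 *\<^sub>R v))" using assms(1) by simp
  ultimately have "((\<lambda>t::real. f (x + t *\<^sub>R v)) has_derivative (\<lambda>t. f' (t *\<^sub>R v))) (at 0)"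
    by (rule has_derivative_compose)
  moreover have "((\<lambda>t::real. f (x + t *\<^sub>R v)) has_derivative (\<lambda>t. t *\<^sub>R d)) (at 0)"
    unfolding assms(2) by (auto intro!: derivative_eq_intros)
  ultimately have "(\<lambda>t::real. f' (t *\<^sub>R v)) = (\<lambda>t. t *\<^sub>R d)"
    by (rule has_derivative_unique)
  from fun_cong[OF this, of 1] show ?thesis by simp
qed

lemma Cm_on_shrink:
  assumes "open S" "Cm_on m f S" "Cm_on m g S"
  shows "Cm_on m (\<lambda>x. shrink B (f x) (g x)) S"
  unfolding shrink_def
  using assms by (intro Cm_on_add Cm_on_scaleR Cm_on_diff Cm_on_const Cm_on_linear_compose[OF _ linear_proj])

text \<open>A partial derivative of \<open>\<psi>\<close> solves an equation of the same form. The new integrand \<open>Hb\<close> is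
  made from the first derivatives of \<open>H\<close> and from \<open>\<psi>\<close> itself, so it is of class \<open>C\<^sup>m\<close> as soon as
  \<open>H\<close> is of class \<open>C\<^sup>m\<^sup>+\<^sup>1\<close> and \<open>\<psi>\<close> of class \<open>C\<^sup>m\<close>. The case \<open>m = 0\<close> is the continuity of
  the partial derivatives, where \<open>Hb\<close> is merely continuous and the equation for it is not available.\<close>

theorem ray_solution_Cm_on:
  fixes B :: "'e::euclidean_space set" and H :: "real \<times> 'e \<times> 'f::euclidean_space \<Rightarrow> 'f"
  assumes "ray_integral_equation B H W \<psi> R \<theta>" and "Cm_on m H W"
  shows "Cm_on m \<psi> (ball 0 R)"
  using assms
proof (induction m arbitrary: H W \<psi>)
  case 0
  then show ?case by (simp add: ray_integral_equation.cont)
next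
  case (Suc m)
  interpret ray_integral_equation B H W \<psi> R \<theta> by (rule Suc.prems(1))
  have \<psi>: "Cm_on m \<psi> (ball 0 R)"
    by (rule Suc.IH[OF Suc.prems(1) Cm_on_lower[OF Suc.prems(2)]])
  have "Cm_on m (\<lambda>p. fderiv \<psi> p b) (ball 0 R)" if b: "b \<in> Basis" for b
  proof (cases m)
    case 0
    then show ?thesis
      using solution_differentiable(3)[OF _ b] by (simp add: continuous_at_imp_continuous_on)
  next
    case (Suc m')
    define Hb where "Hb = (\<lambda>z. fderiv H (graph_point (fst z) (fst (snd z))) (0, b, weight b (fst z) *\<^sub>R snd (snd z)))"
    define W1 :: "(real \<times> 'e \<times> 'f) set" where "W1 = ((\<lambda>z. fst (snd z)) -` ball 0 R) \<inter>
      ((\<lambda>z. shrink B (fst z) (fst (snd z))) -` ball 0 R)"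
    define Wb where "Wb = W1 \<inter> (\<lambda>z. graph_point (fst z) (fst (snd z))) -` W"
    have "open W1"
      unfolding W1_def by (intro open_Int open_vimage continuous_intros) auto
    have graph_point_W1: "Cm_on m (\<lambda>z. graph_point (fst z) (fst (snd z))) W1"
    proof -
      have lin: "linear (\<lambda>z::real \<times> 'e \<times> 'f. fst z)" "linear (\<lambda>z::real \<times> 'e \<times> 'f. fst (snd z))"
        by (auto intro!: linearI)
      have "Cm_on m (\<lambda>z. shrink B (fst z) (fst (snd z))) W1"
        by (intro Cm_on_shrink \<open>open W1\<close> Cm_on_linear lin)
      then have c: "Cm_on m (\<lambda>z. \<psi> (shrink B (fst z) (fst (snd z)))) W1"
        by (intro Cm_on_compose[where f = "\<lambda>z. shrink B (fst z) (fst (snd z))" and g = \<psi>, OF \<open>open W1\<close> open_ball _ _ \<psi>])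
          (auto simp: W1_def)
      then show ?thesis
        unfolding graph_point_def by (intro Cm_on_Pair \<open>open W1\<close> Cm_on_linear[OF lin(1)] Cm_on_linear[OF lin(2)] c)
    qed
    have "open Wb"
      unfolding Wb_def using Cm_on_le[OF graph_point_W1, of 0] W \<open>open W1\<close>
      by (intro continuous_open_preimage) auto
    have graph_point_Wb: "Cm_on m (\<lambda>z. graph_point (fst z) (fst (snd z))) Wb"
      by (rule Cm_on_subset[OF graph_point_W1]) (auto simp: Wb_def)
    have Hb: "Cm_on m Hb Wb"
      unfolding Hb_def
    proof (rule Cm_on_linear_family[where M = "\<lambda>z. fderiv H (graph_point (fst z) (fst (snd z)))", OF \<open>open Wb\<close>])
      show "linear (fderiv H (graph_point (fst z) (fst (snd z))))" if "z \<in> Wb" for z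
        using that by (intro linear_fderiv_H) (auto simp: Wb_def)
      show "Cm_on m (\<lambda>z. fderiv H (graph_point (fst z) (fst (snd z))) c) Wb" for c
        by (rule Cm_on_compose[where g = "\<lambda>x. fderiv H x c", OF \<open>open Wb\<close> W _ graph_point_Wb Cm_on_Suc_fderiv[OF Suc.prems(2)]])
          (auto simp: Wb_def)
      have "Cm_on m (\<lambda>z :: real \<times> 'e \<times> 'f. weight b (fst z)) Wb"
        by (cases "b \<in> B") (auto simp: weight_def intro!: Cm_on_const Cm_on_linear linearI)
      moreover have "Cm_on m (\<lambda>z :: real \<times> 'e \<times> 'f. snd (snd z)) Wb"
        by (auto intro!: Cm_on_linear linearI)
      ultimately show "Cm_on m (\<lambda>z. (0::real, b, weight b (fst z) *\<^sub>R snd (snd z))) Wb"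
        by (intro Cm_on_Pair \<open>open Wb\<close> Cm_on_const Cm_on_scaleR)
    qed
    show ?thesis
    proof (rule Suc.IH[OF _ Hb], unfold_locales)
      show "B \<subseteq> Basis" "open Wb" "0 \<le> \<theta>" "\<theta> < 1" by (rule B \<open>open Wb\<close> \<theta>)+
      show Hb1: "Cm_on (Suc 0) Hb Wb" by (rule Cm_on_le[OF Hb]) (simp add: Suc)
      show "continuous_on (ball 0 R) (\<lambda>p. fderiv \<psi> p b)"
        using solution_differentiable(3)[OF _ b] by (simp add: continuous_at_imp_continuous_on)
      show graph_b: "(s, p, fderiv \<psi> (shrink B s p) b) \<in> Wb" if "s \<in> {0..1}" "p \<in> ball 0 R" for s p
        using that graph_point_in_W[OF that] shrink_in_ball[OF that] by (simp add: Wb_def W1_def)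
      show "norm (fderiv Hb (s, p, fderiv \<psi> (shrink B s p) b) (0, 0, k)) \<le> \<theta> * norm k"
        if s: "s \<in> {0..1}" and p: "p \<in> ball 0 R" for s p k
      proof -
        let ?z = "(s, p, fderiv \<psi> (shrink B s p) b)"
        note lin = linear_fderiv_H[OF graph_point_in_W[OF s p]]
        have "Hb (?z + t *\<^sub>R (0, 0, k)) = Hb ?z + t *\<^sub>R fderiv H (graph_point s p) (0, 0, weight b s *\<^sub>R k)" for t
        proof -
          let ?a = "(0, b, weight b s *\<^sub>R fderiv \<psi> (shrink B s p) b)"
          have "(0, b, weight b s *\<^sub>R (fderiv \<psi> (shrink B s p) b + t *\<^sub>R k))
            = ?a + t *\<^sub>R (0::real, 0::'e, weight b s *\<^sub>R k)"
            by (simp add: algebra_simps)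
          then have "Hb (?z + t *\<^sub>R (0, 0, k)) = fderiv H (graph_point s p) (?a + t *\<^sub>R (0, 0, weight b s *\<^sub>R k))"
            by (simp add: Hb_def)
          also have "\<dots> = fderiv H (graph_point s p) ?a + t *\<^sub>R fderiv H (graph_point s p) (0, 0, weight b s *\<^sub>R k)"
            by (simp only: linear_add[OF lin] linear_scale[OF lin])
          finally show ?thesis by (simp add: Hb_def)
        qed
        then have "fderiv Hb ?z (0, 0, k) = fderiv H (graph_point s p) (0, 0, weight b s *\<^sub>R k)"
          by (rule has_derivative_affine_line[OF Cm_on_SucD[OF Hb1 graph_b[OF s p]]])
        also have "norm \<dots> \<le> \<theta> * norm (weight b s *\<^sub>R k)"
          unfolding graph_point_def by (rule contr[OF s p])
        also have "\<dots> \<le> \<theta> * norm k"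
          using \<theta>(1) s by (intro mult_left_mono) (auto simp: weight_def mult_left_le_one_le)
        finally show ?thesis .
      qed
      show "fderiv \<psi> p b = integral {0..1} (\<lambda>s. Hb (s, p, fderiv \<psi> (shrink B s p) b))"
        if "p \<in> ball 0 R" for p
        using solution_differentiable(2)[OF that b] by (simp add: Hb_def)
    qed
  qed
  then show ?case
    by (intro Cm_on_Suc_BasisI open_ball solution_differentiable(1))
qed

section \<open>Parametric integrals and symmetry of second derivatives\<close>

text \<open>The integral solves a ray equation whose integrand ignores the unknown function, with contraction
  constant 0. For \<open>B = {}\<close> the ray of a point is constant.\<close>

lemma smooth_on_parametric_integral:
  fixes h :: "real \<times> 'e::euclidean_space \<Rightarrow> 'f::euclidean_space"
  assumes WR: "open W" "{0..1} \<times> ball 0 R \<subseteq> W" and h: "smooth_on h W"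
  defines "J \<equiv> \<lambda>p. integral {0..1} (\<lambda>s. h (s, p))"
  shows "smooth_on J (ball 0 R)"
    and "p \<in> ball 0 R \<Longrightarrow> (J has_derivative (\<lambda>u. integral {0..1} (\<lambda>s. fderiv h (s, p) (0, u)))) (at p)"
proof -
  define H where "H = (\<lambda>z :: real \<times> 'e \<times> 'f. h (fst z, fst (snd z)))"
  define W' where "W' = (\<lambda>z :: real \<times> 'e \<times> 'f. (fst z, fst (snd z))) -` W"
  have lin: "linear (\<lambda>z :: real \<times> 'e \<times> 'f. (fst z, fst (snd z)))"
    by (auto intro!: linearI)
  have W': "open W'"
    unfolding W'_def by (intro open_vimage WR continuous_intros)
  have smH: "smooth_on H W'"
    unfolding H_def by (rule smooth_on_compose[OF W' WR(1) _ smooth_on_linear[OF lin] h]) (simp add: W'_def)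
  have fderiv_H: "fderiv H z v = fderiv h (fst z, fst (snd z)) (fst v, fst (snd v))" if "z \<in> W'" for z v
    unfolding H_def
  proof (rule fderiv_compose[where f = "\<lambda>z. (fst z, fst (snd z))" and f' = "\<lambda>z. (fst z, fst (snd z))"])
    show "((\<lambda>z. (fst z, fst (snd z))) has_derivative (\<lambda>z. (fst z, fst (snd z)))) (at z)"
      by (rule linear_has_derivative[OF lin])
    show "(h has_derivative fderiv h (fst z, fst (snd z))) (at (fst z, fst (snd z)))"
      by (rule smooth_on_has_derivative[OF h]) (use that in \<open>simp add: W'_def\<close>)
  qed
  have lin_h: "linear (fderiv h x)" if "x \<in> W" for x
    by (rule linear_fderiv_smooth_on[OF h that])
  have inW': "(s, p, w) \<in> W'" if "s \<in> {0..1}" "p \<in> ball 0 R" for s p w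
    using WR(2) that by (auto simp: W'_def)
  have cont_h: "continuous_on W h" by (rule smooth_on_imp_continuous_on[OF h])
  interpret ray_integral_equation "{}" H W' J R 0
  proof unfold_locales
    show "Cm_on (Suc 0) H W'" by (rule smooth_onD[OF smH])
    show "continuous_on (ball 0 R) J"
    proof -
      have "(\<lambda>z. (snd z, fst z)) ` (ball 0 R \<times> {0..1}) \<subseteq> W" using WR(2) by auto
      then have "continuous_on (ball 0 R \<times> {0..1}) (\<lambda>z. h (snd z, fst z))"
        by (rule continuous_on_compose2[OF cont_h, rotated]) (intro continuous_intros)
      then show ?thesis
        unfolding J_def using integral_continuous_on_param[of "ball 0 R" 0 "1::real" "\<lambda>p s. h (s, p)"]
        by (simp add: split_beta)
    qed
    show "norm (fderiv H (s, p, J (shrink {} s p)) (0, 0, k)) \<le> 0 * norm k"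
      if "s \<in> {0..1}" "p \<in> ball 0 R" for s p k
    proof -
      have "(s, p) \<in> W" using that WR(2) by auto
      from linear_0[OF lin_h[OF this]] show ?thesis
        using fderiv_H[OF inW'[OF that], of "J (shrink {} s p)" "(0, 0, k)"] by (simp add: zero_prod_def)
    qed
  qed (use W' inW' in \<open>auto simp: J_def H_def\<close>)
  show "smooth_on J (ball 0 R)"
    unfolding smooth_on_def
    by (intro allI ray_solution_Cm_on[OF ray_integral_equation_axioms] smooth_onD[OF smH])
  show "(J has_derivative (\<lambda>u. integral {0..1} (\<lambda>s. fderiv h (s, p) (0, u)))) (at p)"
    if p: "p \<in> ball 0 R" for p
  proof -
    have sub: "(\<lambda>s. (s, p)) ` {0..1} \<subseteq> W" using WR(2) p by auto
    have "continuous_on {0..1} (\<lambda>s. fderiv h (s, p) v)" for v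
      by (rule continuous_on_compose2[OF smooth_on_imp_continuous_on[OF smooth_on_fderiv[OF h]] _ sub])
        (intro continuous_intros)
    then have int: "(\<lambda>s. fderiv h (s, p) v) integrable_on {0..1}" for v
      by (rule integrable_continuous_real)
    have "fderiv J p u = integral {0..1} (\<lambda>s. fderiv h (s, p) (0, u))" for u
    proof -
      have b: "fderiv J p b = integral {0..1} (\<lambda>s. fderiv h (s, p) (0, b))" if "b \<in> Basis" for b
        unfolding solution_differentiable(2)[OF p that]
        by (rule integral_cong) (simp add: fderiv_H[OF inW'[OF _ p]] graph_point_def)
      have "fderiv J p u = (\<Sum>b\<in>Basis. (u \<bullet> b) *\<^sub>R integral {0..1} (\<lambda>s. fderiv h (s, p) (0, b)))"
        using linear_Basis_expansion[OF has_derivative_linear[OF solution_differentiable(1)[OF p]]] b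
        by simp
      also have "\<dots> = integral {0..1} (\<lambda>s. \<Sum>b\<in>Basis. (u \<bullet> b) *\<^sub>R fderiv h (s, p) (0, b))"
        by (subst integral_sum) (auto intro!: integrable_cmul int)
      also have "\<dots> = integral {0..1} (\<lambda>s. fderiv h (s, p) (0, u))"
      proof (rule integral_cong)
        fix s :: real assume "s \<in> {0..1}"
        then have "linear (fderiv h (s, p))" using sub by (intro lin_h) auto
        moreover have "linear (\<lambda>u::'e. (0::real, u))" by (auto intro!: linearI)
        ultimately have "linear (fderiv h (s, p) \<circ> (\<lambda>u. (0, u)))" by (intro linear_compose)
        from linear_Basis_expansion[OF this, of u]
        show "(\<Sum>b\<in>Basis. (u \<bullet> b) *\<^sub>R fderiv h (s, p) (0, b)) = fderiv h (s, p) (0, u)" by simp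
      qed
      finally show ?thesis .
    qed
    then have "fderiv J p = (\<lambda>u. integral {0..1} (\<lambda>s. fderiv h (s, p) (0, u)))" by (rule ext)
    with solution_differentiable(1)[OF p] show ?thesis by simp
  qed
qed

text \<open>Applying the mean value theorem in either order to the second difference of \<open>f\<close> over small
  parallelograms with sides \<open>t u\<close> and \<open>t v\<close> gives values of the two mixed derivatives at points
  tending to \<open>x\<close>.\<close>

lemma second_derivative_symmetric_real:
  fixes f :: "'a::euclidean_space \<Rightarrow> real"
  assumes S: "open S" "x \<in> S" and f: "smooth_on f S"
  shows "fderiv (\<lambda>y. fderiv f y u) x v = fderiv (\<lambda>y. fderiv f y v) x u"
proof -
  have mean: "\<exists>y. norm (y - x) \<le> t * (norm u + norm v) \<and>
      f (x + t *\<^sub>R u + t *\<^sub>R v) - f (x + t *\<^sub>R u) - f (x + t *\<^sub>R v) + f x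
        = t * t * fderiv (\<lambda>y. fderiv f y u) y v"
    if t: "t > 0" and sub: "cball x (t * (norm u + norm v)) \<subseteq> S" for t u v
  proof -
    have inS: "x + a *\<^sub>R u + b *\<^sub>R v \<in> S \<and> norm (x + a *\<^sub>R u + b *\<^sub>R v - x) \<le> t * (norm u + norm v)"
      if "0 \<le> a" "a \<le> t" "0 \<le> b" "b \<le> t" for a b
    proof -
      have "norm (a *\<^sub>R u + b *\<^sub>R v) \<le> a * norm u + b * norm v"
        using norm_triangle_ineq[of "a *\<^sub>R u" "b *\<^sub>R v"] that by simp
      also have "\<dots> \<le> t * norm u + t * norm v"
        using that by (intro add_mono mult_right_mono) auto
      finally have "norm (a *\<^sub>R u + b *\<^sub>R v) \<le> t * (norm u + norm v)" by (simp add: algebra_simps)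
      moreover from this have "x + a *\<^sub>R u + b *\<^sub>R v \<in> cball x (t * (norm u + norm v))"
        by (metis add.assoc add_diff_cancel_left' dist_commute dist_norm mem_cball)
      ultimately show ?thesis using sub by (auto simp: add.assoc)
    qed
    have der: "((\<lambda>a. g (y + a *\<^sub>R w)) has_real_derivative fderiv g (y + a *\<^sub>R w) w) (at a)"
      if "smooth_on g S" "y + a *\<^sub>R w \<in> S" for g :: "'a \<Rightarrow> real" and y w a
    proof -
      have "((\<lambda>a. y + a *\<^sub>R w) has_derivative (\<lambda>a. a *\<^sub>R w)) (at a)"
        by (auto intro!: derivative_eq_intros)
      from has_derivative_compose[OF this smooth_on_has_derivative[OF that]]
      show ?thesis
        unfolding has_field_derivative_def
        by (rule has_derivative_eq_rhs)
          (simp add: fun_eq_iff linear_scale[OF linear_fderiv_smooth_on[OF that]] mult.commute)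
    qed
    define \<phi> where "\<phi> = (\<lambda>a. f (x + t *\<^sub>R v + a *\<^sub>R u) - f (x + a *\<^sub>R u))"
    have "\<exists>a. 0 < a \<and> a < t \<and> \<phi> t - \<phi> 0 =
        (t - 0) * (fderiv f (x + t *\<^sub>R v + a *\<^sub>R u) u - fderiv f (x + a *\<^sub>R u) u)"
    proof (rule MVT2[OF t])
      fix a assume "0 \<le> a" "a \<le> t"
      then show "(\<phi> has_real_derivative fderiv f (x + t *\<^sub>R v + a *\<^sub>R u) u - fderiv f (x + a *\<^sub>R u) u) (at a)"
        unfolding \<phi>_def using inS[of a t] inS[of a 0] t
        by (intro DERIV_diff der f) (simp_all add: algebra_simps)
    qed
    then obtain a where a: "0 < a" "a < t" and 1: "\<phi> t - \<phi> 0 =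
        t * (fderiv f (x + t *\<^sub>R v + a *\<^sub>R u) u - fderiv f (x + a *\<^sub>R u) u)" by auto
    have "\<exists>b. 0 < b \<and> b < t \<and> fderiv f (x + a *\<^sub>R u + t *\<^sub>R v) u - fderiv f (x + a *\<^sub>R u + 0 *\<^sub>R v) u
       = (t - 0) * fderiv (\<lambda>y. fderiv f y u) (x + a *\<^sub>R u + b *\<^sub>R v) v"
    proof (rule MVT2[OF t])
      fix b assume "0 \<le> b" "b \<le> t"
      then show "((\<lambda>b. fderiv f (x + a *\<^sub>R u + b *\<^sub>R v) u) has_real_derivative
          fderiv (\<lambda>y. fderiv f y u) (x + a *\<^sub>R u + b *\<^sub>R v) v) (at b)"
        using inS[of a b] a by (intro der smooth_on_fderiv f) auto
    qed
    then obtain b where b: "0 < b" "b < t"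
      and 2: "fderiv f (x + a *\<^sub>R u + t *\<^sub>R v) u - fderiv f (x + a *\<^sub>R u) u
       = t * fderiv (\<lambda>y. fderiv f y u) (x + a *\<^sub>R u + b *\<^sub>R v) v" by auto
    have "f (x + t *\<^sub>R u + t *\<^sub>R v) - f (x + t *\<^sub>R u) - f (x + t *\<^sub>R v) + f x = \<phi> t - \<phi> 0"
      by (simp add: \<phi>_def algebra_simps)
    also have "\<dots> = t * (t * fderiv (\<lambda>y. fderiv f y u) (x + a *\<^sub>R u + b *\<^sub>R v) v)"
      unfolding 1 2[symmetric] by (simp add: algebra_simps)
    finally show ?thesis
      using inS[of a b] a b by (intro exI[of _ "x + a *\<^sub>R u + b *\<^sub>R v"]) simp
  qed
  define E where "E = (\<lambda>u v y. fderiv (\<lambda>y. fderiv f y u) y v)"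
  obtain r where r: "r > 0" "cball x r \<subseteq> S" using S open_contains_cball by blast
  define t where "t = (\<lambda>n. r / ((norm u + norm v + 1) * (real n + 1)))"
  have pos: "norm u + norm v + 1 > 0" by (smt (verit) norm_ge_zero)
  have t: "t n > 0" "t n * (norm u + norm v) \<le> r / (real n + 1)" for n
  proof -
    show "t n > 0" using r pos by (simp add: t_def)
    have "t n * (norm u + norm v) \<le> t n * (norm u + norm v + 1)"
      using \<open>t n > 0\<close> by simp
    also have "\<dots> = r / (real n + 1)" using pos by (simp add: t_def)
    finally show "t n * (norm u + norm v) \<le> r / (real n + 1)" .
  qed
  have "r / (real n + 1) \<le> r" for n using r by (simp add: field_simps)
  then have sub: "cball x (t n * (norm u + norm v)) \<subseteq> S" for n
    using t(2)[of n] r(2) by (meson order_trans subset_cball)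
  have sub': "cball x (t n * (norm v + norm u)) \<subseteq> S" for n
    using sub[of n] by (simp add: add.commute)
  have "\<exists>y. norm (y - x) \<le> r / (real n + 1) \<and>
      f (x + t n *\<^sub>R u + t n *\<^sub>R v) - f (x + t n *\<^sub>R u) - f (x + t n *\<^sub>R v) + f x = t n * t n * E u v y" for n
    using mean[OF t(1) sub] t(2)[of n] unfolding E_def by (meson order_trans)
  then obtain y where y: "\<And>n. norm (y n - x) \<le> r / (real n + 1)"
    "\<And>n. f (x + t n *\<^sub>R u + t n *\<^sub>R v) - f (x + t n *\<^sub>R u) - f (x + t n *\<^sub>R v) + f x = t n * t n * E u v (y n)"
    by metis
  have "\<exists>y. norm (y - x) \<le> r / (real n + 1) \<and>
      f (x + t n *\<^sub>R v + t n *\<^sub>R u) - f (x + t n *\<^sub>R v) - f (x + t n *\<^sub>R u) + f x = t n * t n * E v u y" for n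
    using mean[OF t(1) sub'] t(2)[of n] unfolding E_def by (metis add.commute order_trans)
  then obtain z where z: "\<And>n. norm (z n - x) \<le> r / (real n + 1)"
    "\<And>n. f (x + t n *\<^sub>R v + t n *\<^sub>R u) - f (x + t n *\<^sub>R v) - f (x + t n *\<^sub>R u) + f x = t n * t n * E v u (z n)"
    by metis
  have "t n * t n * E u v (y n) = t n * t n * E v u (z n)" for n
    unfolding y(2)[symmetric] z(2)[symmetric] by (simp add: algebra_simps)
  then have eq: "E u v (y n) = E v u (z n)" for n
    using t(1)[of n] by (metis less_irrefl mult_eq_0_iff mult_left_cancel)
  have lim: "(\<lambda>n. E a b (w n)) \<longlonglongrightarrow> E a b x" if w: "\<And>n. norm (w n - x) \<le> r / (real n + 1)" for a b w
  proof -
    have "(\<lambda>n. r / (real n + 1)) \<longlonglongrightarrow> 0"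
      using LIMSEQ_ignore_initial_segment[OF lim_const_over_n[of r], of 1] by (simp add: add.commute)
    then have "(\<lambda>n. w n - x) \<longlonglongrightarrow> 0"
      by (rule Lim_null_comparison[rotated]) (simp add: w)
    then have "w \<longlonglongrightarrow> x" by (simp add: LIM_zero_iff)
    moreover have "isCont (E a b) x"
      unfolding E_def
      using smooth_on_imp_continuous_on[OF smooth_on_fderiv[OF smooth_on_fderiv[OF f]]] S
      by (simp add: continuous_on_eq_continuous_at)
    ultimately show ?thesis by (simp add: isCont_tendsto_compose)
  qed
  have "(\<lambda>n. E u v (y n)) \<longlonglongrightarrow> E u v x" by (rule lim[OF y(1)])
  moreover have "(\<lambda>n. E u v (y n)) \<longlonglongrightarrow> E v u x" unfolding eq by (rule lim[OF z(1)])
  ultimately have "E u v x = E v u x" by (rule LIMSEQ_unique)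
  then show ?thesis by (simp add: E_def)
qed

lemma second_derivative_symmetric:
  fixes f :: "'a::euclidean_space \<Rightarrow> 'b::euclidean_space"
  assumes S: "open S" "x \<in> S" and f: "smooth_on f S"
  shows "fderiv (\<lambda>y. fderiv f y u) x v = fderiv (\<lambda>y. fderiv f y v) x u"
proof (rule euclidean_eqI)
  fix b :: 'b
  define g where "g = (\<lambda>y. f y \<bullet> b)"
  have g: "smooth_on g S" unfolding g_def by (intro smooth_on_inner S f smooth_on_const)
  have dg: "fderiv g y w = fderiv f y w \<bullet> b" if "y \<in> S" for y w
    unfolding g_def
    by (simp add: fderiv_eq[OF has_derivative_inner_left[OF smooth_on_has_derivative[OF f that]]])
  have "fderiv (\<lambda>y. fderiv g y w) x w' = fderiv (\<lambda>y. fderiv f y w) x w' \<bullet> b" for w w'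
  proof -
    have "((\<lambda>y. fderiv f y w \<bullet> b) has_derivative (\<lambda>w'. fderiv (\<lambda>y. fderiv f y w) x w' \<bullet> b)) (at x)"
      by (rule has_derivative_inner_left[OF smooth_on_has_derivative[OF smooth_on_fderiv[OF f] S(2)]])
    then have "((\<lambda>y. fderiv g y w) has_derivative (\<lambda>w'. fderiv (\<lambda>y. fderiv f y w) x w' \<bullet> b)) (at x)"
      by (rule has_derivative_transform_within_open[OF _ S]) (simp add: dg)
    then show ?thesis by (simp add: fderiv_eq)
  qed
  then show "fderiv (\<lambda>y. fderiv f y u) x v \<bullet> b = fderiv (\<lambda>y. fderiv f y v) x u \<bullet> b"
    using second_derivative_symmetric_real[OF S g, of u v] by simp
qed

section \<open>The Frobenius theorem in coordinates\<close>

text \<open>The range of \<open>L q\<close> is a distribution that is a graph over \<open>span B\<close>: \<open>L q\<close> projects onto it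
  along the transversal \<open>span (Basis - B)\<close>. For \<open>u\<close>, \<open>v\<close> in \<open>span B\<close> the vector fields
  \<open>q \<mapsto> L q u\<close> and \<open>q \<mapsto> L q v\<close> span the distribution, and the last assumption says that their Lie
  bracket vanishes.\<close>

locale vertical_projection =
  fixes B :: "'e::euclidean_space set" and L :: "'e \<Rightarrow> 'e \<Rightarrow> 'e" and \<Omega> :: "'e set"
  assumes B: "B \<subseteq> Basis" and \<Omega>: "open \<Omega>" "0 \<in> \<Omega>"
    and linear_L: "\<And>q. q \<in> \<Omega> \<Longrightarrow> linear (L q)"
    and smooth_L: "\<And>v. smooth_on (\<lambda>q. L q v) \<Omega>"
    and proj_L: "\<And>q v. q \<in> \<Omega> \<Longrightarrow> proj B (L q v) = proj B v"
    and L_proj: "\<And>q v. q \<in> \<Omega> \<Longrightarrow> L q (proj B v) = L q v"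
    and involutive: "\<And>q u v. q \<in> \<Omega> \<Longrightarrow>
      fderiv (\<lambda>w. L w v) q (L q u) = fderiv (\<lambda>w. L w u) q (L q v)"
begin

abbreviation DL :: "'e \<Rightarrow> 'e \<Rightarrow> 'e \<Rightarrow> 'e" where
  "DL w k v \<equiv> fderiv (\<lambda>w. L w v) w k"

lemma linear_DL: "w \<in> \<Omega> \<Longrightarrow> linear (\<lambda>k. DL w k v)"
  using linear_fderiv_smooth_on[OF smooth_L] .

lemma DL_expand: "w \<in> \<Omega> \<Longrightarrow> DL w k v = (\<Sum>b\<in>Basis. (v \<bullet> b) *\<^sub>R DL w k b)"
  by (rule fderiv_linear_family_expansion[OF \<Omega>(1) linear_L smooth_L])

lemma linear_DL2: assumes "w \<in> \<Omega>" shows "linear (\<lambda>v. DL w k v)"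
  unfolding fun_eq_iff[of "\<lambda>v. DL w k v", THEN iffD2, OF allI[OF DL_expand[OF assms]]]
  by (intro linearI) (simp_all add: inner_add_left scaleR_add_left sum.distrib scaleR_sum_right)

lemma local_bounds:
  shows "\<exists>r C K. r > 0 \<and> C \<ge> 0 \<and> K \<ge> 0 \<and> cball 0 r \<subseteq> \<Omega> \<and>
    (\<forall>w k v. w \<in> cball 0 r \<longrightarrow> norm (DL w k v) \<le> C * norm v * norm k) \<and>
    (\<forall>w v. w \<in> cball 0 r \<longrightarrow> norm (L w v) \<le> K * norm v) \<and>
    (\<forall>w w' v. w \<in> cball 0 r \<longrightarrow> w' \<in> cball 0 r \<longrightarrow>
       norm (L w v - L w' v) \<le> C * norm v * norm (w - w'))"
proof -
  obtain r where r: "r > 0" "cball 0 r \<subseteq> \<Omega>" using \<Omega> open_contains_cball by blast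
  have "\<forall>b. \<exists>c\<ge>0. \<forall>w\<in>cball 0 r. \<forall>k. norm (DL w k b) \<le> c * norm k"
  proof
    fix b
    obtain c where "c \<ge> 0" "\<And>w k. w \<in> cball 0 r \<Longrightarrow> norm (DL w k b) \<le> c * norm k"
      using fderiv_bound_on_compact[OF smooth_onD[OF smooth_L] compact_cball r(2), of b] by blast
    then show "\<exists>c\<ge>0. \<forall>w\<in>cball 0 r. \<forall>k. norm (DL w k b) \<le> c * norm k" by blast
  qed
  from choice[OF this] obtain c where c: "\<And>b. c b \<ge> 0"
    "\<And>b w k. w \<in> cball 0 r \<Longrightarrow> norm (DL w k b) \<le> c b * norm k" by blast
  have "\<forall>b. \<exists>d\<ge>0. \<forall>w\<in>cball 0 r. norm (L w b) \<le> d"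
  proof
    fix b
    have "bounded ((\<lambda>w. L w b) ` cball 0 r)"
      by (intro compact_imp_bounded compact_continuous_image compact_cball
          continuous_on_subset[OF smooth_on_imp_continuous_on[OF smooth_L] r(2)])
    then obtain d where "\<forall>w\<in>cball 0 r. norm (L w b) \<le> d" by (auto simp: bounded_iff)
    then show "\<exists>d\<ge>0. \<forall>w\<in>cball 0 r. norm (L w b) \<le> d"
      by (intro exI[of _ "\<bar>d\<bar>"]) force
  qed
  from choice[OF this] obtain d where d: "\<And>b. d b \<ge> 0"
    "\<And>b w. w \<in> cball 0 r \<Longrightarrow> norm (L w b) \<le> d b" by blast
  define C where "C = (\<Sum>b\<in>Basis. c b)"
  define K where "K = (\<Sum>b\<in>Basis. d b)"
  have DLb: "norm (DL w k v) \<le> C * norm v * norm k" if w: "w \<in> cball 0 r" for w k v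
  proof -
    have "norm (DL w k v) \<le> (\<Sum>b\<in>Basis. norm (DL w k b)) * norm v"
      by (rule linear_norm_le_Basis_sum[OF linear_DL2[OF subsetD[OF r(2) w]]])
    also have "\<dots> \<le> (\<Sum>b\<in>Basis. c b * norm k) * norm v"
      by (intro mult_right_mono sum_mono c(2)[OF w]) simp
    also have "\<dots> = C * norm v * norm k" by (simp add: C_def sum_distrib_left[symmetric] sum_distrib_right[symmetric] mult_ac)
    finally show ?thesis .
  qed
  have Lb: "norm (L w v) \<le> K * norm v" if w: "w \<in> cball 0 r" for w v
  proof -
    have "norm (L w v) \<le> (\<Sum>b\<in>Basis. norm (L w b)) * norm v"
      by (rule linear_norm_le_Basis_sum[OF linear_L[OF subsetD[OF r(2) w]]])
    also have "\<dots> \<le> K * norm v"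
      unfolding K_def by (intro mult_right_mono sum_mono d(2)[OF w]) simp
    finally show ?thesis .
  qed
  have lip: "norm (L w v - L w' v) \<le> C * norm v * norm (w - w')"
    if "w \<in> cball 0 r" "w' \<in> cball 0 r" for w w' v
  proof (rule differentiable_bound[OF convex_cball _ _ that(1) that(2)])
    fix x :: 'e assume x: "x \<in> cball 0 r"
    then have "x \<in> \<Omega>" using r(2) by blast
    then show "((\<lambda>w. L w v) has_derivative (\<lambda>k. DL x k v)) (at x within cball 0 r)"
      using has_derivative_at_withinI[OF smooth_on_has_derivative[OF smooth_L[of v]]] by blast
    show "onorm (\<lambda>k. DL x k v) \<le> C * norm v"
      by (rule onorm_le) (rule DLb[OF x])
  qed
  have "C \<ge> 0" "K \<ge> 0" unfolding C_def K_def by (simp_all add: sum_nonneg c d)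
  with r DLb Lb lip show ?thesis
    by (intro exI[of _ r] exI[of _ C] exI[of _ K] conjI allI impI)
qed

text \<open>\<open>F p\<close> is the end point of the curve in the distribution that starts at the projection of \<open>p\<close> to
  the transversal and lies over the ray of \<open>p\<close>. By the linearised equation the derivative of \<open>F\<close> in
  a direction \<open>v\<close> of \<open>span B\<close> and the vector \<open>L (F p) v\<close> satisfy equations that differ in
  the order in which \<open>v\<close> and the direction of the ray enter the derivative of \<open>L\<close>. Involutivity
  exchanges the two, so the difference \<open>u v\<close> solves a homogeneous linear equation and is 0.\<close>

theorem foliated_coordinates:
  obtains F R where "R > 0" "smooth_on F (ball 0 R)" "F ` ball 0 R \<subseteq> \<Omega>" "F 0 = 0" "inj (fderiv F 0)"
    "\<And>p v. p \<in> ball 0 R \<Longrightarrow> fderiv F p (proj B v) = L (F p) v"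
proof -
  obtain r C K where "r > 0 \<and> C \<ge> 0 \<and> K \<ge> 0 \<and> cball 0 r \<subseteq> \<Omega> \<and>
    (\<forall>w k v. w \<in> cball 0 r \<longrightarrow> norm (DL w k v) \<le> C * norm v * norm k) \<and>
    (\<forall>w v. w \<in> cball 0 r \<longrightarrow> norm (L w v) \<le> K * norm v) \<and>
    (\<forall>w w' v. w \<in> cball 0 r \<longrightarrow> w' \<in> cball 0 r \<longrightarrow>
       norm (L w v - L w' v) \<le> C * norm v * norm (w - w'))"
    using local_bounds by (elim exE)
  then have r: "r > 0" "C \<ge> 0" "K \<ge> 0" "cball 0 r \<subseteq> \<Omega>"
    and bounds: "\<forall>w k v. w \<in> cball 0 r \<longrightarrow> norm (DL w k v) \<le> C * norm v * norm k"
    "\<forall>w v. w \<in> cball 0 r \<longrightarrow> norm (L w v) \<le> K * norm v"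
    "\<forall>w w' v. w \<in> cball 0 r \<longrightarrow> w' \<in> cball 0 r \<longrightarrow>
       norm (L w v - L w' v) \<le> C * norm v * norm (w - w')"
    by - (elim conjE, assumption)+
  note DLb = bounds(1)[rule_format] and Lb = bounds(2)[rule_format] and lip = bounds(3)[rule_format]
  define R where "R = min (1 / (2 * (C + 1))) (r / (1 + K))"
  have R: "R > 0" "C * R \<le> 1 / 2" "(1 + K) * R \<le> r"
  proof -
    show "R > 0" using r by (simp add: R_def)
    have "C * R \<le> C * (1 / (2 * (C + 1)))"
      unfolding R_def by (intro mult_left_mono min.cobounded1 r)
    also have "\<dots> \<le> 1 / 2" using r by (simp add: field_simps)
    finally show "C * R \<le> 1 / 2" .
    have "(1 + K) * R \<le> (1 + K) * (r / (1 + K))"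
      unfolding R_def using r by (intro mult_left_mono min.cobounded2) auto
    also have "\<dots> = r" using r by simp
    finally show "(1 + K) * R \<le> r" .
  qed
  \<comment> \<open>The family \<open>L\<close> is controlled on a ball only. The nonexpansive retraction \<open>\<kappa>\<close> makes the equation
    global, and the solution remains in the ball, where \<open>\<kappa>\<close> is the identity.\<close>
  define \<kappa> where "\<kappa> = closest_point (cball (0::'e) r)"
  have \<kappa>_in: "\<kappa> w \<in> cball 0 r" for w
    unfolding \<kappa>_def using r by (intro closest_point_in_set) auto
  have \<kappa>_lip: "norm (\<kappa> w - \<kappa> w') \<le> norm (w - w')" for w w'
    using closest_point_lipschitz[of "cball (0::'e) r" w w'] r(1) by (simp add: \<kappa>_def dist_norm)
  have \<kappa>_id: "w \<in> cball 0 r \<Longrightarrow> \<kappa> w = w" for w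
    unfolding \<kappa>_def by (rule closest_point_self)
  have cont\<kappa>: "continuous_on S \<kappa>" for S
    unfolding \<kappa>_def using r(1) by (intro continuous_on_closest_point) auto
  let ?H = "\<lambda>(s::real) p w. (p - proj B p) + L (\<kappa> w) (proj B p)"
  have normQ: "norm (p - proj B p) \<le> norm p" for p
    by (rule norm_le_componentwise) (simp add: inner_diff_left proj_inner[OF B])
  have normP: "norm (proj B p) \<le> norm p" for p by (rule norm_proj_le[OF B])
  have \<kappa>\<Omega>: "\<kappa> w \<in> \<Omega>" for w using \<kappa>_in r(4) by blast
  have contH: "continuous_on S (\<lambda>(s, p, w). ?H s p w)" for S
  proof -
    have "continuous_on S (\<lambda>z::real \<times> 'e \<times> 'e. L (\<kappa> (snd (snd z))) b)" for b
    proof (rule continuous_on_compose2[OF smooth_on_imp_continuous_on[OF smooth_L]])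
      show "continuous_on S (\<lambda>z::real \<times> 'e \<times> 'e. \<kappa> (snd (snd z)))"
        by (rule continuous_on_compose2[OF cont\<kappa>[of UNIV]]) (auto intro!: continuous_intros)
    qed (use \<kappa>\<Omega> in auto)
    then have "continuous_on S (\<lambda>z::real \<times> 'e \<times> 'e. L (\<kappa> (snd (snd z))) (proj B (fst (snd z))))"
      by (rule continuous_on_linear_family[where M = "\<lambda>z. L (\<kappa> (snd (snd z)))", OF linear_L[OF \<kappa>\<Omega>]])
        (intro continuous_intros)
    then show ?thesis unfolding split_beta by (intro continuous_intros)
  qed
  have cont_sh: "continuous_on ({0..1} \<times> cball 0 R) (\<lambda>(s, p). shrink B s p)"
    unfolding split_beta by (intro continuous_intros)
  have sh_in: "shrink B s p \<in> cball 0 R" if "s \<in> {0..1}" "p \<in> cball 0 R" for s p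
    using norm_shrink_le[OF B that(1), of p] that(2) by simp
  have contr: "norm (?H s p w - ?H s p w') \<le> 1 / 2 * norm (w - w')"
    if "s \<in> {0..1}" "p \<in> cball 0 R" for s p w w'
  proof -
    have "norm (?H s p w - ?H s p w') \<le> C * norm (proj B p) * norm (\<kappa> w - \<kappa> w')"
      using lip[OF \<kappa>_in \<kappa>_in] by simp
    also have "\<dots> \<le> C * R * norm (w - w')"
      using normP[of p] that(2) \<kappa>_lip r R(1) by (intro mult_mono) auto
    also have "\<dots> \<le> 1 / 2 * norm (w - w')"
      by (intro mult_right_mono R(2)) auto
    finally show ?thesis .
  qed
  have ne: "cball 0 R \<noteq> ({} :: 'e set)" using R by simp
  obtain F where contF: "continuous_on (cball 0 R) F"
    and F\<kappa>: "\<And>p. p \<in> cball 0 R \<Longrightarrow> F p = integral {0..1} (\<lambda>s. ?H s p (F (shrink B s p)))"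
    by (rule integral_fixed_point[where H = ?H and \<sigma> = "shrink B" and \<theta> = "1/2",
        OF compact_cball convex_cball ne cont_sh sh_in contH _ _ contr]) auto
  have F_in: "F p \<in> cball 0 r" if p: "p \<in> cball 0 R" for p
  proof -
    have "norm (F p) \<le> r * (1 - 0)"
      unfolding F\<kappa>[OF p]
    proof (rule integral_bound)
      have "continuous_on {0..1} (\<lambda>s. F (shrink B s p))"
        by (rule continuous_on_compose2[OF contF]) (use sh_in p in \<open>auto intro!: continuous_intros\<close>)
      then have c: "continuous_on {0..1} (\<lambda>s. (s, p, F (shrink B s p)))" by (intro continuous_intros)
      show "continuous_on {0..1} (\<lambda>s. ?H s p (F (shrink B s p)))"
        using continuous_on_compose2[OF contH[of UNIV] c] by simp
      fix s :: real
      have "norm (?H s p (F (shrink B s p))) \<le> norm (p - proj B p) + K * norm (proj B p)"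
        using norm_triangle_ineq[of "p - proj B p"] Lb[OF \<kappa>_in] by (smt (verit))
      also have "\<dots> \<le> norm p + K * norm p"
        by (intro add_mono mult_left_mono normQ normP r)
      also have "\<dots> = (1 + K) * norm p" by (simp add: algebra_simps)
      also have "\<dots> \<le> (1 + K) * R" using p r by (intro mult_left_mono) auto
      also have "\<dots> \<le> r" by (rule R)
      finally show "norm (?H s p (F (shrink B s p))) \<le> r" .
    qed simp
    then show ?thesis by simp
  qed
  have F\<Omega>: "F p \<in> \<Omega>" if "p \<in> cball 0 R" for p using F_in[OF that] r(4) by blast
  define H where "H = (\<lambda>z :: real \<times> 'e \<times> 'e. (fst (snd z) - proj B (fst (snd z)))
     + L (snd (snd z)) (proj B (fst (snd z))))"
  define W where "W = (\<lambda>z :: real \<times> 'e \<times> 'e. snd (snd z)) -` \<Omega>"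
  have H_eq: "H (s, p, w) = (p - proj B p) + L w p" if "w \<in> \<Omega>" for s p w
    by (simp add: H_def L_proj[OF that])
  have W: "open W" unfolding W_def by (intro open_vimage \<Omega> continuous_intros)
  have linsnd: "linear (\<lambda>z::real \<times> 'e \<times> 'e. fst (snd z))" "linear (\<lambda>z::real \<times> 'e \<times> 'e. snd (snd z))"
    by (auto intro!: linearI)
  have linPsnd: "linear (\<lambda>z::real \<times> 'e \<times> 'e. proj B (fst (snd z)))"
    using linear_compose[OF linsnd(1) linear_proj[of B]] by (simp add: o_def)
  have LW: "smooth_on (\<lambda>z::real \<times> 'e \<times> 'e. L (snd (snd z)) b) W" for b
    by (rule smooth_on_compose[where g = "\<lambda>w. L w b", OF W \<Omega>(1) _ smooth_on_linear[OF linsnd(2)] smooth_L])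
      (simp add: W_def)
  have "smooth_on (\<lambda>z::real \<times> 'e \<times> 'e. L (snd (snd z)) (proj B (fst (snd z)))) W"
    by (rule smooth_on_linear_family[where M = "\<lambda>z. L (snd (snd z))", OF W _ LW smooth_on_linear[OF linPsnd]])
      (simp add: W_def linear_L)
  then have smooth_H: "smooth_on H W"
    unfolding H_def
    by (intro smooth_on_add smooth_on_diff W smooth_on_linear[OF linsnd(1)] smooth_on_linear[OF linPsnd])
  have DH: "fderiv H (s, p, w) (0, u, k) = (u - proj B u) + L w u + DL w k (proj B p)"
    if w: "w \<in> \<Omega>" for s p w u k
  proof -
    let ?z = "(s, p, w)"
    note d = linear_has_derivative[OF linsnd(1), of "at ?z"] linear_has_derivative[OF linPsnd, of "at ?z"]
      linear_has_derivative[OF linsnd(2), of "at ?z"]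
    have w': "snd (snd ?z) \<in> \<Omega>" using w by simp
    have "(H has_derivative (\<lambda>y. (fst (snd y) - proj B (fst (snd y))) +
        (DL (snd (snd ?z)) (snd (snd y)) (proj B (fst (snd ?z))) + L (snd (snd ?z)) (proj B (fst (snd y)))))) (at ?z)"
      unfolding H_def
      by (intro has_derivative_add has_derivative_diff d(1,2)
          has_derivative_linear_family[where M = L, OF \<Omega>(1) linear_L smooth_L d(3) w' d(2)])
    from fun_cong[OF fderiv_eq[OF this], of "(0, u, k)"] show ?thesis
      by (simp add: L_proj[OF w])
  qed
  have sub: "ball 0 R \<subseteq> (cball 0 R :: 'e set)" by auto
  have sh_ball: "shrink B s p \<in> ball 0 R" if "s \<in> {0..1}" "p \<in> ball 0 R" for s p
    using norm_shrink_le[OF B that(1), of p] that(2) by simp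
  have DLhalf: "norm (DL w k (proj B p)) \<le> 1 / 2 * norm k" if "w \<in> cball 0 r" "p \<in> ball 0 R" for w k p
  proof -
    have "norm (DL w k (proj B p)) \<le> C * norm (proj B p) * norm k" by (rule DLb[OF that(1)])
    also have "\<dots> \<le> C * R * norm k"
      using normP[of p] that(2) r by (intro mult_right_mono mult_left_mono) auto
    also have "\<dots> \<le> 1 / 2 * norm k" by (intro mult_right_mono R(2)) auto
    finally show ?thesis .
  qed
  have F_sh: "F (shrink B s p) \<in> cball 0 r" "F (shrink B s p) \<in> \<Omega>"
    if "s \<in> {0..1}" "p \<in> ball 0 R" for s p
    using F_in F\<Omega> sh_ball[OF that] sub by blast+
  interpret E: ray_integral_equation B H W F R "1/2"
  proof unfold_locales
    show "Cm_on (Suc 0) H W" by (rule smooth_onD[OF smooth_H])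
    show "continuous_on (ball 0 R) F" by (rule continuous_on_subset[OF contF sub])
    show "(s, p, F (shrink B s p)) \<in> W" if "s \<in> {0..1}" "p \<in> ball 0 R" for s p
      using F_sh[OF that] by (simp add: W_def)
    show "norm (fderiv H (s, p, F (shrink B s p)) (0, 0, k)) \<le> 1 / 2 * norm k"
      if "s \<in> {0..1}" "p \<in> ball 0 R" for s p k
      using DLhalf[OF F_sh(1)[OF that] that(2)]
      by (simp add: DH[OF F_sh(2)[OF that]] linear_0[OF linear_proj] linear_0[OF linear_L[OF F_sh(2)[OF that]]])
    show "F p = integral {0..1} (\<lambda>s. H (s, p, F (shrink B s p)))" if p: "p \<in> ball 0 R" for p
      unfolding F\<kappa>[OF subsetD[OF sub p]]
      by (rule integral_cong) (simp add: H_eq[OF F_sh(2)[OF _ p]] L_proj[OF F_sh(2)[OF _ p]] \<kappa>_id[OF F_sh(1)[OF _ p]])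
  qed (use B W in auto)
  have smooth_F: "smooth_on F (ball 0 R)"
    unfolding smooth_on_def
    by (intro allI ray_solution_Cm_on[OF E.ray_integral_equation_axioms] smooth_onD[OF smooth_H])
  have R0: "0 \<in> ball (0::'e) R" using R(1) by simp
  have sh0: "shrink B s 0 = 0" for s by (rule linear_0[OF linear_shrink])
  have "F 0 = 0"
    using E.eq[OF R0] F\<Omega>[OF subsetD[OF sub R0]]
    by (simp add: sh0 H_eq linear_0[OF linear_proj] linear_0[OF linear_L])
  have linF: "linear (fderiv F q)" if "q \<in> ball 0 R" for q
    by (rule linear_fderiv_smooth_on[OF smooth_F that])
  have contDF: "continuous_on (ball 0 R) (\<lambda>q. fderiv F q v)" for v
    by (rule smooth_on_imp_continuous_on[OF smooth_on_fderiv[OF smooth_F]])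
  have cont_ray: "continuous_on {0..1} (\<lambda>s. g (shrink B s q))"
    if "continuous_on (ball 0 R) g" "q \<in> ball 0 R" for g :: "'e \<Rightarrow> 'e" and q
    by (rule continuous_on_compose2[OF that(1)])
      (use sh_ball that(2) in \<open>auto intro!: continuous_intros\<close>)
  have contF': "continuous_on (ball 0 R) F" by (rule E.cont)
  have cont_L: "continuous_on {0..1} (\<lambda>s. L (F (shrink B s q)) v)" if "q \<in> ball 0 R" for q v
    by (rule continuous_on_compose2[OF smooth_on_imp_continuous_on[OF smooth_L] cont_ray[OF contF' that]])
      (use F_sh(2) that in auto)
  have cont_DL: "continuous_on {0..1} (\<lambda>s. DL (F (shrink B s q)) (u s) v)"
    if q: "q \<in> ball 0 R" and u: "continuous_on {0..1} u" for q u v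
  proof (rule continuous_on_linear_family[OF _ _ u, where M = "\<lambda>s. fderiv (\<lambda>w. L w v) (F (shrink B s q))"])
    show "linear (fderiv (\<lambda>w. L w v) (F (shrink B s q)))" if "s \<in> {0..1}" for s
      by (rule linear_DL[OF F_sh(2)[OF that q]])
    show "continuous_on {0..1} (\<lambda>s. DL (F (shrink B s q)) b v)" for b
      by (rule continuous_on_compose2[OF smooth_on_imp_continuous_on[OF smooth_on_fderiv[OF smooth_L]]
            cont_ray[OF contF' q]])
        (use F_sh(2) q in auto)
  qed
  have DF: "fderiv F q (proj B v) = integral {0..1} (\<lambda>s. L (F (shrink B s q)) v
      + s *\<^sub>R DL (F (shrink B s q)) (fderiv F (shrink B s q) (proj B v)) (proj B q))"
    if q: "q \<in> ball 0 R" for q v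
  proof -
    let ?g = "\<lambda>b s. L (F (shrink B s q)) b + s *\<^sub>R DL (F (shrink B s q)) (fderiv F (shrink B s q) b) (proj B q)"
    have g: "?g b integrable_on {0..1}" for b
      by (intro integrable_continuous_real continuous_intros cont_L cont_DL cont_ray contDF q)
    have fin: "finite B" using B finite_Basis finite_subset by blast
    have b: "fderiv F q b = integral {0..1} (?g b)" if "b \<in> B" for b
    proof -
      have "b \<in> Basis" using that B by auto
      have P: "proj B b = b" using proj_Basis[OF B \<open>b \<in> Basis\<close>] that by simp
      show ?thesis
        unfolding E.solution_differentiable(2)[OF q \<open>b \<in> Basis\<close>] E.graph_point_def
      proof (rule integral_cong)
        fix s :: real assume s: "s \<in> {0..1}"
        show "fderiv H (s, q, F (shrink B s q)) (0, b, E.weight b s *\<^sub>R fderiv F (shrink B s q) b) = ?g b s"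
          unfolding DH[OF F_sh(2)[OF s q]] linear_scale[OF linear_DL[OF F_sh(2)[OF s q]]]
          using that by (simp add: P E.weight_def)
      qed
    qed
    have "fderiv F q (proj B v) = (\<Sum>b\<in>B. (v \<bullet> b) *\<^sub>R integral {0..1} (?g b))"
      unfolding proj_def[of B v] linear_sum[OF linF[OF q]] linear_scale[OF linF[OF q]]
      by (intro sum.cong refl) (simp add: b)
    also have "\<dots> = integral {0..1} (\<lambda>s. \<Sum>b\<in>B. (v \<bullet> b) *\<^sub>R ?g b s)"
      using fin by (subst integral_sum) (auto intro!: integrable_cmul g)
    also have "\<dots> = integral {0..1} (\<lambda>s. L (F (shrink B s q)) v
      + s *\<^sub>R DL (F (shrink B s q)) (fderiv F (shrink B s q) (proj B v)) (proj B q))"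
    proof (rule integral_cong)
      fix s :: real assume s: "s \<in> {0..1}"
      note w = F_sh(2)[OF s q]
      have 1: "(\<Sum>b\<in>B. (v \<bullet> b) *\<^sub>R L (F (shrink B s q)) b) = L (F (shrink B s q)) v"
        by (subst L_proj[OF w, symmetric])
          (simp add: proj_def linear_sum[OF linear_L[OF w]] linear_scale[OF linear_L[OF w]])
      have 2: "(\<Sum>b\<in>B. (v \<bullet> b) *\<^sub>R s *\<^sub>R DL (F (shrink B s q)) (fderiv F (shrink B s q) b) (proj B q))
        = s *\<^sub>R DL (F (shrink B s q)) (fderiv F (shrink B s q) (proj B v)) (proj B q)"
        unfolding proj_def[of B v]
        by (simp add: linear_sum[OF linF[OF sh_ball[OF s q]]] linear_scale[OF linF[OF sh_ball[OF s q]]]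
            linear_sum[OF linear_DL[OF w]] linear_scale[OF linear_DL[OF w]] scaleR_sum_right mult.commute)
      show "(\<Sum>b\<in>B. (v \<bullet> b) *\<^sub>R ?g b s) = L (F (shrink B s q)) v
        + s *\<^sub>R DL (F (shrink B s q)) (fderiv F (shrink B s q) (proj B v)) (proj B q)"
        unfolding scaleR_add_right sum.distrib 1 2 ..
    qed
    finally show ?thesis .
  qed
  \<comment> \<open>The integrand is the derivative of \<open>s *\<^sub>R L (F (shrink B s q)) v\<close>.\<close>
  have LF: "L (F q) v = integral {0..1} (\<lambda>s. L (F (shrink B s q)) v
      + s *\<^sub>R DL (F (shrink B s q)) (fderiv F (shrink B s q) (proj B q)) v)"
    if q: "q \<in> ball 0 R" for q v
  proof -
    have "((\<lambda>s. L (F (shrink B s q)) v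
      + s *\<^sub>R DL (F (shrink B s q)) (fderiv F (shrink B s q) (proj B q)) v) has_integral
       (1 *\<^sub>R L (F (shrink B 1 q)) v - 0 *\<^sub>R L (F (shrink B 0 q)) v)) {0..1}"
    proof (rule fundamental_theorem_of_calculus)
      fix s :: real assume s: "s \<in> {0..1}"
      have "((\<lambda>s. shrink B s q) has_derivative (\<lambda>t. t *\<^sub>R proj B q)) (at s)"
        unfolding shrink_def by (auto intro!: derivative_eq_intros)
      from has_derivative_compose[where g = F, OF this smooth_on_has_derivative[OF smooth_F sh_ball[OF s q]]]
      have "((\<lambda>s. F (shrink B s q)) has_derivative (\<lambda>t. fderiv F (shrink B s q) (t *\<^sub>R proj B q))) (at s)"
        by blast
      from has_derivative_compose[where g = "\<lambda>w. L w v", OF this smooth_on_has_derivative[OF smooth_L F_sh(2)[OF s q]]]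
      have d: "((\<lambda>s. L (F (shrink B s q)) v) has_derivative
         (\<lambda>t. DL (F (shrink B s q)) (fderiv F (shrink B s q) (t *\<^sub>R proj B q)) v)) (at s)" by blast
      have "((\<lambda>s. s *\<^sub>R L (F (shrink B s q)) v) has_derivative
         (\<lambda>t. s *\<^sub>R DL (F (shrink B s q)) (fderiv F (shrink B s q) (t *\<^sub>R proj B q)) v
            + t *\<^sub>R L (F (shrink B s q)) v)) (at s)"
        by (intro has_derivative_scaleR has_derivative_ident d)
      then have "((\<lambda>s. s *\<^sub>R L (F (shrink B s q)) v) has_vector_derivative
         L (F (shrink B s q)) v + s *\<^sub>R DL (F (shrink B s q)) (fderiv F (shrink B s q) (proj B q)) v) (at s)"
        unfolding has_vector_derivative_def
        by (rule has_derivative_eq_rhs)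
          (simp add: fun_eq_iff linear_scale[OF linF[OF sh_ball[OF s q]]]
            linear_scale[OF linear_DL[OF F_sh(2)[OF s q]]] algebra_simps)
      then show "((\<lambda>s. s *\<^sub>R L (F (shrink B s q)) v) has_vector_derivative
         L (F (shrink B s q)) v + s *\<^sub>R DL (F (shrink B s q)) (fderiv F (shrink B s q) (proj B q)) v)
         (at s within {0..1})"
        by (rule has_vector_derivative_at_within)
    qed simp
    then show ?thesis by (simp add: integral_unique)
  qed
  \<comment> \<open>For \<open>v = proj B q\<close> the right-hand sides of \<open>DF\<close> and \<open>LF\<close> coincide.\<close>
  have euler: "fderiv F q (proj B q) = L (F q) q" if q: "q \<in> ball 0 R" for q
    using DF[OF q, of q] LF[OF q, of "proj B q"]
    using integral_cong[of "{0..1::real}" "\<lambda>s. L (F (shrink B s q)) q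
      + s *\<^sub>R DL (F (shrink B s q)) (fderiv F (shrink B s q) (proj B q)) (proj B q)"
      "\<lambda>s. L (F (shrink B s q)) (proj B q)
      + s *\<^sub>R DL (F (shrink B s q)) (fderiv F (shrink B s q) (proj B q)) (proj B q)"]
    by (simp add: L_proj[OF F_sh(2)[OF _ q]] L_proj[OF F\<Omega>[OF subsetD[OF sub q]]])
  define u where "u = (\<lambda>v q. fderiv F q (proj B v) - L (F q) v)"
  have u_eq: "u v q = integral {0..1} (\<lambda>s. s *\<^sub>R DL (F (shrink B s q)) (u v (shrink B s q)) (proj B q))"
    if q: "q \<in> ball 0 R" for q v
  proof -
    let ?F = "\<lambda>s. F (shrink B s q)" and ?D = "\<lambda>s. fderiv F (shrink B s q)"
    have "u v q = integral {0..1} (\<lambda>s. (L (?F s) v + s *\<^sub>R DL (?F s) (?D s (proj B v)) (proj B q))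
       - (L (?F s) v + s *\<^sub>R DL (?F s) (?D s (proj B q)) v))"
      unfolding u_def DF[OF q] LF[OF q]
      by (rule integral_diff[symmetric])
        (intro integrable_continuous_real continuous_intros cont_L cont_DL cont_ray contDF q)+
    also have "\<dots> = integral {0..1} (\<lambda>s. s *\<^sub>R DL (?F s) (u v (shrink B s q)) (proj B q))"
    proof (rule integral_cong)
      fix s :: real assume s: "s \<in> {0..1}"
      note w = F_sh(2)[OF s q]
      have "s *\<^sub>R DL (?F s) (?D s (proj B q)) v = DL (?F s) (?D s (proj B (shrink B s q))) v"
        by (simp add: proj_shrink[OF B] linear_scale[OF linF[OF sh_ball[OF s q]]] linear_scale[OF linear_DL[OF w]])
      also have "\<dots> = DL (?F s) (L (?F s) (shrink B s q)) v"
        by (simp only: euler[OF sh_ball[OF s q]])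
      also have "L (?F s) (shrink B s q) = L (?F s) (s *\<^sub>R proj B q)"
        by (subst L_proj[OF w, symmetric]) (simp only: proj_shrink[OF B])
      also have "DL (?F s) (L (?F s) (s *\<^sub>R proj B q)) v = s *\<^sub>R DL (?F s) (L (?F s) (proj B q)) v"
        by (simp add: linear_scale[OF linear_L[OF w]] linear_scale[OF linear_DL[OF w]])
      also have "DL (?F s) (L (?F s) (proj B q)) v = DL (?F s) (L (?F s) v) (proj B q)"
        by (rule involutive[OF w])
      finally have *: "s *\<^sub>R DL (?F s) (?D s (proj B q)) v = s *\<^sub>R DL (?F s) (L (?F s) v) (proj B q)" .
      show "(L (?F s) v + s *\<^sub>R DL (?F s) (?D s (proj B v)) (proj B q))
       - (L (?F s) v + s *\<^sub>R DL (?F s) (?D s (proj B q)) v)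
       = s *\<^sub>R DL (?F s) (u v (shrink B s q)) (proj B q)"
        unfolding * u_def by (simp add: linear_diff[OF linear_DL[OF w]] scaleR_diff_right)
    qed
    finally show ?thesis .
  qed
  have contu: "continuous_on (ball 0 R) (u v)" for v
    unfolding u_def
    using F\<Omega> sub by (intro continuous_on_diff contDF
      continuous_on_compose2[OF smooth_on_imp_continuous_on[OF smooth_L] contF']) auto
  have tangent: "fderiv F p (proj B v) = L (F p) v" if p: "p \<in> ball 0 R" for p v
  proof -
    have "norm (u v (shrink B 1 p)) \<le> 0 / (1 - 1 / 2)"
    proof (rule bound_by_own_maximum[where f = "\<lambda>r. norm (u v (shrink B r p))" and \<theta> = "1/2"])
      show "continuous_on {0..1} (\<lambda>r. norm (u v (shrink B r p)))"
        by (intro continuous_on_norm cont_ray contu p)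
      fix r' M assume r': "r' \<in> {0..1::real}" and M: "\<And>s. s \<in> {0..1} \<Longrightarrow> norm (u v (shrink B s p)) \<le> M"
      let ?q = "shrink B r' p"
      have q: "?q \<in> ball 0 R" by (rule sh_ball[OF r' p])
      have "norm (u v ?q) \<le> 1 / 2 * M * (1 - 0)"
        unfolding u_eq[OF q, of v]
      proof (rule integral_bound)
        show "continuous_on {0..1} (\<lambda>s. s *\<^sub>R DL (F (shrink B s ?q)) (u v (shrink B s ?q)) (proj B ?q))"
          by (intro continuous_intros cont_DL cont_ray contu q)
        fix s :: real assume s: "s \<in> {0..1}"
        have "norm (s *\<^sub>R DL (F (shrink B s ?q)) (u v (shrink B s ?q)) (proj B ?q))
          \<le> 1 * norm (DL (F (shrink B s ?q)) (u v (shrink B s ?q)) (proj B ?q))"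
          unfolding norm_scaleR using s by (intro mult_right_mono) auto
        also have "\<dots> \<le> 1 / 2 * norm (u v (shrink B s ?q))"
          using DLhalf[OF F_sh(1)[OF s q] q] by simp
        also have "\<dots> \<le> 1 / 2 * M"
          using M[of "s * r'"] s r' by (simp add: shrink_shrink[OF B] mult_le_one)
        finally show "norm (s *\<^sub>R DL (F (shrink B s ?q)) (u v (shrink B s ?q)) (proj B ?q)) \<le> 1 / 2 * M" .
      qed simp
      then show "norm (u v ?q) \<le> 0 + 1 / 2 * M" by simp
    qed auto
    then show ?thesis by (simp add: u_def)
  qed
  have "inj (fderiv F 0)"
    unfolding linear_injective_0[OF linF[OF R0]]
  proof (intro allI impI)
    fix h assume h: "fderiv F 0 h = 0"
    have Fb: "fderiv F 0 b = b" if "b \<in> Basis - B" for b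
    proof -
      have P: "proj B b = 0" using proj_Basis[OF B, of b] that by auto
      have L0: "L w b = 0" if "w \<in> \<Omega>" for w
        using L_proj[OF that, of b] linear_0[OF linear_L[OF that]] by (simp add: P)
      have "fderiv F 0 b = integral {0..1} (\<lambda>s::real. b)"
        unfolding E.solution_differentiable(2)[OF R0 DiffD1[OF that]] E.graph_point_def
      proof (rule integral_cong)
        fix s :: real assume s: "s \<in> {0..1}"
        note w = F_sh(2)[OF s R0]
        show "fderiv H (s, 0, F (shrink B s 0)) (0, b, E.weight b s *\<^sub>R fderiv F (shrink B s 0) b) = b"
          unfolding DH[OF w] by (simp add: P L0[OF w] linear_0[OF linear_proj] linear_0[OF linear_DL2[OF w]])
      qed
      then show ?thesis by simp
    qed
    have "h = proj B h + (\<Sum>b\<in>Basis - B. (h \<bullet> b) *\<^sub>R b)"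
      unfolding proj_def using B sum.subset_diff[OF B finite_Basis, of "\<lambda>b. (h \<bullet> b) *\<^sub>R b"]
      by (simp add: euclidean_representation add.commute)
    then have "fderiv F 0 h = fderiv F 0 (proj B h) + (\<Sum>b\<in>Basis - B. (h \<bullet> b) *\<^sub>R fderiv F 0 b)"
      by (metis (no_types, lifting) linear_add[OF linF[OF R0]] linear_sum[OF linF[OF R0]]
          linear_scale[OF linF[OF R0]] sum.cong)
    also have "\<dots> = L 0 h + (\<Sum>b\<in>Basis - B. (h \<bullet> b) *\<^sub>R b)"
      by (simp add: tangent[OF R0] \<open>F 0 = 0\<close> Fb)
    finally have eq: "L 0 h + (\<Sum>b\<in>Basis - B. (h \<bullet> b) *\<^sub>R b) = 0" using h by simp
    have "proj B (\<Sum>b\<in>Basis - B. (h \<bullet> b) *\<^sub>R b) = 0"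
      unfolding linear_sum[OF linear_proj] linear_scale[OF linear_proj]
      by (intro sum.neutral ballI) (auto simp: proj_Basis[OF B])
    with arg_cong[OF eq, of "proj B"] have "proj B h = 0"
      by (simp add: linear_add[OF linear_proj] linear_0[OF linear_proj] proj_L[OF \<Omega>(2)])
    moreover from this have "L 0 h = 0"
      using L_proj[OF \<Omega>(2), of h] linear_0[OF linear_L[OF \<Omega>(2)]] by simp
    ultimately show "h = 0" using eq \<open>h = proj B h + _\<close> by simp
  qed
  show ?thesis
    by (rule that[OF R(1) smooth_F _ \<open>F 0 = 0\<close> \<open>inj (fderiv F 0)\<close> tangent])
      (use F\<Omega> sub in auto)
qed

end

section \<open>Darboux coordinates for a closed form that vanishes on a foliation\<close>

text \<open>The coefficients of a closed two-form on a ball for which the leaves of the foliation by the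
  translates of \<open>span B\<close> are isotropic.\<close>

locale polarized_closed_form =
  fixes B :: "'e::euclidean_space set" and R :: real and w :: "'e \<Rightarrow> 'e \<Rightarrow> 'e \<Rightarrow> real"
  assumes B: "B \<subseteq> Basis"
    and linear_w: "\<And>q u. q \<in> ball 0 R \<Longrightarrow> linear (w q u)"
    and antisym_w: "\<And>q u v. q \<in> ball 0 R \<Longrightarrow> w q u v = - w q v u"
    and smooth_w: "\<And>u v. smooth_on (\<lambda>q. w q u v) (ball 0 R)"
    and closed_w: "\<And>q u v t. q \<in> ball 0 R \<Longrightarrow>
      fderiv (\<lambda>q. w q v t) q u - fderiv (\<lambda>q. w q u t) q v + fderiv (\<lambda>q. w q u v) q t = 0"
    and isotropic_w: "\<And>q u v. q \<in> ball 0 R \<Longrightarrow> w q (proj B u) (proj B v) = 0"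
begin

abbreviation Dw :: "'e \<Rightarrow> 'e \<Rightarrow> 'e \<Rightarrow> 'e \<Rightarrow> real" where
  "Dw q u v \<equiv> fderiv (\<lambda>q. w q u v) q"

text \<open>The integrand of the homotopy operator of the Poincare lemma, evaluated on a constant transversal
  vector field \<open>b\<close>. The first summand comes from the deformation along the leaves to the transversal;
  by isotropy it contributes nothing to the values of the primitive on vectors of \<open>span B\<close>. The second
  comes from the radial contraction of the transversal, with the factor \<open>fst z\<close> from pulling back \<open>b\<close>
  by that contraction.\<close>

definition homotopy_integrand :: "'e \<Rightarrow> real \<times> 'e \<Rightarrow> real" where
  "homotopy_integrand b z = w (shrink B (fst z) (snd z)) b (proj B (snd z))
     + fst z * w (fst z *\<^sub>R (snd z - proj B (snd z))) b (snd z - proj B (snd z))"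

definition darboux_coord :: "'e \<Rightarrow> 'e \<Rightarrow> real" where
  "darboux_coord b q = integral {0..1} (\<lambda>s. homotopy_integrand b (s, q))"

text \<open>An open neighbourhood of \<open>{0..1} \<times> ball 0 R\<close> on which the integrand makes sense.\<close>

definition ray_domain :: "(real \<times> 'e) set" where
  "ray_domain = (\<lambda>z. shrink B (fst z) (snd z)) -` ball 0 R \<inter>
    (\<lambda>z. fst z *\<^sub>R (snd z - proj B (snd z))) -` ball 0 R"

lemma shrink_in: "s \<in> {0..1} \<Longrightarrow> q \<in> ball 0 R \<Longrightarrow> shrink B s q \<in> ball 0 R"
  using norm_shrink_le[OF B, of s q] by simp

lemma scale_in: "s \<in> {0..1} \<Longrightarrow> q \<in> ball 0 R \<Longrightarrow> s *\<^sub>R (q - proj B q) \<in> ball 0 R"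
proof -
  assume s: "s \<in> {0..1}" and q: "q \<in> ball 0 R"
  have "norm (q - proj B q) \<le> norm q"
    by (rule norm_le_componentwise) (simp add: inner_diff_left proj_inner[OF B])
  moreover have "\<bar>s\<bar> * norm (q - proj B q) \<le> 1 * norm (q - proj B q)"
    using s by (intro mult_right_mono) auto
  ultimately show ?thesis using q by simp
qed

lemma ray_domain: "open ray_domain" "{0..1} \<times> ball 0 R \<subseteq> ray_domain"
  unfolding ray_domain_def using shrink_in scale_in
  by (auto intro!: open_Int open_vimage continuous_intros)

lemma smooth_homotopy_integrand: "smooth_on (homotopy_integrand b) ray_domain"
proof -
  have lin: "linear (\<lambda>z::real \<times> 'e. snd z)" "linear (\<lambda>z::real \<times> 'e. fst z)" by (auto intro!: linearI)
  have P: "smooth_on (\<lambda>z::real \<times> 'e. proj B (snd z)) ray_domain"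
    using linear_compose[OF lin(1) linear_proj[of B]] by (intro smooth_on_linear) (simp add: o_def)
  note intros = ray_domain(1) P smooth_on_linear[OF lin(1)] smooth_on_linear[OF lin(2)] smooth_on_const
  have 1: "smooth_on (\<lambda>z. shrink B (fst z) (snd z)) ray_domain"
    unfolding shrink_def by (intro smooth_on_add smooth_on_scaleR smooth_on_diff intros)
  have 2: "smooth_on (\<lambda>z. fst z *\<^sub>R (snd z - proj B (snd z))) ray_domain"
    by (intro smooth_on_scaleR smooth_on_diff intros)
  have w1: "smooth_on (\<lambda>z. w (shrink B (fst z) (snd z)) b c) ray_domain" for c
    by (rule smooth_on_compose[where g = "\<lambda>q. w q b c", OF ray_domain(1) open_ball _ 1 smooth_w]) (simp add: ray_domain_def)
  have w2: "smooth_on (\<lambda>z. w (fst z *\<^sub>R (snd z - proj B (snd z))) b c) ray_domain" for c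
    by (rule smooth_on_compose[where g = "\<lambda>q. w q b c", OF ray_domain(1) open_ball _ 2 smooth_w]) (simp add: ray_domain_def)
  have 3: "smooth_on (\<lambda>z. w (shrink B (fst z) (snd z)) b (proj B (snd z))) ray_domain"
    by (rule smooth_on_linear_family[where M = "\<lambda>z. w (shrink B (fst z) (snd z)) b", OF ray_domain(1) _ w1 P])
      (auto simp: ray_domain_def intro: linear_w)
  have Q: "smooth_on (\<lambda>z::real \<times> 'e. snd z - proj B (snd z)) ray_domain"
    by (intro smooth_on_diff intros)
  have 4: "smooth_on (\<lambda>z. w (fst z *\<^sub>R (snd z - proj B (snd z))) b (snd z - proj B (snd z))) ray_domain"
    by (rule smooth_on_linear_family[where M = "\<lambda>z. w (fst z *\<^sub>R (snd z - proj B (snd z))) b", OF ray_domain(1) _ w2 Q])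
      (auto simp: ray_domain_def intro: linear_w)
  show ?thesis
    unfolding homotopy_integrand_def[abs_def] by (intro smooth_on_add smooth_on_mult 3 4 intros)
qed

lemma fderiv_homotopy_integrand:
  assumes s: "s \<in> {0..1}" and q: "q \<in> ball 0 R"
  shows "fderiv (homotopy_integrand b) (s, q) (0, u) =
    Dw (shrink B s q) b (proj B q) (shrink B s u) + w (shrink B s q) b (proj B u)
    + s * (Dw (s *\<^sub>R (q - proj B q)) b (q - proj B q) (s *\<^sub>R (u - proj B u))
           + w (s *\<^sub>R (q - proj B q)) b (u - proj B u))"
proof -
  note lin = linear_has_derivative[of _ "at q"]
  have linQ: "linear (\<lambda>p. p - proj B p)"
    by (intro linear_compose_sub linear_ident linear_proj)
  have 1: "((\<lambda>p. w (shrink B s p) b (proj B p)) has_derivative (\<lambda>u.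
      Dw (shrink B s q) b (proj B q) (shrink B s u) + w (shrink B s q) b (proj B u))) (at q)"
    by (rule has_derivative_linear_family[where M = "\<lambda>q. w q b", OF open_ball linear_w smooth_w
          lin[OF linear_shrink] shrink_in[OF s q] lin[OF linear_proj]])
  have 2: "((\<lambda>p. w (s *\<^sub>R (p - proj B p)) b (p - proj B p)) has_derivative (\<lambda>u.
      Dw (s *\<^sub>R (q - proj B q)) b (q - proj B q) (s *\<^sub>R (u - proj B u))
           + w (s *\<^sub>R (q - proj B q)) b (u - proj B u))) (at q)"
    by (rule has_derivative_linear_family[where M = "\<lambda>q. w q b", OF open_ball linear_w smooth_w
          lin[OF linear_compose_scale_right[OF linQ]] scale_in[OF s q] lin[OF linQ]])
  have d1: "((\<lambda>p. homotopy_integrand b (s, p)) has_derivative (\<lambda>u.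
    Dw (shrink B s q) b (proj B q) (shrink B s u) + w (shrink B s q) b (proj B u)
    + s * (Dw (s *\<^sub>R (q - proj B q)) b (q - proj B q) (s *\<^sub>R (u - proj B u))
           + w (s *\<^sub>R (q - proj B q)) b (u - proj B u)))) (at q)"
    unfolding homotopy_integrand_def fst_conv snd_conv by (intro has_derivative_add has_derivative_mult_right 1 2)
  have d2: "((\<lambda>p. homotopy_integrand b (s, p)) has_derivative (\<lambda>u. fderiv (homotopy_integrand b) (s, q) (0, u))) (at q)"
  proof (rule has_derivative_compose[where f = "\<lambda>p. (s, p)" and g = "homotopy_integrand b"])
    show "((\<lambda>p. (s, p)) has_derivative (\<lambda>u. (0, u))) (at q)"
      by (auto intro!: derivative_eq_intros)
    show "(homotopy_integrand b has_derivative fderiv (homotopy_integrand b) (s, q)) (at (s, q))"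
      by (rule smooth_on_has_derivative[OF smooth_homotopy_integrand]) (use ray_domain(2) s q in auto)
  qed
  show ?thesis
    using fun_cong[OF fderiv_eq[OF d1], of u] fun_cong[OF fderiv_eq[OF d2], of u] by simp
qed

lemma smooth_darboux_coord: "smooth_on (darboux_coord b) (ball 0 R)"
  unfolding darboux_coord_def[abs_def] by (rule smooth_on_parametric_integral(1)[OF ray_domain smooth_homotopy_integrand])

lemma fderiv_darboux_coord:
  "q \<in> ball 0 R \<Longrightarrow> fderiv (darboux_coord b) q u = integral {0..1} (\<lambda>s. fderiv (homotopy_integrand b) (s, q) (0, u))"
  using fun_cong[OF fderiv_eq[OF smooth_on_parametric_integral(2)[OF ray_domain smooth_homotopy_integrand[of b]]], of q u]
  unfolding darboux_coord_def[abs_def] by simp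

lemma integrable_fderiv_homotopy_integrand:
  assumes "q \<in> ball 0 R"
  shows "(\<lambda>s. fderiv (homotopy_integrand b) (s, q) v) integrable_on {0..1}"
proof (rule integrable_continuous_real)
  have "(\<lambda>s. (s, q)) ` {0..1} \<subseteq> ray_domain" using ray_domain(2) assms by auto
  then show "continuous_on {0..1} (\<lambda>s. fderiv (homotopy_integrand b) (s, q) v)"
    by (rule continuous_on_compose2[OF smooth_on_imp_continuous_on[OF smooth_on_fderiv[OF smooth_homotopy_integrand]], rotated])
      (intro continuous_intros)
qed

lemma Dw_antisym: "q \<in> ball 0 R \<Longrightarrow> Dw q u v t = - Dw q v u t"
proof -
  assume q: "q \<in> ball 0 R"
  have "((\<lambda>q. - w q v u) has_derivative (\<lambda>t. - Dw q v u t)) (at q)"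
    by (intro has_derivative_minus smooth_on_has_derivative[OF smooth_w q])
  then have "((\<lambda>q. w q u v) has_derivative (\<lambda>t. - Dw q v u t)) (at q)"
    by (rule has_derivative_transform_within_open[OF _ open_ball q]) (simp add: antisym_w[of _ u v])
  then show ?thesis by (simp add: fderiv_eq)
qed

lemma Dw_isotropic: "q \<in> ball 0 R \<Longrightarrow> Dw q (proj B u) (proj B v) t = 0"
proof -
  assume q: "q \<in> ball 0 R"
  have "((\<lambda>q. 0) has_derivative (\<lambda>t. 0::real)) (at q)" by simp
  then have "((\<lambda>q. w q (proj B u) (proj B v)) has_derivative (\<lambda>t. 0)) (at q)"
    by (rule has_derivative_transform_within_open[OF _ open_ball q]) (simp add: isotropic_w)
  then show ?thesis by (simp add: fderiv_eq)
qed

lemma Dw_scale: "q \<in> ball 0 R \<Longrightarrow> Dw q u v (r *\<^sub>R t) = r * Dw q u v t"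
  using linear_scale[OF linear_fderiv_smooth_on[OF smooth_w]] by simp

lemma Dw_line:
  assumes "c + s *\<^sub>R d \<in> ball 0 R"
  shows "((\<lambda>s. w (c + s *\<^sub>R d) a b) has_real_derivative Dw (c + s *\<^sub>R d) a b d) (at s)"
proof -
  have "((\<lambda>s. c + s *\<^sub>R d) has_derivative (\<lambda>t. t *\<^sub>R d)) (at s)"
    by (auto intro!: derivative_eq_intros)
  from has_derivative_compose[where g = "\<lambda>q. w q a b", OF this smooth_on_has_derivative[OF smooth_w assms]]
  show ?thesis
    unfolding has_field_derivative_def
    by (rule has_derivative_eq_rhs) (simp add: fun_eq_iff Dw_scale[OF assms] mult.commute)
qed

lemma shrink_line: "shrink B s q = (q - proj B q) + s *\<^sub>R proj B q"
  by (simp add: shrink_def algebra_simps)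

text \<open>By closedness the antisymmetrised derivative of the homotopy integrand is the derivative with
  respect to \<open>s\<close> of the coefficient \<open>w a c\<close> along the ray of \<open>q\<close>, plus that of \<open>s\<^sup>2 w a c\<close> along
  the radius of the transversal. The value of the former at the foot of the ray cancels
  against that of the latter at the end of the radius, which is the same point.\<close>

lemma form_on_horizontal_pair:
  assumes q: "q \<in> ball 0 R" and a: "a \<in> Basis - B" and c: "c \<in> Basis - B"
  shows "w q a c = fderiv (darboux_coord a) q c - fderiv (darboux_coord c) q a"
proof -
  have P: "proj B a = 0" "proj B c = 0" using proj_Basis[OF B] a c by auto
  have S: "shrink B s a = a" "shrink B s c = c" for s by (simp_all add: shrink_def P)
  let ?x = "q - proj B q" and ?z = "proj B q"
  have "fderiv (darboux_coord a) q c - fderiv (darboux_coord c) q a =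
    integral {0..1} (\<lambda>s. fderiv (homotopy_integrand a) (s, q) (0, c) - fderiv (homotopy_integrand c) (s, q) (0, a))"
    unfolding fderiv_darboux_coord[OF q] by (rule integral_diff[symmetric]) (intro integrable_fderiv_homotopy_integrand q)+
  also have "\<dots> = integral {0..1} (\<lambda>s. Dw (?x + s *\<^sub>R ?z) a c ?z
      + (s\<^sup>2 * Dw (0 + s *\<^sub>R ?x) a c ?x + 2 * s * w (0 + s *\<^sub>R ?x) a c))"
  proof (rule integral_cong)
    fix s :: real assume s: "s \<in> {0..1}"
    note s1 = shrink_in[OF s q] and s2 = scale_in[OF s q]
    have w0: "w (shrink B s q) a 0 = 0" "w (shrink B s q) c 0 = 0"
      using linear_0[OF linear_w[OF s1]] by auto
    have 1: "Dw (shrink B s q) a ?z c - Dw (shrink B s q) c ?z a = Dw (shrink B s q) a c ?z"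
      using closed_w[OF s1, of a ?z c] Dw_antisym[OF s1, of c a] by simp
    have 2: "Dw (s *\<^sub>R ?x) a ?x c - Dw (s *\<^sub>R ?x) c ?x a = Dw (s *\<^sub>R ?x) a c ?x"
      using closed_w[OF s2, of a ?x c] Dw_antisym[OF s2, of c a] by simp
    have "fderiv (homotopy_integrand a) (s, q) (0, c) - fderiv (homotopy_integrand c) (s, q) (0, a)
      = (Dw (shrink B s q) a ?z c - Dw (shrink B s q) c ?z a)
        + s\<^sup>2 * (Dw (s *\<^sub>R ?x) a ?x c - Dw (s *\<^sub>R ?x) c ?x a) + 2 * s * w (s *\<^sub>R ?x) a c"
      unfolding fderiv_homotopy_integrand[OF s q]
      unfolding P S diff_0_right Dw_scale[OF s2] w0 antisym_w[OF s2, of c a] power2_eq_square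
      by (simp add: algebra_simps)
    then show "fderiv (homotopy_integrand a) (s, q) (0, c) - fderiv (homotopy_integrand c) (s, q) (0, a)
      = Dw (?x + s *\<^sub>R ?z) a c ?z
      + (s\<^sup>2 * Dw (0 + s *\<^sub>R ?x) a c ?x + 2 * s * w (0 + s *\<^sub>R ?x) a c)"
      unfolding 1 2 by (simp add: shrink_line)
  qed
  also have "\<dots> = (w (?x + 1 *\<^sub>R ?z) a c + 1\<^sup>2 * w (0 + 1 *\<^sub>R ?x) a c)
     - (w (?x + 0 *\<^sub>R ?z) a c + 0\<^sup>2 * w (0 + 0 *\<^sub>R ?x) a c)"
  proof (rule integral_unique, rule fundamental_theorem_of_calculus)
    fix s :: real assume s: "s \<in> {0..1}"
    have s1: "?x + s *\<^sub>R ?z \<in> ball 0 R" using shrink_in[OF s q] by (simp only: shrink_line)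
    have s2: "0 + s *\<^sub>R ?x \<in> ball 0 R" using scale_in[OF s q] by simp
    have "((\<lambda>s. w (?x + s *\<^sub>R ?z) a c + s\<^sup>2 * w (0 + s *\<^sub>R ?x) a c) has_real_derivative
      Dw (?x + s *\<^sub>R ?z) a c ?z + (2 * s * w (0 + s *\<^sub>R ?x) a c + Dw (0 + s *\<^sub>R ?x) a c ?x * s\<^sup>2)) (at s)"
      by (intro DERIV_add DERIV_mult Dw_line s1 s2) (auto intro!: derivative_eq_intros)
    then show "((\<lambda>s. w (?x + s *\<^sub>R ?z) a c + s\<^sup>2 * w (0 + s *\<^sub>R ?x) a c) has_vector_derivative
      Dw (?x + s *\<^sub>R ?z) a c ?z + (s\<^sup>2 * Dw (0 + s *\<^sub>R ?x) a c ?x + 2 * s * w (0 + s *\<^sub>R ?x) a c))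
      (at s within {0..1})"
      by - (rule has_vector_derivative_at_within, simp add: has_real_derivative_iff_has_vector_derivative algebra_simps)
  qed simp
  also have "\<dots> = w q a c" by simp
  finally show ?thesis ..
qed

text \<open>Here closedness and isotropy turn the derivative of the homotopy integrand into the derivative of
  \<open>s w a c\<close> along the ray of \<open>q\<close>.\<close>

lemma form_on_mixed_pair:
  assumes q: "q \<in> ball 0 R" and a: "a \<in> Basis - B" and c: "c \<in> B"
  shows "w q a c = fderiv (darboux_coord a) q c"
proof -
  have P: "proj B a = 0" "proj B c = c" using proj_Basis[OF B] a c B by auto
  have S: "shrink B s c = s *\<^sub>R c" for s by (simp add: shrink_def P algebra_simps)
  let ?x = "q - proj B q" and ?z = "proj B q"
  have "fderiv (darboux_coord a) q c = integral {0..1} (\<lambda>s. fderiv (homotopy_integrand a) (s, q) (0, c))"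
    by (rule fderiv_darboux_coord[OF q])
  also have "\<dots> = integral {0..1} (\<lambda>s. s * Dw (?x + s *\<^sub>R ?z) a c ?z + w (?x + s *\<^sub>R ?z) a c)"
  proof (rule integral_cong)
    fix s :: real assume s: "s \<in> {0..1}"
    note s1 = shrink_in[OF s q] and s2 = scale_in[OF s q]
    have w0: "w (s *\<^sub>R ?x) a 0 = 0" using linear_0[OF linear_w[OF s2]] by auto
    have D0: "Dw (s *\<^sub>R ?x) a ?x 0 = 0"
      using linear_0[OF linear_fderiv_smooth_on[OF smooth_w s2]] by auto
    have "Dw (shrink B s q) c ?z a = 0" using Dw_isotropic[OF s1, of c q a] by (simp add: P)
    then have 1: "Dw (shrink B s q) a ?z c = Dw (shrink B s q) a c ?z"
      using closed_w[OF s1, of a ?z c] Dw_antisym[OF s1, of c a ?z] by simp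
    show "fderiv (homotopy_integrand a) (s, q) (0, c) = s * Dw (?x + s *\<^sub>R ?z) a c ?z + w (?x + s *\<^sub>R ?z) a c"
      unfolding fderiv_homotopy_integrand[OF s q] by (simp add: P S w0 D0 Dw_scale[OF s1] 1 flip: shrink_line)
  qed
  also have "\<dots> = 1 * w (?x + 1 *\<^sub>R ?z) a c - 0 * w (?x + 0 *\<^sub>R ?z) a c"
  proof (rule integral_unique, rule fundamental_theorem_of_calculus)
    fix s :: real assume s: "s \<in> {0..1}"
    have s1: "?x + s *\<^sub>R ?z \<in> ball 0 R" using shrink_in[OF s q] by (simp only: shrink_line)
    have "((\<lambda>s. s * w (?x + s *\<^sub>R ?z) a c) has_real_derivative
      1 * w (?x + s *\<^sub>R ?z) a c + Dw (?x + s *\<^sub>R ?z) a c ?z * s) (at s)"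
      by (intro DERIV_mult DERIV_ident Dw_line s1)
    then show "((\<lambda>s. s * w (?x + s *\<^sub>R ?z) a c) has_vector_derivative
      s * Dw (?x + s *\<^sub>R ?z) a c ?z + w (?x + s *\<^sub>R ?z) a c) (at s within {0..1})"
      by - (rule has_vector_derivative_at_within, simp add: has_real_derivative_iff_has_vector_derivative algebra_simps)
  qed simp
  also have "\<dots> = w q a c" by simp
  finally show ?thesis ..
qed

text \<open>With the linear coordinates \<open>x\<^sub>b\<close> and \<open>y\<^sub>b = darboux_coord b\<close> this reads
  \<open>w = \<Sum>\<^sub>b dx\<^sub>b \<and> dy\<^sub>b\<close>. Both sides are bilinear and antisymmetric, so pairs of basis vectors
  suffice.\<close>

theorem form_in_coordinates:
  assumes q: "q \<in> ball 0 R"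
  shows "w q u v = (\<Sum>b\<in>Basis - B. (u \<bullet> b) * fderiv (darboux_coord b) q v - (v \<bullet> b) * fderiv (darboux_coord b) q u)"
proof -
  define \<rho> where "\<rho> = (\<lambda>u v. \<Sum>b\<in>Basis - B. (u \<bullet> b) * fderiv (darboux_coord b) q v - (v \<bullet> b) * fderiv (darboux_coord b) q u)"
  have liny: "linear (fderiv (darboux_coord b) q)" for b by (rule linear_fderiv_smooth_on[OF smooth_darboux_coord q])
  have lin2: "linear (\<rho> u)" for u
    unfolding \<rho>_def
    by (intro linear_compose_sum ballI linearI)
      (simp_all add: linear_add[OF liny] linear_scale[OF liny] inner_add_left algebra_simps)
  have anti: "\<rho> u v = - \<rho> v u" for u v
    unfolding \<rho>_def by (simp flip: sum_negf)
  have fin: "finite (Basis - B)" by simp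
  have single: "(\<Sum>b\<in>Basis - B. (a \<bullet> b) * g b) = (if a \<in> B then 0 else g a)" if "a \<in> Basis" for a and g :: "'e \<Rightarrow> real"
  proof -
    have "(\<Sum>b\<in>Basis - B. (a \<bullet> b) * g b) = (\<Sum>b\<in>Basis - B. if b = a then g a else 0)"
      by (rule sum.cong) (use that in \<open>auto simp: inner_Basis\<close>)
    then show ?thesis using that by simp
  qed
  have basis: "w q a c = \<rho> a c" if a: "a \<in> Basis" and c: "c \<in> Basis" for a c
  proof (cases "a \<in> B")
    case True
    note aB = True
    show ?thesis
    proof (cases "c \<in> B")
      case True
      then have "w q a c = 0"
        using isotropic_w[OF q, of a c] proj_Basis[OF B a] proj_Basis[OF B c] aB by simp
      then show ?thesis using True aB by (simp add: \<rho>_def sum_subtractf single a c)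
    next
      case False
      then have "w q c a = fderiv (darboux_coord c) q a" using form_on_mixed_pair[OF q _ aB, of c] c by simp
      then show ?thesis
        using False aB antisym_w[OF q, of a c] by (simp add: \<rho>_def sum_subtractf single a c)
    qed
  next
    case False
    note aB = False
    show ?thesis
    proof (cases "c \<in> B")
      case True
      then show ?thesis
        using form_on_mixed_pair[OF q _ True, of a] a aB by (simp add: \<rho>_def sum_subtractf single c)
    next
      case False
      then show ?thesis
        using form_on_horizontal_pair[OF q, of a c] a c aB by (simp add: \<rho>_def sum_subtractf single)
    qed
  qed
  have half: "w q a v = \<rho> a v" if "a \<in> Basis" for a v
    unfolding linear_Basis_expansion[OF linear_w[OF q], of a v] linear_Basis_expansion[OF lin2, of a v]
    using basis[OF that] by simp
  have "w q v u = \<rho> v u"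
    unfolding linear_Basis_expansion[OF linear_w[OF q], of v u] linear_Basis_expansion[OF lin2, of v u]
    using half antisym_w[OF q, of v] anti[of v] by simp
  then show ?thesis
    using antisym_w[OF q, of u v] anti[of u v] by (simp add: \<rho>_def)
qed

end

section \<open>Charts and tangent vectors\<close>

lemma span_Basis_iff:
  assumes "B \<subseteq> Basis"
  shows "v \<in> span B \<longleftrightarrow> proj B v = v"
proof
  assume "v \<in> span B"
  moreover have "subspace {v. proj B v = v}"
    by (auto simp: subspace_def linear_add[OF linear_proj] linear_scale[OF linear_proj] linear_0[OF linear_proj])
  moreover have "B \<subseteq> {v. proj B v = v}" using proj_Basis[OF assms] assms by auto
  ultimately show "proj B v = v" using span_minimal by blast
next
  assume "proj B v = v"
  moreover have "proj B v \<in> span B"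
    unfolding proj_def by (intro span_sum span_scale span_base)
  ultimately show "v \<in> span B" by simp
qed

lemma proj_Compl: 
  assumes "B \<subseteq> Basis"
  shows "proj (Basis - B) v = v - proj B v"
  by (rule euclidean_eqI) (use assms in \<open>auto simp: proj_inner inner_diff_left\<close>)

lemma span_Compl_Basis_iff:
  assumes "B \<subseteq> Basis"
  shows "v \<in> span (Basis - B) \<longleftrightarrow> proj B v = 0"
  using span_Basis_iff[of "Basis - B" v] proj_Compl[OF assms, of v] by auto

lemma homeomorphism_imp_homeomorphic_map:
  "homeomorphism S T f g \<Longrightarrow> homeomorphic_map (top_of_set S) (top_of_set T) f"
  unfolding homeomorphic_map_maps homeomorphic_maps_def homeomorphism_def
  by (intro exI[of _ g]) auto

context smooth_manifold
begin

lemma chart_openin: "c \<in> A \<Longrightarrow> openin X (fst c)"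
  using charts by (auto simp: is_chart_def)

lemma chart_open_image: "c \<in> A \<Longrightarrow> open (snd c ` fst c)"
  using charts by (auto simp: is_chart_def)

lemma chart_topspace: "c \<in> A \<Longrightarrow> topspace (subtopology X (fst c)) = fst c"
  using openin_subset[OF chart_openin[of c]] by (auto simp: topspace_subtopology)

lemma chart_homeomorphic:
  "c \<in> A \<Longrightarrow> homeomorphic_map (subtopology X (fst c)) (top_of_set (snd c ` fst c)) (snd c)"
  using charts by (auto simp: is_chart_def)

lemma chart_inj: "c \<in> A \<Longrightarrow> inj_on (snd c) (fst c)"
  using homeomorphic_imp_injective_map[OF chart_homeomorphic] chart_topspace by metis

lemma chart_inv_chart [simp]: "c \<in> A \<Longrightarrow> p \<in> fst c \<Longrightarrow> chart_inv c (snd c p) = p"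
  using chart_inj by (simp add: chart_inv_def)

lemma chart_image_open:
  assumes "c \<in> A" "openin X S" "S \<subseteq> fst c"
  shows "open (snd c ` S)"
proof -
  have "openin (subtopology X (fst c)) S"
    using assms by (simp add: openin_subset_topspace_eq openin_open_subtopology[OF chart_openin])
  then have "openin (top_of_set (snd c ` fst c)) (snd c ` S)"
    using homeomorphic_imp_open_map[OF chart_homeomorphic[OF assms(1)]] by (simp add: open_map_def)
  then show ?thesis using openin_open_eq[OF chart_open_image[OF assms(1)]] by blast
qed

lemma chart_image_Int_open: "c \<in> A \<Longrightarrow> d \<in> A \<Longrightarrow> open (snd c ` (fst c \<inter> fst d))"
  by (intro chart_image_open openin_Int chart_openin) auto

lemma chart_preimage_open:
  assumes "c \<in> A" "open O'"
  shows "openin X {p \<in> fst c. snd c p \<in> O'}"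
proof -
  have "openin (top_of_set (snd c ` fst c)) (snd c ` fst c \<inter> O')" using assms(2) by auto
  moreover have "continuous_map (subtopology X (fst c)) (top_of_set (snd c ` fst c)) (snd c)"
    by (rule homeomorphic_imp_continuous_map[OF chart_homeomorphic[OF assms(1)]])
  ultimately have "openin (subtopology X (fst c))
    {p \<in> topspace (subtopology X (fst c)). snd c p \<in> snd c ` fst c \<inter> O'}"
    by (rule openin_continuous_map_preimage[rotated])
  moreover have "{p \<in> topspace (subtopology X (fst c)). snd c p \<in> snd c ` fst c \<inter> O'} = {p \<in> fst c. snd c p \<in> O'}"
    unfolding chart_topspace[OF assms(1)] by auto
  ultimately have "openin (subtopology X (fst c)) {p \<in> fst c. snd c p \<in> O'}"
    by (simp only:)
  then show ?thesis
    using openin_open_subtopology[OF chart_openin[OF assms(1)]] by blast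
qed

lemma transition_apply [simp]: "c \<in> A \<Longrightarrow> p \<in> fst c \<Longrightarrow> transition c d (snd c p) = snd d p"
  by (simp add: transition_def)

lemma smooth_transition: "c \<in> A \<Longrightarrow> d \<in> A \<Longrightarrow> smooth_on (transition c d) (snd c ` (fst c \<inter> fst d))"
  using compatible by (auto simp: smoothly_compatible_def)

lemma transition_has_derivative:
  assumes "c \<in> A" "d \<in> A" "p \<in> fst c" "p \<in> fst d"
  shows "(transition c d has_derivative fderiv (transition c d) (snd c p)) (at (snd c p))"
  by (rule smooth_on_has_derivative[OF smooth_transition]) (use assms in auto)

lemma linear_transition_deriv:
  assumes "c \<in> A" "d \<in> A" "p \<in> fst c" "p \<in> fst d"
  shows "linear (fderiv (transition c d) (snd c p))"
  using transition_has_derivative[OF assms] has_derivative_linear by blast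

lemma transition_deriv_compose:
  assumes A: "c \<in> A" "d \<in> A" "e \<in> A" and p: "p \<in> fst c" "p \<in> fst d" "p \<in> fst e"
  shows "fderiv (transition d e) (snd d p) (fderiv (transition c d) (snd c p) v)
    = fderiv (transition c e) (snd c p) v"
proof -
  let ?S = "snd c ` (fst c \<inter> fst d \<inter> fst e)"
  have S: "open ?S" by (intro chart_image_open openin_Int chart_openin A) auto
  have "(transition d e has_derivative fderiv (transition d e) (snd d p)) (at (transition c d (snd c p)))"
    using transition_has_derivative[OF A(2,3) p(2,3)] A p by simp
  from has_derivative_compose[OF transition_has_derivative[OF A(1,2) p(1,2)] this]
  have "(transition c e has_derivative
    (\<lambda>v. fderiv (transition d e) (snd d p) (fderiv (transition c d) (snd c p) v))) (at (snd c p))"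
    by (rule has_derivative_transform_within_open[OF _ S]) (use A p in auto)
  then show ?thesis by (simp add: fderiv_eq)
qed

lemma transition_deriv_self:
  assumes "c \<in> A" "p \<in> fst c"
  shows "fderiv (transition c c) (snd c p) v = v"
proof -
  have "((\<lambda>x. x) has_derivative (\<lambda>v. v)) (at (snd c p))" by simp
  then have "(transition c c has_derivative (\<lambda>v. v)) (at (snd c p))"
    by (rule has_derivative_transform_within_open[OF _ chart_open_image[OF assms(1)]]) (use assms in \<open>auto simp del: split_paired_All\<close>)
  then show ?thesis by (simp add: fderiv_eq)
qed

lemma tangent_deriv:
  assumes "v \<in> tangent_space A p" "c \<in> A" "d \<in> A" "p \<in> fst c" "p \<in> fst d"
  shows "v d = fderiv (transition c d) (snd c p) (v c)"
  using assms unfolding tangent_space_def by blast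

lemma coord_vec_in_tangent: 
  assumes "c \<in> A" "p \<in> fst c"
  shows "coord_vec A c p u \<in> tangent_space A p"
  using assms by (auto simp: tangent_space_def coord_vec_def transition_deriv_compose)

lemma coord_vec_self [simp]: "c \<in> A \<Longrightarrow> p \<in> fst c \<Longrightarrow> coord_vec A c p u c = u"
  by (simp add: coord_vec_def transition_deriv_self)

lemma coord_vec_tangent:
  assumes "c \<in> A" "p \<in> fst c" "v \<in> tangent_space A p"
  shows "coord_vec A c p (v c) = v"
proof
  fix d
  show "coord_vec A c p (v c) d = v d"
  proof (cases "d \<in> A \<and> p \<in> fst d")
    case True
    then show ?thesis using tangent_deriv[OF assms(3,1) _ assms(2), of d] by (simp add: coord_vec_def)
  next
    case False
    then have "v d = 0" using assms(3) unfolding tangent_space_def by blast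
    then show ?thesis using False by (simp only: coord_vec_def if_False)
  qed
qed

lemma tangent_eqI:
  assumes "c \<in> A" "p \<in> fst c" "v \<in> tangent_space A p" "w \<in> tangent_space A p" "v c = w c"
  shows "v = w"
  using coord_vec_tangent[OF assms(1,2,3)] coord_vec_tangent[OF assms(1,2,4)] assms(5) by metis

lemma linear_coord_vec:
  assumes "c \<in> A" "p \<in> fst c"
  shows "linear (coord_vec A c p)"
proof (rule linearI)
  fix u v :: 'e and r :: real
  have lin: "linear (fderiv (transition c d) (snd c p))" if "d \<in> A \<and> p \<in> fst d" for d
    using linear_transition_deriv[of c d p] assms that by blast
  show "coord_vec A c p (u + v) = coord_vec A c p u + coord_vec A c p v"
    by (rule ext) (simp add: coord_vec_def linear_add[OF lin])
  show "coord_vec A c p (r *\<^sub>R u) = r *\<^sub>R coord_vec A c p u"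
    by (rule ext) (simp add: coord_vec_def linear_scale[OF lin])
qed

lemma subspace_tangent_space: "subspace (tangent_space A p)"
proof -
  have off: "v c = 0" if "v \<in> tangent_space A p" "\<not> (c \<in> A \<and> p \<in> fst c)" for v c
    using that unfolding tangent_space_def by blast
  have I: "v \<in> tangent_space A p"
    if "\<And>c. \<not> (c \<in> A \<and> p \<in> fst c) \<Longrightarrow> v c = 0"
      "\<And>c d. c \<in> A \<Longrightarrow> d \<in> A \<Longrightarrow> p \<in> fst c \<Longrightarrow> p \<in> fst d \<Longrightarrow>
        v d = fderiv (transition c d) (snd c p) (v c)" for v
    using that unfolding tangent_space_def by blast
  show ?thesis
    unfolding subspace_def
  proof (intro conjI ballI allI)
    show "0 \<in> tangent_space A p"
      by (rule I) (simp_all add: linear_0[OF linear_transition_deriv])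
    fix x assume x: "x \<in> tangent_space A p"
    show "r *\<^sub>R x \<in> tangent_space A p" for r
    proof (rule I)
      fix c d assume cd: "c \<in> A" "d \<in> A" "p \<in> fst c" "p \<in> fst d"
      show "(r *\<^sub>R x) d = fderiv (transition c d) (snd c p) ((r *\<^sub>R x) c)"
        by (simp only: scaleR_fun_apply linear_scale[OF linear_transition_deriv[OF cd]] tangent_deriv[OF x cd])
    qed (simp add: off[OF x])
    fix y assume y: "y \<in> tangent_space A p"
    show "x + y \<in> tangent_space A p"
    proof (rule I)
      fix c d assume cd: "c \<in> A" "d \<in> A" "p \<in> fst c" "p \<in> fst d"
      show "(x + y) d = fderiv (transition c d) (snd c p) ((x + y) c)"
        by (simp only: plus_fun_apply linear_add[OF linear_transition_deriv[OF cd]]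
            tangent_deriv[OF x cd] tangent_deriv[OF y cd])
    qed (simp add: off[OF x] off[OF y])
  qed
qed

text \<open>The tangent spaces of the slices of \<open>c\<close> in which the coordinates belonging to \<open>B\<close> vary.\<close>

definition chart_distribution :: "('a, 'e) chart \<Rightarrow> 'e set \<Rightarrow> 'a \<Rightarrow> ('a, 'e) tvec set" where
  "chart_distribution c B q = {v \<in> tangent_space A q. v c \<in> span B}"

lemma chart_distribution_eq_image:
  assumes "c \<in> A" "q \<in> fst c"
  shows "chart_distribution c B q = coord_vec A c q ` span B"
proof (intro equalityI subsetI)
  fix v assume "v \<in> chart_distribution c B q"
  then have "v = coord_vec A c q (v c)" "v c \<in> span B"
    using coord_vec_tangent[OF assms] by (auto simp: chart_distribution_def)
  then show "v \<in> coord_vec A c q ` span B" by blast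
qed (use assms in \<open>auto simp: chart_distribution_def coord_vec_in_tangent\<close>)

lemma smooth_coord_vec:
  assumes "c \<in> A"
  shows "smooth_vector_field A (fst c) (\<lambda>q. coord_vec A c q b)"
  unfolding smooth_vector_field_def
proof (intro conjI ballI)
  fix d assume d: "d \<in> A"
  let ?S = "snd d ` (fst d \<inter> fst c)"
  have S: "open ?S" by (rule chart_image_Int_open[OF d assms])
  have S': "open (snd c ` (fst c \<inter> fst d))" by (rule chart_image_Int_open[OF assms d])
  have "smooth_on (\<lambda>x. fderiv (transition c d) (transition d c x) b) ?S"
    by (rule smooth_on_compose[where g = "\<lambda>y. fderiv (transition c d) y b", OF S S' _
          smooth_transition[OF d assms] smooth_on_fderiv[OF smooth_transition[OF assms d]]])
      (use d in auto)
  then show "smooth_on (\<lambda>x. coord_vec A c (chart_inv d x) b d) ?S"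
    by (rule smooth_on_cong[OF S, rotated]) (use d in \<open>auto simp: coord_vec_def\<close>)
qed (use assms in \<open>auto simp: coord_vec_in_tangent\<close>)

text \<open>The coordinate vector fields are a frame, and the slices of the chart are integral manifolds.\<close>

lemma integrable_chart_distribution:
  assumes c: "c \<in> A" and B: "B \<subseteq> Basis"
  shows "integrable_distribution X A (fst c) (card B) (chart_distribution c B)"
  unfolding integrable_distribution_def distribution_def
proof (intro conjI ballI)
  fix p assume p: "p \<in> fst c"
  note img = chart_distribution_eq_image[OF c p] and lin = linear_coord_vec[OF c p]
  show "subspace (chart_distribution c B p)"
    unfolding img by (rule linear_subspace_image[OF lin subspace_span])
  show "chart_distribution c B p \<subseteq> tangent_space A p" by (auto simp: chart_distribution_def)
  have inj: "inj (coord_vec A c p)"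
    by (rule inj_on_inverseI[where g = "\<lambda>v. v c"]) (use c p in simp)
  have ind: "independent B" by (rule independent_mono[OF independent_Basis B])
  have "independent (coord_vec A c p ` B)"
    by (rule linear_independent_injective_image[OF lin ind]) (rule inj_on_subset[OF inj], simp)
  then have "dim (span (coord_vec A c p ` B)) = card (coord_vec A c p ` B)"
    by (simp add: dim_span dim_eq_card_independent)
  also have "\<dots> = card B" by (rule card_image) (rule inj_on_subset[OF inj], simp)
  finally show "dim (chart_distribution c B p) = card B"
    unfolding img using linear_span_image[OF lin, of B] by simp
next
  fix p assume p: "p \<in> fst c"
  have "finite B" using B finite_Basis finite_subset by blast
  then obtain e where e: "bij_betw e {..<card B} B"
    using ex_bij_betw_nat_finite[of B] by (auto simp: atLeast0LessThan)
  show "\<exists>W Y. openin X W \<and> p \<in> W \<and> W \<subseteq> fst c \<and>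
      (\<forall>i<card B. smooth_vector_field A W (Y i)) \<and>
      (\<forall>q\<in>W. chart_distribution c B q = span ((\<lambda>i. Y i q) ` {..<card B}))"
  proof (intro exI[of _ "fst c"] exI[of _ "\<lambda>i q. coord_vec A c q (e i)"] conjI allI impI ballI)
    fix q assume q: "q \<in> fst c"
    have "(\<lambda>i. coord_vec A c q (e i)) ` {..<card B} = coord_vec A c q ` B"
      using bij_betw_imp_surj_on[OF e] by (auto simp: image_image[symmetric])
    then show "chart_distribution c B q = span ((\<lambda>i. coord_vec A c q (e i)) ` {..<card B})"
      unfolding chart_distribution_eq_image[OF c q] using linear_span_image[OF linear_coord_vec[OF c q], of B] by simp
  qed (use p c smooth_coord_vec chart_openin in auto)
next
  fix p assume p: "p \<in> fst c"
  let ?N = "{q \<in> fst c. \<forall>b\<in>Basis - B. snd c q \<bullet> b = snd c p \<bullet> b}"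
  show "\<exists>N. p \<in> N \<and> N \<subseteq> fst c \<and> integral_manifold A (card B) (chart_distribution c B) N"
  proof (intro exI[of _ ?N] conjI)
    show "integral_manifold A (card B) (chart_distribution c B) ?N"
      unfolding integral_manifold_def
    proof
      fix q assume q: "q \<in> ?N"
      have "slice_chart A (card B) ?N q c B"
        unfolding slice_chart_def using c q B by auto
      then show "\<exists>c' B'. slice_chart A (card B) ?N q c' B' \<and>
          chart_distribution c B q = {v \<in> tangent_space A q. v c' \<in> span B'}"
        unfolding chart_distribution_def by (intro exI[of _ c] exI[of _ B] conjI refl)
    qed
  qed (use p in auto)
qed

text \<open>A local diffeomorphism of the coordinate space takes charts of a maximal atlas to charts of the
  atlas. This is how every special coordinate system below is obtained, and why forms and
  distributions need no pullback: their coordinate expressions are available in all charts.\<close>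

lemma change_of_chart:
  assumes c: "c \<in> A" and S: "open S" "S \<subseteq> snd c ` fst c" and T: "open T"
    and hom: "homeomorphism S T \<Psi> g" and smooth: "smooth_on \<Psi> S" "smooth_on g T"
  defines "c' \<equiv> ({q \<in> fst c. snd c q \<in> S}, \<lambda>q. \<Psi> (snd c q))"
  shows "c' \<in> A" "snd c' ` fst c' = T"
    "\<And>q. q \<in> fst c' \<Longrightarrow> fderiv (transition c c') (snd c q) = fderiv \<Psi> (snd c q)"
    "\<And>q. q \<in> fst c' \<Longrightarrow> fderiv (transition c' c) (snd c' q) = fderiv g (snd c' q)"
proof -
  let ?W = "{q \<in> fst c. snd c q \<in> S}"
  have W: "openin X ?W" by (rule chart_preimage_open[OF c S(1)])
  have sub: "?W \<subseteq> fst c" by auto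
  have imgS: "snd c ` ?W = S" using S(2) by auto
  have imgT: "(\<lambda>q. \<Psi> (snd c q)) ` ?W = T"
    using hom imgS by (auto simp: homeomorphism_def image_image[symmetric])
  then show img: "snd c' ` fst c' = T" by (simp add: c'_def)
  have g\<Psi>: "g (\<Psi> x) = x" if "x \<in> S" for x using hom that by (auto simp: homeomorphism_def)
  have gT: "g y \<in> S" "\<Psi> (g y) = y" if "y \<in> T" for y using hom that by (auto simp: homeomorphism_def)
  have "homeomorphic_map (subtopology (subtopology X (fst c)) ?W)
      (subtopology (top_of_set (snd c ` fst c)) S) (snd c)"
    by (rule homeomorphic_map_subtopologies[OF chart_homeomorphic[OF c]])
      (use chart_topspace[OF c] imgS S(2) in \<open>auto simp: Int_absorb1\<close>)
  moreover have "subtopology (subtopology X (fst c)) ?W = subtopology X ?W"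
    using sub by (simp add: subtopology_subtopology Int_absorb1)
  moreover have "subtopology (top_of_set (snd c ` fst c)) S = top_of_set S"
    using S(2) by (simp add: subtopology_subtopology Int_absorb1)
  ultimately have "homeomorphic_map (subtopology X ?W) (top_of_set S) (snd c)" by simp
  from homeomorphic_map_compose[OF this homeomorphism_imp_homeomorphic_map[OF hom]]
  have hm: "homeomorphic_map (subtopology X ?W) (top_of_set T) (\<lambda>q. \<Psi> (snd c q))"
    by (simp add: o_def)
  have chart: "is_chart X c'"
    unfolding is_chart_def using W T hm imgT by (simp add: c'_def)
  have inj: "inj_on (snd c') (fst c')"
    unfolding c'_def using g\<Psi> chart_inj[OF c] by (auto simp: inj_on_def) (metis g\<Psi>)
  have inv': "chart_inv c' (snd c' q) = q" if "q \<in> fst c'" for q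
    using inj that by (simp add: chart_inv_def)
  have compat: "smoothly_compatible c' d" if d: "d \<in> A" for d
    unfolding smoothly_compatible_def
  proof
    let ?S = "snd c' ` (fst c' \<inter> fst d)" and ?S' = "snd c ` (?W \<inter> fst d)"
    have S': "open ?S'" by (intro chart_image_open openin_Int W chart_openin d c) auto
    have S'S: "?S' \<subseteq> S" by auto
    have eqS: "?S = T \<inter> g -` ?S'"
    proof (intro equalityI subsetI)
      fix y assume "y \<in> T \<inter> g -` ?S'"
      then obtain q where q: "y \<in> T" "g y = snd c q" "q \<in> ?W" "q \<in> fst d" by auto
      then have "y = \<Psi> (snd c q)" using gT(2)[OF q(1)] by simp
      then show "y \<in> ?S" using q by (auto simp: c'_def)
    qed (use g\<Psi> imgT in \<open>auto simp: c'_def\<close>)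
    have "open ?S"
      unfolding eqS using hom by (intro continuous_open_preimage T S') (auto simp: homeomorphism_def)
    have "smooth_on (\<lambda>y. transition c d (g y)) ?S"
    proof (rule smooth_on_compose[where g = "transition c d", OF \<open>open ?S\<close> S'])
      show "g y \<in> ?S'" if "y \<in> ?S" for y using that eqS by auto
      show "smooth_on g ?S" by (rule smooth_on_subset[OF smooth(2)]) (use eqS in auto)
      show "smooth_on (transition c d) ?S'"
        by (rule smooth_on_subset[OF smooth_transition[OF c d]]) auto
    qed
    then show "smooth_on (transition c' d) ?S"
    proof (rule smooth_on_cong[OF \<open>open ?S\<close>, rotated])
      fix y assume "y \<in> ?S"
      then obtain q where q: "y = snd c' q" "q \<in> fst c'" "q \<in> fst d" by auto
      have "g y = snd c q" using q g\<Psi> by (simp add: c'_def)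
      moreover have "q \<in> fst c" using q by (simp add: c'_def)
      ultimately show "transition c d (g y) = transition c' d y"
        using c inv'[OF q(2)] by (simp add: q(1) transition_def)
    qed
    let ?D = "snd d ` (fst c' \<inter> fst d)"
    have D: "open ?D"
      by (rule chart_image_open[OF d]) (use W chart_openin[OF d] in \<open>auto simp: c'_def\<close>)
    have "smooth_on (\<lambda>x. \<Psi> (transition d c x)) ?D"
    proof (rule smooth_on_compose[OF D S(1) _ _ smooth(1)])
      show "transition d c x \<in> S" if "x \<in> ?D" for x using that d by (auto simp: c'_def)
      show "smooth_on (transition d c) ?D"
        by (rule smooth_on_subset[OF smooth_transition[OF d c]]) (auto simp: c'_def)
    qed
    then show "smooth_on (transition d c') ?D"
      by (rule smooth_on_cong[OF D, rotated]) (use d in \<open>auto simp: c'_def transition_def\<close>)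
  qed
  show c': "c' \<in> A" by (rule maximal[OF chart compat])
  show "fderiv (transition c c') (snd c q) = fderiv \<Psi> (snd c q)" if q: "q \<in> fst c'" for q
  proof (rule fderiv_eq, rule has_derivative_transform_within_open[OF _ S(1)])
    show qS: "snd c q \<in> S" using q by (simp add: c'_def)
    show "(\<Psi> has_derivative fderiv \<Psi> (snd c q)) (at (snd c q))"
      by (rule smooth_on_has_derivative[OF smooth(1) qS])
    fix x assume "x \<in> S"
    then show "\<Psi> x = transition c c' x" using S(2) c by (auto simp: transition_def c'_def)
  qed
  show "fderiv (transition c' c) (snd c' q) = fderiv g (snd c' q)" if q: "q \<in> fst c'" for q
  proof (rule fderiv_eq, rule has_derivative_transform_within_open[OF _ T])
    show qT: "snd c' q \<in> T" using q img by auto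
    show "(g has_derivative fderiv g (snd c' q)) (at (snd c' q))"
      by (rule smooth_on_has_derivative[OF smooth(2) qT])
    fix y assume "y \<in> T"
    then obtain q' where "q' \<in> fst c'" "y = snd c' q'" using img by auto
    then show "g y = transition c' c y" using c' g\<Psi> by (simp) (simp add: c'_def)
  qed
qed

end

section \<open>Integrable distributions have foliated charts\<close>

lemma open_inj_family:
  fixes M :: "'a::euclidean_space \<Rightarrow> 'b::euclidean_space \<Rightarrow> 'c::euclidean_space"
  assumes S: "open S" and lin: "\<And>x. x \<in> S \<Longrightarrow> linear (M x)" and cont: "\<And>b. continuous_on S (\<lambda>x. M x b)"
  shows "open {x \<in> S. inj (M x)}"
  unfolding open_subopen[of "{x \<in> S. inj (M x)}"]
proof
  fix x0 assume "x0 \<in> {x \<in> S. inj (M x)}"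
  then have x0: "x0 \<in> S" "inj (M x0)" by auto
  obtain k where k: "k > 0" "\<And>v. k * norm v \<le> norm (M x0 v)"
    using linear_inj_bounded_below_pos[OF lin[OF x0(1)] x0(2)] by blast
  define f where "f = (\<lambda>x. \<Sum>b\<in>Basis. norm (M x b - M x0 b))"
  have "continuous_on S f" unfolding f_def by (intro continuous_intros cont)
  then have "open (S \<inter> f -` {..<k})" by (intro continuous_open_preimage S) auto
  moreover have "x0 \<in> S \<inter> f -` {..<k}" using x0 k by (simp add: f_def)
  moreover have "S \<inter> f -` {..<k} \<subseteq> {x \<in> S. inj (M x)}"
  proof
    fix x assume x: "x \<in> S \<inter> f -` {..<k}"
    then have xS: "x \<in> S" and fx: "f x < k" by auto
    have "v = 0" if v: "M x v = 0" for v
    proof (rule ccontr)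
      assume "v \<noteq> 0"
      have "norm (M x v - M x0 v) \<le> f x * norm v"
        unfolding f_def
        by (rule linear_norm_le_Basis_sum[OF linear_compose_sub[OF lin[OF xS] lin[OF x0(1)]]])
      also have "\<dots> < k * norm v" using fx \<open>v \<noteq> 0\<close> by simp
      also have "\<dots> \<le> norm (M x0 v)" by (rule k)
      finally show False using v by simp
    qed
    then show "x \<in> {x \<in> S. inj (M x)}"
      using xS linear_injective_0[OF lin[OF xS]] by blast
  qed
  ultimately show "\<exists>T. open T \<and> x0 \<in> T \<and> T \<subseteq> {x \<in> S. inj (M x)}" by blast
qed

context smooth_manifold
begin

text \<open>At \<open>p\<close> a local frame of \<open>V\<close> spans \<open>span B\<close>. Completed by the basis vectors outside \<open>B\<close>
  it gives a linear automorphism \<open>M x\<close> for \<open>x\<close> near the image of \<open>p\<close>, which takes \<open>span B\<close> to \<open>V\<close>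
  and fixes the transversal. Conjugating \<open>proj B\<close> by \<open>M x\<close> yields the projection onto \<open>V\<close> along
  the transversal.\<close>

lemma distribution_as_graph:
  assumes c: "c \<in> A" "p \<in> fst c" and B: "B \<subseteq> Basis"
    and V: "distribution X A (topspace X) (card B) V" and Vp: "V p = chart_distribution c B p"
  shows "\<exists>L \<Omega>. open \<Omega> \<and> snd c p \<in> \<Omega> \<and> \<Omega> \<subseteq> snd c ` fst c \<and>
    (\<forall>x\<in>\<Omega>. linear (L x)) \<and> (\<forall>v. smooth_on (\<lambda>x. L x v) \<Omega>) \<and>
    (\<forall>x\<in>\<Omega>. \<forall>v. proj B (L x v) = proj B v \<and> L x (proj B v) = L x v) \<and>
    (\<forall>q\<in>fst c. snd c q \<in> \<Omega> \<longrightarrow> V q = {v \<in> tangent_space A q. L (snd c q) (v c) = v c})"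
proof -
  have "p \<in> topspace X" using openin_subset[OF chart_openin[OF c(1)]] c(2) by blast
  then obtain W Y where W: "openin X W" "p \<in> W"
    and Y: "\<And>i. i < card B \<Longrightarrow> smooth_vector_field A W (Y i)"
    and VY: "\<And>q. q \<in> W \<Longrightarrow> V q = span ((\<lambda>i. Y i q) ` {..<card B})"
    using V unfolding distribution_def by metis
  have WX: "W \<subseteq> topspace X" by (rule openin_subset[OF W(1)])
  have VT: "V q \<subseteq> tangent_space A q" if "q \<in> W" for q
    using V that WX unfolding distribution_def by blast
  define y where "y = (\<lambda>i x. Y i (chart_inv c x) c)"
  define S where "S = snd c ` (fst c \<inter> W)"
  have S: "open S" "snd c p \<in> S"
    unfolding S_def using c W by (auto intro!: chart_image_open openin_Int chart_openin)
  have smooth_y: "smooth_on (y i) S" if "i < card B" for i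
    using Y[OF that] c(1) unfolding smooth_vector_field_def y_def S_def by blast
  have finB: "finite B" using B finite_Basis finite_subset by blast
  obtain e where e: "bij_betw e B {..<card B}"
    using ex_bij_betw_finite_nat[OF finB] by (auto simp: atLeast0LessThan)
  have e_less: "e b < card B" if "b \<in> B" for b using bij_betwE[OF e] that by auto
  define M where "M = (\<lambda>x v. (v - proj B v) + (\<Sum>b\<in>B. (v \<bullet> b) *\<^sub>R y (e b) x))"
  have linM: "linear (M x)" for x
    unfolding M_def
    by (intro linear_compose_add linear_compose_sub linear_ident linear_proj linear_compose_sum ballI)
      (auto intro!: linearI simp: inner_add_left scaleR_add_left)
  have smooth_M: "smooth_on (\<lambda>x. M x v) S" for v
    unfolding M_def
    by (intro smooth_on_add smooth_on_const smooth_on_sum smooth_on_scaleR S smooth_y e_less)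
  have M_in: "M x b = y (e b) x" if "b \<in> B" for x b
  proof -
    have "(\<Sum>b'\<in>B. (b \<bullet> b') *\<^sub>R y (e b') x) = (\<Sum>b'\<in>B. if b' = b then y (e b) x else 0)"
      by (rule sum.cong) (use that B in \<open>auto simp: inner_Basis subset_iff\<close>)
    then show ?thesis using that B finB proj_Basis[OF B, of b] by (auto simp: M_def)
  qed
  have M_out: "M x v = v" if "proj B v = 0" for x v
  proof -
    have "v \<bullet> b = 0" if "b \<in> B" for b
      using proj_inner[OF B, of b v] that B \<open>proj B v = 0\<close> by auto
    then show ?thesis using that by (simp add: M_def)
  qed
  have image_B: "M x ` B = (\<lambda>i. y i x) ` {..<card B}" for x
  proof -
    have "M x ` B = (\<lambda>b. y (e b) x) ` B" by (rule image_cong[OF refl M_in])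
    also have "\<dots> = (\<lambda>i. y i x) ` (e ` B)" by (simp add: image_image)
    finally show ?thesis unfolding bij_betw_imp_surj_on[OF e] .
  qed
  have V_coord: "V q = {v \<in> tangent_space A q. v c \<in> M (snd c q) ` span B}"
    if q: "q \<in> fst c" "q \<in> W" for q
  proof -
    have lin_ev: "linear (\<lambda>v :: ('a, 'e) tvec. v c)" by (auto intro!: linearI)
    have "(\<lambda>v. v c) ` V q = span ((\<lambda>i. Y i q c) ` {..<card B})"
      unfolding VY[OF q(2)] by (simp add: linear_span_image[OF lin_ev, symmetric] image_image)
    also have "(\<lambda>i. Y i q c) = (\<lambda>i. y i (snd c q))" using c q by (simp add: y_def)
    also have "span ((\<lambda>i. y i (snd c q)) ` {..<card B}) = M (snd c q) ` span B"
      unfolding image_B[symmetric] by (rule linear_span_image[OF linM])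
    finally have img: "(\<lambda>v. v c) ` V q = M (snd c q) ` span B" .
    show ?thesis
    proof (intro equalityI subsetI)
      fix v assume "v \<in> V q"
      then show "v \<in> {v \<in> tangent_space A q. v c \<in> M (snd c q) ` span B}"
        using VT[OF q(2)] img by blast
    next
      fix v assume v: "v \<in> {v \<in> tangent_space A q. v c \<in> M (snd c q) ` span B}"
      then obtain v' where v': "v' \<in> V q" "v c = v' c" using img[symmetric] by auto
      then have "v = v'"
        using tangent_eqI[OF c(1) q(1)] v VT[OF q(2)] by blast
      then show "v \<in> V q" using v' by simp
    qed
  qed
  have inj0: "inj (M (snd c p))"
  proof -
    have sub: "subspace (range (M (snd c p)))" by (rule linear_subspace_image[OF linM subspace_UNIV])
    have "b \<in> range (M (snd c p))" if b: "b \<in> Basis" for b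
    proof (cases "b \<in> B")
      case True
      then have "coord_vec A c p b \<in> V p"
        unfolding Vp chart_distribution_def using c coord_vec_in_tangent by (auto intro: span_base)
      then have "b \<in> M (snd c p) ` span B" unfolding V_coord[OF c(2) W(2)] using c by simp
      then show ?thesis by blast
    next
      case False
      then have "M (snd c p) b = b" using M_out proj_Basis[OF B b] by simp
      then show ?thesis by (metis rangeI)
    qed
    then have "span Basis \<subseteq> range (M (snd c p))" by (intro span_minimal sub) auto
    then have "surj (M (snd c p))" by auto
    then show ?thesis by (rule linear_surj_imp_inj[OF linM])
  qed
  define \<Omega> where "\<Omega> = {x \<in> S. inj (M x)}"
  have \<Omega>: "open \<Omega>" "snd c p \<in> \<Omega>" "\<Omega> \<subseteq> S"
    unfolding \<Omega>_def using S inj0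
    by (auto intro!: open_inj_family linM smooth_on_imp_continuous_on smooth_M)
  have surj: "M x (inv (M x) v) = v" and inv: "inv (M x) (M x v) = v" if "x \<in> \<Omega>" for x v
  proof -
    have "inj (M x)" using that by (simp add: \<Omega>_def)
    then show "inv (M x) (M x v) = v" by simp
    have "surj (M x)" by (rule linear_inj_imp_surj[OF linM \<open>inj (M x)\<close>])
    then show "M x (inv (M x) v) = v" by (rule surj_f_inv_f)
  qed
  have lin_inv: "linear (inv (M x))" if "x \<in> \<Omega>" for x
  proof (rule linearI)
    show "inv (M x) (u + v) = inv (M x) u + inv (M x) v" for u v
      using inv[OF that, of "inv (M x) u + inv (M x) v"] surj[OF that] by (simp add: linear_add[OF linM])
    show "inv (M x) (r *\<^sub>R u) = r *\<^sub>R inv (M x) u" for r u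
      using inv[OF that, of "r *\<^sub>R inv (M x) u"] surj[OF that] by (simp add: linear_scale[OF linM])
  qed
  define L where "L = (\<lambda>x v. M x (proj B (inv (M x) v)))"
  have linL: "linear (L x)" if "x \<in> \<Omega>" for x
    using linear_compose[OF linear_compose[OF lin_inv[OF that] linear_proj[of B]] linM[of x]]
    by (simp add: L_def o_def)
  have smooth_L: "smooth_on (\<lambda>x. L x v) \<Omega>" for v
  proof -
    have M\<Omega>: "smooth_on (\<lambda>x. M x b) \<Omega>" for b by (rule smooth_on_subset[OF smooth_M \<Omega>(3)])
    have "smooth_on (\<lambda>x. inv (M x) v) \<Omega>"
      by (rule smooth_on_solve_linear[where M = M and c = "\<lambda>x. v", OF \<Omega>(1) linM _ M\<Omega> smooth_on_const surj])
        (simp add: \<Omega>_def)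
    then have "smooth_on (\<lambda>x. proj B (inv (M x) v)) \<Omega>"
      by (rule smooth_on_compose[where g = "proj B", OF \<Omega>(1) open_UNIV UNIV_I _ smooth_on_linear[OF linear_proj]])
    then show ?thesis
      unfolding L_def by (rule smooth_on_linear_family[OF \<Omega>(1) linM M\<Omega>])
  qed
  have L_diff: "v - L x v = inv (M x) v - proj B (inv (M x) v)" if "x \<in> \<Omega>" for x v
  proof -
    let ?u = "inv (M x) v"
    have "v - L x v = M x (?u - proj B ?u)"
      unfolding L_def linear_diff[OF linM] using surj[OF that] by simp
    also have "\<dots> = ?u - proj B ?u"
      by (rule M_out) (simp add: linear_diff[OF linear_proj] proj_proj[OF B])
    finally show ?thesis .
  qed
  have proj_L: "proj B (L x v) = proj B v" if "x \<in> \<Omega>" for x v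
  proof -
    have "proj B (v - L x v) = 0"
      unfolding L_diff[OF that] by (simp add: linear_diff[OF linear_proj] proj_proj[OF B])
    then show ?thesis by (simp add: linear_diff[OF linear_proj])
  qed
  have L_proj: "L x (proj B v) = L x v" if x: "x \<in> \<Omega>" for x v
  proof -
    have P0: "proj B (v - proj B v) = 0" by (simp add: linear_diff[OF linear_proj] proj_proj[OF B])
    then have "inv (M x) (v - proj B v) = v - proj B v"
      using inv[OF x, of "v - proj B v"] M_out[OF P0, of x] by simp
    then have "L x (v - proj B v) = 0" by (simp add: L_def P0 linear_0[OF linM])
    then show ?thesis by (simp add: linear_diff[OF linL[OF x]])
  qed
  have range_L: "z \<in> M x ` span B \<longleftrightarrow> L x z = z" if x: "x \<in> \<Omega>" for x z
  proof
    assume "z \<in> M x ` span B"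
    then obtain u where "z = M x u" "proj B u = u" using span_Basis_iff[OF B] by auto
    then show "L x z = z" by (simp add: L_def inv[OF x])
  next
    assume "L x z = z"
    then have "z = M x (proj B (inv (M x) z))" by (simp add: L_def)
    then show "z \<in> M x ` span B" using span_Basis_iff[OF B] proj_proj[OF B] by blast
  qed
  have "\<Omega> \<subseteq> snd c ` fst c" using \<Omega>(3) by (auto simp: S_def)
  moreover have "V q = {v \<in> tangent_space A q. L (snd c q) (v c) = v c}"
    if q: "q \<in> fst c" "snd c q \<in> \<Omega>" for q
  proof -
    have "snd c q \<in> S" using q \<Omega> by blast
    then have "q \<in> W" using inj_onD[OF chart_inj[OF c(1)]] q(1) by (force simp: S_def)
    from V_coord[OF q(1) this] show ?thesis using range_L[OF q(2)] by simp
  qed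
  ultimately show ?thesis
    using \<Omega>(1,2) linL smooth_L proj_L L_proj by (intro exI[of _ L] exI[of _ \<Omega>]) simp
qed

lemma slice_curve:
  assumes N: "slice_chart A r N q0 c B" and q: "q \<in> N" "q \<in> fst c"
    and b: "b \<in> span B" and t: "snd c q + t *\<^sub>R b \<in> snd c ` fst c"
  obtains q' where "q' \<in> N" "q' \<in> fst c" "snd c q' = snd c q + t *\<^sub>R b"
proof -
  have c: "c \<in> A" and B: "B \<subseteq> Basis"
    and sl: "snd c ` (fst c \<inter> N) = {x \<in> snd c ` fst c. \<forall>b\<in>Basis - B. x \<bullet> b = snd c q0 \<bullet> b}"
    using N by (auto simp: slice_chart_def)
  have "snd c q \<in> snd c ` (fst c \<inter> N)" using q by blast
  then have q_sl: "\<forall>b\<in>Basis - B. snd c q \<bullet> b = snd c q0 \<bullet> b" unfolding sl by blast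
  have "b \<bullet> b' = 0" if "b' \<in> Basis - B" for b'
    using proj_inner[OF B, of b' b] span_Basis_iff[OF B, of b] b that by simp
  then have "snd c q + t *\<^sub>R b \<in> snd c ` (fst c \<inter> N)"
    unfolding sl using q_sl t by (auto simp: inner_add_left)
  then show ?thesis using that by (auto simp: image_iff)
qed

text \<open>An integral manifold comes with a separate slice chart for each of its points, and only at that
  point is \<open>V\<close> described in it. Differentiating straight lines in the slice of \<open>c\<close>, viewed in the
  slice chart of another point \<open>q\<close>, shows that the tangent vectors of the slice belong to \<open>V\<close>
  at \<open>q\<close> as well.\<close>

lemma slice_tangent:
  assumes V: "integral_manifold A r V N" and N: "slice_chart A s N q0 c B"
    and q: "q \<in> N" "q \<in> fst c" and b: "b \<in> span B"
  shows "coord_vec A c q b \<in> V q"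
proof -
  have c: "c \<in> A" using N by (simp add: slice_chart_def)
  obtain d B' where d: "slice_chart A r N q d B'" and Vq: "V q = {v \<in> tangent_space A q. v d \<in> span B'}"
    using V q unfolding integral_manifold_def by blast
  have dA: "d \<in> A" "q \<in> fst d" and B': "B' \<subseteq> Basis"
    and sl: "snd d ` (fst d \<inter> N) = {x \<in> snd d ` fst d. \<forall>b\<in>Basis - B'. x \<bullet> b = snd d q \<bullet> b}"
    using d by (auto simp: slice_chart_def)
  let ?x = "snd c q" and ?T = "transition c d"
  let ?S = "snd c ` (fst c \<inter> fst d)"
  have S: "open ?S" by (rule chart_image_Int_open[OF c dA(1)])
  have line: "((\<lambda>t::real. ?x + t *\<^sub>R b) has_derivative (\<lambda>t. t *\<^sub>R b)) (at 0)"
    by (auto intro!: derivative_eq_intros)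
  have lin: "linear (fderiv ?T ?x)" by (rule linear_transition_deriv[OF c dA(1) q(2) dA(2)])
  have U: "open ((\<lambda>t::real. ?x + t *\<^sub>R b) -` ?S)" by (intro open_vimage S continuous_intros)
  have "fderiv ?T ?x b \<bullet> b' = 0" if b': "b' \<in> Basis - B'" for b'
  proof -
    have "(?T has_derivative fderiv ?T ?x) (at (?x + 0 *\<^sub>R b))"
      using transition_has_derivative[OF c dA(1) q(2) dA(2)] by simp
    from has_derivative_inner_left[OF has_derivative_compose[where g = ?T, OF line this]]
    have "((\<lambda>t. ?T (?x + t *\<^sub>R b) \<bullet> b') has_derivative (\<lambda>t. fderiv ?T ?x (t *\<^sub>R b) \<bullet> b')) (at 0)" .
    then have "((\<lambda>t. snd d q \<bullet> b') has_derivative (\<lambda>t. fderiv ?T ?x (t *\<^sub>R b) \<bullet> b')) (at 0)"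
    proof (rule has_derivative_transform_within_open[OF _ U])
      show "0 \<in> (\<lambda>t::real. ?x + t *\<^sub>R b) -` ?S" using q dA by simp
      fix t :: real assume t: "t \<in> (\<lambda>t::real. ?x + t *\<^sub>R b) -` ?S"
      then obtain q' where q': "q' \<in> N" "q' \<in> fst c" "snd c q' = ?x + t *\<^sub>R b"
        using slice_curve[OF N q b, of t] by auto
      then have "q' \<in> fst d" using t inj_onD[OF chart_inj[OF c]] by (force simp flip: q'(3))
      then have "snd d q' \<in> snd d ` (fst d \<inter> N)" using q' by blast
      then have "snd d q' \<bullet> b' = snd d q \<bullet> b'" unfolding sl using b' by blast
      then show "?T (?x + t *\<^sub>R b) \<bullet> b' = snd d q \<bullet> b'" using c q' by (simp flip: q'(3))
    qed
    from fun_cong[OF has_derivative_unique[OF this has_derivative_const], of 1]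
    show ?thesis by simp
  qed
  then have "proj B' (fderiv ?T ?x b) = fderiv ?T ?x b"
    by - (rule euclidean_eqI, simp add: proj_inner[OF B'])
  then have "fderiv ?T ?x b \<in> span B'" using span_Basis_iff[OF B'] by blast
  then show ?thesis
    unfolding Vq using coord_vec_in_tangent[OF c q(2)] dA by (simp add: coord_vec_def)
qed

text \<open>Let \<open>T\<close> be the transition map from a slice chart at \<open>q\<close>, which parametrises an integral
  manifold. Its derivatives in slice directions \<open>b\<close> are tangent to \<open>V\<close>, that is, fixed by \<open>L\<close>.
  Differentiating \<open>L (T y) (fderiv T y b) = fderiv T y b\<close> in a slice direction \<open>a\<close> shows that the
  derivative of \<open>L\<close> in the direction \<open>fderiv T y a\<close>, applied to \<open>fderiv T y b\<close>, is a linear image of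
  the second derivative of \<open>T\<close>, which is symmetric in \<open>a\<close> and \<open>b\<close>.\<close>

theorem integrable_imp_involutive:
  assumes int: "integrable_distribution X A (topspace X) r V"
    and c: "c \<in> A" and \<Omega>: "open \<Omega>" "\<Omega> \<subseteq> snd c ` fst c"
    and B: "B \<subseteq> Basis"
    and lin: "\<And>x. x \<in> \<Omega> \<Longrightarrow> linear (L x)" and smooth: "\<And>v. smooth_on (\<lambda>x. L x v) \<Omega>"
    and proj_L: "\<And>x v. x \<in> \<Omega> \<Longrightarrow> proj B (L x v) = proj B v"
    and L_proj: "\<And>x v. x \<in> \<Omega> \<Longrightarrow> L x (proj B v) = L x v"
    and VL: "\<And>q. q \<in> fst c \<Longrightarrow> snd c q \<in> \<Omega> \<Longrightarrow> V q = {v \<in> tangent_space A q. L (snd c q) (v c) = v c}"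
    and x: "x \<in> \<Omega>"
  shows "fderiv (\<lambda>w. L w v) x (L x u) = fderiv (\<lambda>w. L w u) x (L x v)"
proof -
  obtain q where q: "q \<in> fst c" "x = snd c q" using x \<Omega>(2) by blast
  have "q \<in> topspace X" using openin_subset[OF chart_openin[OF c]] q(1) by blast
  then obtain N where N: "q \<in> N" "integral_manifold A r V N"
    using int unfolding integrable_distribution_def by blast
  obtain d B' where d: "slice_chart A r N q d B'" and Vq: "V q = {v \<in> tangent_space A q. v d \<in> span B'}"
    using N unfolding integral_manifold_def by blast
  have dA: "d \<in> A" "q \<in> fst d" using d by (auto simp: slice_chart_def)
  let ?T = "transition d c" and ?x = "snd d q" and ?S = "snd d ` (fst d \<inter> fst c)"
  have S: "open ?S" "?x \<in> ?S" using chart_image_Int_open[OF dA(1) c] dA q by auto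
  have smT: "smooth_on ?T ?S" by (rule smooth_transition[OF dA(1) c])
  have Tx: "?T ?x = x" using dA q by simp
  define D2 where "D2 = (\<lambda>a b. fderiv (\<lambda>y. fderiv ?T y b) ?x a)"
  have sym: "D2 a b = D2 b a" for a b
    unfolding D2_def by (rule second_derivative_symmetric[OF S smT])
  have key: "fderiv (\<lambda>w. L w (fderiv ?T ?x b)) x (fderiv ?T ?x a) + L x (D2 a b) = D2 a b"
    if a: "a \<in> span B'" and b: "b \<in> span B'" for a b
  proof -
    let ?g = "\<lambda>t::real. ?x + t *\<^sub>R a"
    have line: "(?g has_derivative (\<lambda>t. t *\<^sub>R a)) (at 0)"
      by (auto intro!: derivative_eq_intros)
    have "(?T has_derivative fderiv ?T ?x) (at (?g 0))"
      using smooth_on_has_derivative[OF smT S(2)] by simp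
    from has_derivative_compose[where g = ?T, OF line this]
    have dT: "((\<lambda>t. ?T (?g t)) has_derivative (\<lambda>t. fderiv ?T ?x (t *\<^sub>R a))) (at 0)" .
    have "((\<lambda>y. fderiv ?T y b) has_derivative (\<lambda>a. D2 a b)) (at (?g 0))"
      using smooth_on_has_derivative[OF smooth_on_fderiv[OF smT] S(2)] by (simp add: D2_def)
    from has_derivative_compose[where g = "\<lambda>y. fderiv ?T y b", OF line this]
    have dD: "((\<lambda>t. fderiv ?T (?g t) b) has_derivative (\<lambda>t. D2 (t *\<^sub>R a) b)) (at 0)" .
    have L0: "?T (?g 0) \<in> \<Omega>" using Tx x by simp
    have d1: "((\<lambda>t. L (?T (?g t)) (fderiv ?T (?g t) b)) has_derivative
       (\<lambda>t. fderiv (\<lambda>w. L w (fderiv ?T (?g 0) b)) (?T (?g 0)) (fderiv ?T ?x (t *\<^sub>R a))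
          + L (?T (?g 0)) (D2 (t *\<^sub>R a) b))) (at 0)"
      by (rule has_derivative_linear_family[where M = L, OF \<Omega>(1) lin smooth dT L0 dD])
    have "open (?S \<inter> ?T -` \<Omega>)"
      by (rule continuous_open_preimage[OF smooth_on_imp_continuous_on[OF smT] S(1) \<Omega>(1)])
    then have U: "open (?g -` (?S \<inter> ?T -` \<Omega>))" by (intro open_vimage continuous_intros)
    from d1 have "((\<lambda>t. fderiv ?T (?g t) b) has_derivative
       (\<lambda>t. fderiv (\<lambda>w. L w (fderiv ?T (?g 0) b)) (?T (?g 0)) (fderiv ?T ?x (t *\<^sub>R a))
          + L (?T (?g 0)) (D2 (t *\<^sub>R a) b))) (at 0)"
    proof (rule has_derivative_transform_within_open[OF _ U])
      show "0 \<in> ?g -` (?S \<inter> ?T -` \<Omega>)" using S L0 by simp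
      fix t assume t: "t \<in> ?g -` (?S \<inter> ?T -` \<Omega>)"
      then obtain q' where q': "q' \<in> N" "q' \<in> fst d" "snd d q' = ?g t"
        using slice_curve[OF d N(1) dA(2) a, of t] by auto
      have "q' \<in> fst c" using t inj_onD[OF chart_inj[OF dA(1)]] q' by (force simp flip: q'(3))
      have Tq: "?T (?g t) = snd c q'" using dA q' by (simp flip: q'(3))
      have "coord_vec A d q' b \<in> V q'" by (rule slice_tangent[OF N(2) d q'(1,2) b])
      then have "L (snd c q') (coord_vec A d q' b c) = coord_vec A d q' b c"
        using VL[OF \<open>q' \<in> fst c\<close>] t Tq by auto
      then show "L (?T (?g t)) (fderiv ?T (?g t) b) = fderiv ?T (?g t) b"
        unfolding Tq using c \<open>q' \<in> fst c\<close> by (simp add: coord_vec_def flip: q'(3))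
    qed
    from fun_cong[OF has_derivative_unique[OF this dD], of 1] show ?thesis by (simp add: dA q)
  qed
  have in_V: "\<exists>a\<in>span B'. fderiv ?T ?x a = L x u" for u
  proof -
    let ?v = "coord_vec A c q (L x u)"
    have "L x (L x u) = L x u"
      using L_proj[OF x, of "L x u"] proj_L[OF x, of u] L_proj[OF x, of u] by simp
    then have "?v \<in> V q"
      using VL[OF q(1)] x c q coord_vec_in_tangent[OF c q(1)] by simp
    then have "?v d \<in> span B'" unfolding Vq by blast
    moreover have "fderiv ?T ?x (?v d) = L x u"
      using c q dA transition_deriv_compose[of c d c q] transition_deriv_self[OF c q(1)]
      by (simp add: coord_vec_def)
    ultimately show ?thesis by blast
  qed
  obtain a where a: "a \<in> span B'" "fderiv ?T ?x a = L x u" using in_V by blast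
  obtain b where b: "b \<in> span B'" "fderiv ?T ?x b = L x v" using in_V by blast
  \<comment> \<open>As \<open>L w\<close> depends on \<open>proj B\<close> of its argument only, an inner \<open>L x\<close> may be dropped.\<close>
  have drop: "fderiv (\<lambda>w. L w (L x v)) x k = fderiv (\<lambda>w. L w v) x k" for v k
  proof -
    have "((\<lambda>w. L w (L x v)) has_derivative fderiv (\<lambda>w. L w v) x) (at x)"
      by (rule has_derivative_transform_within_open[OF smooth_on_has_derivative[OF smooth x] \<Omega>(1) x])
        (metis L_proj proj_L x)
    then show ?thesis by (simp add: fderiv_eq)
  qed
  have "fderiv (\<lambda>w. L w (L x v)) x (L x u) = fderiv (\<lambda>w. L w (L x u)) x (L x v)"
    using key[OF a(1) b(1)] key[OF b(1) a(1)] sym[of a b] by (simp add: a b) (metis add_right_cancel)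
  then show ?thesis by (simp add: drop)
qed

end

context smooth_manifold
begin

lemma translate_chart:
  assumes c: "c \<in> A" "p \<in> fst c"
  shows "\<exists>c'\<in>A. p \<in> fst c' \<and> snd c' p = 0 \<and> (\<forall>B. chart_distribution c' B p = chart_distribution c B p)"
proof -
  let ?\<Psi> = "\<lambda>x. x - snd c p" and ?g = "\<lambda>y. y + snd c p"
  let ?S = "snd c ` fst c"
  have hom: "homeomorphism ?S (?\<Psi> ` ?S) ?\<Psi> ?g"
    by (intro homeomorphismI continuous_intros) auto
  have S: "open ?S" by (rule chart_open_image[OF c(1)])
  have T: "open (?\<Psi> ` ?S)" using open_translation_subtract[OF S, of "snd c p"] .
  have smooth: "smooth_on ?\<Psi> ?S" "smooth_on ?g (?\<Psi> ` ?S)"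
    using S T by (auto intro: smooth_on_diff smooth_on_add smooth_on_ident smooth_on_const)
  define c' where "c' = ({q \<in> fst c. snd c q \<in> ?S}, \<lambda>q. ?\<Psi> (snd c q))"
  note ch = change_of_chart[OF c(1) S subset_refl T hom smooth, folded c'_def]
  have p: "p \<in> fst c'" using c by (simp add: c'_def)
  have "(?\<Psi> has_derivative (\<lambda>v. v)) (at (snd c p))"
    by (auto intro!: derivative_eq_intros)
  then have id: "fderiv (transition c c') (snd c p) = (\<lambda>v. v)"
    using ch(3)[OF p] by (simp add: fderiv_eq)
  have eqc: "v c' = v c" if "v \<in> tangent_space A p" for v
    using tangent_deriv[OF that c(1) ch(1) c(2) p] id by simp
  then have "chart_distribution c' B p = chart_distribution c B p" for B
    unfolding chart_distribution_def by - (rule Collect_cong, metis eqc)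
  then show ?thesis using ch(1) p by (intro bexI[of _ c']) (auto simp: c'_def)
qed

text \<open>The theorem of Frobenius: in a chart centred at \<open>p\<close> whose coordinate subspace \<open>span B\<close> is tangent
  to \<open>V\<close> at \<open>p\<close>, the inverse of the map \<open>F\<close> of \<open>foliated_coordinates\<close> straightens the leaves.\<close>

theorem foliated_chart:
  assumes int: "integrable_distribution X A (topspace X) r V" and p: "p \<in> topspace X"
  shows "\<exists>c\<in>A. \<exists>B R. p \<in> fst c \<and> snd c p = 0 \<and> B \<subseteq> Basis \<and> card B = r \<and> R > 0 \<and>
    snd c ` fst c = ball 0 R \<and> (\<forall>q\<in>fst c. V q = chart_distribution c B q)"
proof -
  obtain N where N: "p \<in> N" "integral_manifold A r V N"
    using int p unfolding integrable_distribution_def by blast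
  obtain c0 B where sl: "slice_chart A r N p c0 B" and Vp0: "V p = {v \<in> tangent_space A p. v c0 \<in> span B}"
    using N unfolding integral_manifold_def by blast
  then have c0: "c0 \<in> A" "p \<in> fst c0" and B: "B \<subseteq> Basis" "card B = r"
    by (auto simp: slice_chart_def)
  obtain c where c: "c \<in> A" "p \<in> fst c" "snd c p = 0"
    and cd: "\<forall>B. chart_distribution c B p = chart_distribution c0 B p"
    using translate_chart[OF c0] by blast
  have Vp: "V p = chart_distribution c B p"
    using cd Vp0 by (simp add: chart_distribution_def)
  have dist: "distribution X A (topspace X) (card B) V"
    using int B(2) by (simp add: integrable_distribution_def)
  obtain L \<Omega> where L\<Omega>: "open \<Omega> \<and> snd c p \<in> \<Omega> \<and> \<Omega> \<subseteq> snd c ` fst c \<and>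
    (\<forall>x\<in>\<Omega>. linear (L x)) \<and> (\<forall>v. smooth_on (\<lambda>x. L x v) \<Omega>) \<and>
    (\<forall>x\<in>\<Omega>. \<forall>v. proj B (L x v) = proj B v \<and> L x (proj B v) = L x v) \<and>
    (\<forall>q\<in>fst c. snd c q \<in> \<Omega> \<longrightarrow> V q = {v \<in> tangent_space A q. L (snd c q) (v c) = v c})"
    using distribution_as_graph[OF c(1,2) B(1) dist Vp] by (elim exE)
  then have \<Omega>c: "open \<Omega>" "0 \<in> \<Omega>" "\<Omega> \<subseteq> snd c ` fst c" using c(3) by auto
  have linL: "linear (L x)" if "x \<in> \<Omega>" for x using L\<Omega> that by blast
  have smL: "smooth_on (\<lambda>x. L x v) \<Omega>" for v using L\<Omega> by blast
  have projL: "proj B (L x v) = proj B v" "L x (proj B v) = L x v" if "x \<in> \<Omega>" for x v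
    using L\<Omega> that by blast+
  have VL: "V q = {v \<in> tangent_space A q. L (snd c q) (v c) = v c}" if "q \<in> fst c" "snd c q \<in> \<Omega>" for q
    using L\<Omega> that by blast
  note cardB = B(2)
  interpret vertical_projection B L \<Omega>
  proof (rule vertical_projection.intro)
    show "fderiv (\<lambda>w. L w v) x (L x u) = fderiv (\<lambda>w. L w u) x (L x v)" if "x \<in> \<Omega>" for x u v
      by (rule integrable_imp_involutive[OF int c(1) \<Omega>c(1,3) B(1) linL smL projL VL that])
  qed (rule B \<Omega>c linL smL projL | assumption)+
  obtain F R0 where R0: "R0 > 0" and smF: "smooth_on F (ball 0 R0)" and F\<Omega>: "F ` ball 0 R0 \<subseteq> \<Omega>"
    and F0: "F 0 = 0" and injF: "inj (fderiv F 0)"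
    and DF: "\<And>p v. p \<in> ball 0 R0 \<Longrightarrow> fderiv F p (proj B v) = L (F p) v"
    by (rule foliated_coordinates) (rule that)
  have z: "0 \<in> ball (0::'e) R0" using R0 by simp
  obtain U T g where U: "open U" "U \<subseteq> ball 0 R0" "0 \<in> U" and T: "open T" and hom: "homeomorphism U T F g"
    and smg: "smooth_on g T"
    and derg: "\<And>y. y \<in> T \<Longrightarrow> (g has_derivative inv (fderiv F (g y))) (at y)"
    and bij: "\<And>x. x \<in> U \<Longrightarrow> bij (fderiv F x)"
    by (rule smooth_inverse_function[OF open_ball z smF injF]) (rule that)
  obtain R where R: "R > 0" "ball 0 R \<subseteq> U" using U open_contains_ball by blast
  define S where "S = T \<inter> g -` ball 0 R"
  have S: "open S"
    unfolding S_def using hom by (intro continuous_open_preimage T) (auto simp: homeomorphism_def)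
  have FS: "F ` ball 0 R = S"
  proof (intro equalityI subsetI)
    fix x assume "x \<in> F ` ball 0 R"
    then obtain z where z: "z \<in> ball 0 R" "x = F z" by blast
    then have "z \<in> U" using R(2) by blast
    then have "F z \<in> T" "g (F z) = z" using hom by (auto simp: homeomorphism_def)
    then show "x \<in> S" using z by (simp add: S_def)
  next
    fix x assume "x \<in> S"
    then have "x \<in> T" "g x \<in> ball 0 R" by (auto simp: S_def)
    moreover from this have "F (g x) = x" using hom by (auto simp: homeomorphism_def)
    ultimately show "x \<in> F ` ball 0 R" using image_eqI[of x F "g x" "ball 0 R"] by simp
  qed
  have homS: "homeomorphism (ball 0 R) S F g"
    by (rule homeomorphism_of_subsets[OF hom R(2) _ FS, of S]) (simp add: S_def)
  have gF: "homeomorphism S (ball 0 R) g F" by (rule homeomorphism_symD[OF homS])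
  have RR0: "ball (0::'e) R \<subseteq> ball 0 R0" by (rule order_trans[OF R(2) U(2)])
  have "S \<subseteq> F ` ball 0 R0" unfolding FS[symmetric] by (rule image_mono[OF RR0])
  then have S\<Omega>: "S \<subseteq> \<Omega>" using F\<Omega> by (rule subset_trans)
  then have S_sub: "S \<subseteq> snd c ` fst c" using \<Omega>c(3) by (rule subset_trans)
  have smg': "smooth_on g S" by (rule smooth_on_subset[OF smg]) (simp add: S_def)
  have smF': "smooth_on F (ball 0 R)" by (rule smooth_on_subset[OF smF RR0])
  define c' where "c' = ({q \<in> fst c. snd c q \<in> S}, \<lambda>q. g (snd c q))"
  note ch = change_of_chart[OF c(1) S S_sub open_ball gF smg' smF', folded c'_def]
  have sub: "q \<in> fst c" "snd c q \<in> S" "snd c q \<in> \<Omega>" if "q \<in> fst c'" for q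
    using that subsetD[OF S\<Omega>] by (simp_all add: c'_def)
  have "F 0 \<in> S" unfolding FS[symmetric] using R(1) by simp
  then have p': "p \<in> fst c'" using c F0 by (simp add: c'_def)
  have "g (F 0) = 0" using homeomorphism_apply1[OF homS] R(1) by simp
  then have p0: "snd c' p = 0" using F0 c by (simp add: c'_def)
  have V': "V q = chart_distribution c' B q" if q: "q \<in> fst c'" for q
  proof -
    let ?y = "snd c' q"
    have y: "?y \<in> ball 0 R" using ch(2) q by blast
    have Fy: "F ?y = snd c q" using homeomorphism_apply2[OF homS sub(2)[OF q]] by (simp add: c'_def)
    have y0: "?y \<in> ball 0 R0" "?y \<in> U" using subsetD[OF RR0 y] subsetD[OF R(2) y] by simp_all
    have vc: "v c = fderiv F ?y (v c')" if "v \<in> tangent_space A q" for v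
      using tangent_deriv[OF that ch(1) c(1) q sub(1)[OF q]] ch(4)[OF q] by simp
    have "L (snd c q) (v c) = v c \<longleftrightarrow> v c' \<in> span B" if v: "v \<in> tangent_space A q" for v
    proof
      assume "L (snd c q) (v c) = v c"
      then have "fderiv F ?y (proj B (v c)) = fderiv F ?y (v c')"
        using DF[OF y0(1), of "v c"] vc[OF v] Fy by simp
      then have "proj B (v c) = v c'" using bij[OF y0(2)] by (simp add: bij_def inj_eq)
      then show "v c' \<in> span B" using span_Basis_iff[OF B(1)] proj_proj[OF B(1)] by metis
    next
      assume "v c' \<in> span B"
      then have "proj B (v c') = v c'" using span_Basis_iff[OF B(1)] by blast
      then have e: "v c = L (snd c q) (v c')" using DF[OF y0(1), of "v c'"] vc[OF v] Fy by simp
      then show "L (snd c q) (v c) = v c"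
        using projL[OF sub(3)[OF q]] by metis
    qed
    then show ?thesis
      unfolding VL[OF sub(1)[OF q] sub(3)[OF q]] chart_distribution_def by blast
  qed
  show ?thesis
    by (intro bexI[of _ c'] exI[of _ B] exI[of _ R] conjI ballI ch(1,2) p' p0 B cardB R(1) V')
qed

lemma form2_coeff_eq:
  assumes "c \<in> A" "q \<in> fst c" "u \<in> tangent_space A q" "v \<in> tangent_space A q"
  shows "\<omega> q u v = form2_coeff A \<omega> c (u c) (v c) (snd c q)"
  using assms by (simp add: form2_coeff_def coord_vec_tangent)

lemma form2_coeff_antisym_linear:
  assumes \<omega>: "differential_form2 X A \<omega>" and c: "c \<in> A" and x: "x \<in> snd c ` fst c"
  shows "form2_coeff A \<omega> c u v x = - form2_coeff A \<omega> c v u x"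
    and "linear (\<lambda>v. form2_coeff A \<omega> c u v x)"
proof -
  obtain q where q: "q \<in> fst c" "x = snd c q" using x by blast
  have qX: "q \<in> topspace X" using openin_subset[OF chart_openin[OF c]] q(1) by blast
  have t: "coord_vec A c q u \<in> tangent_space A q" for u by (rule coord_vec_in_tangent[OF c q(1)])
  have e: "form2_coeff A \<omega> c u v x = \<omega> q (coord_vec A c q u) (coord_vec A c q v)" for u v
    using q c by (simp add: form2_coeff_def)
  have anti: "form2_coeff A \<omega> c u v x = - form2_coeff A \<omega> c v u x" for u v
    unfolding e using \<omega> qX t unfolding differential_form2_def by blast
  show "form2_coeff A \<omega> c u v x = - form2_coeff A \<omega> c v u x" by (rule anti)
  have lin: "form2_coeff A \<omega> c (a *\<^sub>R u + b *\<^sub>R v) w x = a * form2_coeff A \<omega> c u w x + b * form2_coeff A \<omega> c v w x"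
    for a b u v w
    unfolding e linear_add[OF linear_coord_vec[OF c q(1)]] linear_scale[OF linear_coord_vec[OF c q(1)]]
    using \<omega> qX t unfolding differential_form2_def by blast
  show "linear (\<lambda>v. form2_coeff A \<omega> c u v x)"
  proof (rule linearI)
    show "form2_coeff A \<omega> c u (v + w) x = form2_coeff A \<omega> c u v x + form2_coeff A \<omega> c u w x" for v w
      using lin[of 1 v 1 w u] anti[of u] by simp
    show "form2_coeff A \<omega> c u (r *\<^sub>R v) x = r *\<^sub>R form2_coeff A \<omega> c u v x" for r v
      using lin[of r v 0 v u] anti[of u] by simp
  qed
qed

end

section \<open>The supplementary foliation\<close>

text \<open>In a foliated chart \<open>c\<close> the functions \<open>y \<alpha> b\<close> are the Darboux coordinates of \<open>\<omega> \<alpha>\<close>. Together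
  with the transversal coordinates of \<open>c\<close> they form the chart \<open>d\<close>, in which \<open>V\<close> belongs to the
  coordinates in \<open>B\<close> and \<open>V'\<close> to the others.\<close>

theorem corollary3p7:
  fixes X :: "'a topology" and A :: "('a, 'e::euclidean_space) chart set"
    and n k :: nat
    and \<omega> :: "nat \<Rightarrow> ('a, 'e) form2"
    and V :: "'a \<Rightarrow> ('a, 'e) tvec set"
  assumes "k_symplectic_manifold X A n k \<omega> V"
  shows "\<forall>p\<in>topspace X. \<exists>U V'. openin X U \<and> p \<in> U \<and>
           integrable_distribution X A U n V' \<and>
           supplementary_on A U V V' \<and>
           (\<forall>\<alpha>\<in>{1..k}. vanishes_on U (\<omega> \<alpha>) V')"
proof
  fix p assume p: "p \<in> topspace X"
  interpret k_symplectic_manifold X A n k \<omega> V by (rule assms)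
  obtain c B R where c: "c \<in> A" "p \<in> fst c" "snd c p = 0" and B: "B \<subseteq> Basis" "card B = n * k"
    and R: "R > 0" "snd c ` fst c = ball 0 R" and V: "\<And>q. q \<in> fst c \<Longrightarrow> V q = chart_distribution c B q"
    using foliated_chart[OF integrable p] by blast
  define w where "w = (\<lambda>\<alpha> x u v. form2_coeff A (\<omega> \<alpha>) c u v x)"
  have c_in: "q \<in> topspace X" if "q \<in> fst c" for q
    using openin_subset[OF chart_openin[OF c(1)]] that by blast
  have w_eq: "w \<alpha> (snd c q) u v = \<omega> \<alpha> q (coord_vec A c q u) (coord_vec A c q v)" if "q \<in> fst c" for \<alpha> q u v
    using that c by (simp add: w_def form2_coeff_def)
  have polar: "polarized_closed_form B R (w \<alpha>)" if \<alpha>: "\<alpha> \<in> {1..k}" for \<alpha>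
  proof (rule polarized_closed_form.intro)
    show "B \<subseteq> Basis" by (rule B)
    fix x u assume "x \<in> ball (0::'e) R"
    then have x: "x \<in> snd c ` fst c" using R by simp
    then obtain q where q: "q \<in> fst c" "x = snd c q" by blast
    show "linear (w \<alpha> x u)"
      unfolding w_def by (rule form2_coeff_antisym_linear(2)[OF forms[OF \<alpha>] c(1) x])
    show "w \<alpha> x u v = - w \<alpha> x v u" for v
      unfolding w_def by (rule form2_coeff_antisym_linear(1)[OF forms[OF \<alpha>] c(1) x])
    show "fderiv (\<lambda>q. w \<alpha> q v t) x u - fderiv (\<lambda>q. w \<alpha> q u t) x v + fderiv (\<lambda>q. w \<alpha> q u v) x t = 0" for v t
      using closed[OF \<alpha>] c(1) x unfolding closed_form2_def ext_deriv2_def w_def by blast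
    show "w \<alpha> x (proj B u) (proj B v) = 0" for v
    proof -
      have "coord_vec A c q (proj B v) \<in> V q" for v
        unfolding V[OF q(1)] chart_distribution_def
        using coord_vec_in_tangent[OF c(1) q(1)] c(1) q(1) span_Basis_iff[OF B(1)] proj_proj[OF B(1)] by simp
      then show ?thesis
        using isotropic[OF \<alpha>] c_in[OF q(1)] unfolding q(2) w_eq[OF q(1)] vanishes_on_def by blast
    qed
  next
    show "smooth_on (\<lambda>q. w \<alpha> q u v) (ball 0 R)" for u v
      using forms[OF \<alpha>] c(1) R(2) unfolding differential_form2_def w_def by auto
  qed
  define y where "y = (\<lambda>\<alpha>. polarized_closed_form.darboux_coord B (w \<alpha>))"
  have smooth_y: "smooth_on (y \<alpha> b) (ball 0 R)" if "\<alpha> \<in> {1..k}" for \<alpha> b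
    unfolding y_def by (rule polarized_closed_form.smooth_darboux_coord[OF polar[OF that]])
  have darboux: "w \<alpha> x u v = (\<Sum>b\<in>Basis - B. (u \<bullet> b) * fderiv (y \<alpha> b) x v - (v \<bullet> b) * fderiv (y \<alpha> b) x u)"
    if "\<alpha> \<in> {1..k}" "x \<in> ball 0 R" for \<alpha> x u v
    unfolding y_def by (rule polarized_closed_form.form_in_coordinates[OF polar[OF that(1)] that(2)])
  have finB: "finite B" using B(1) finite_Basis finite_subset by blast
  have card_Q: "card (Basis - B) = n"
    using card_Diff_subset[OF finB B(1)] B(2) dimension by (simp add: algebra_simps)
  define I where "I = {1..k} \<times> (Basis - B)"
  have finI: "finite I" by (simp add: I_def)
  have "card I = card B" using card_Q B(2) by (simp add: I_def card_cartesian_product)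
  then obtain \<beta> where \<beta>: "bij_betw \<beta> I B"
    using finite_same_card_bij[OF finI finB] by blast
  \<comment> \<open>There are as many functions \<open>y \<alpha> b\<close> as elements of \<open>B\<close>; \<open>y \<alpha> b\<close> becomes the coordinate
    belonging to the basis vector \<open>\<beta> (\<alpha>, b)\<close>.\<close>
  define \<Psi> where "\<Psi> = (\<lambda>x. (x - proj B x) + (\<Sum>i\<in>I. y (fst i) (snd i) x *\<^sub>R \<beta> i))"
  have yI: "smooth_on (y (fst i) (snd i)) (ball 0 R)" if "i \<in> I" for i
    by (rule smooth_y) (use that in \<open>auto simp: I_def\<close>)
  have smooth_\<Psi>: "smooth_on \<Psi> (ball 0 R)"
    unfolding \<Psi>_def
    by (intro smooth_on_add smooth_on_diff smooth_on_sum smooth_on_scaleR open_ball smooth_on_ident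
        smooth_on_const smooth_on_linear[OF linear_proj] yI)
  have D\<Psi>: "fderiv \<Psi> x u = (u - proj B u) + (\<Sum>i\<in>I. fderiv (y (fst i) (snd i)) x u *\<^sub>R \<beta> i)"
    if x: "x \<in> ball 0 R" for x u
  proof -
    note P = linear_has_derivative[OF linear_proj, of B "at x"]
    have "(\<Psi> has_derivative (\<lambda>u. (u - proj B u) + (\<Sum>i\<in>I. fderiv (y (fst i) (snd i)) x u *\<^sub>R \<beta> i))) (at x)"
      unfolding \<Psi>_def
      by (intro has_derivative_add has_derivative_diff has_derivative_ident P has_derivative_sum
          has_derivative_scaleR_left smooth_on_has_derivative[OF yI x])
    then show ?thesis by (simp add: fderiv_eq)
  qed
  have \<beta>B: "\<beta> i \<in> B" "\<beta> i \<in> Basis" if "i \<in> I" for i using bij_betwE[OF \<beta>] that B(1) by auto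
  have proj_\<beta>: "proj B (\<beta> i) = \<beta> i" if "i \<in> I" for i
    using proj_Basis[OF B(1) \<beta>B(2)[OF that]] \<beta>B(1)[OF that] by simp
  have proj_D\<Psi>: "proj B (fderiv \<Psi> x u) = (\<Sum>i\<in>I. fderiv (y (fst i) (snd i)) x u *\<^sub>R \<beta> i)"
    if x: "x \<in> ball 0 R" for x u
    unfolding D\<Psi>[OF x]
    by (simp add: linear_add[OF linear_proj] linear_diff[OF linear_proj] proj_proj[OF B(1)]
        linear_sum[OF linear_proj] linear_scale[OF linear_proj] proj_\<beta>)
  have D\<Psi>_y: "fderiv (y \<alpha> b) x u = fderiv \<Psi> x u \<bullet> \<beta> (\<alpha>, b)"
    if x: "x \<in> ball 0 R" and i: "\<alpha> \<in> {1..k}" "b \<in> Basis - B" for x u \<alpha> b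
  proof -
    have iI: "(\<alpha>, b) \<in> I" using i by (simp add: I_def)
    have "fderiv \<Psi> x u \<bullet> \<beta> (\<alpha>, b) = proj B (fderiv \<Psi> x u) \<bullet> \<beta> (\<alpha>, b)"
      using proj_inner[OF B(1) \<beta>B(2)[OF iI]] \<beta>B(1)[OF iI] by simp
    also have "\<dots> = (\<Sum>i\<in>I. fderiv (y (fst i) (snd i)) x u * (\<beta> i \<bullet> \<beta> (\<alpha>, b)))"
      unfolding proj_D\<Psi>[OF x] by (simp add: inner_sum_left)
    also have "\<dots> = (\<Sum>i\<in>I. if i = (\<alpha>, b) then fderiv (y \<alpha> b) x u else 0)"
    proof (rule sum.cong[OF refl])
      fix i assume "i \<in> I"
      then show "fderiv (y (fst i) (snd i)) x u * (\<beta> i \<bullet> \<beta> (\<alpha>, b)) = (if i = (\<alpha>, b) then fderiv (y \<alpha> b) x u else 0)"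
        using inner_Basis[OF \<beta>B(2) \<beta>B(2)[OF iI]] bij_betw_imp_inj_on[OF \<beta>] iI by (auto simp: inj_on_def)
    qed
    also have "\<dots> = fderiv (y \<alpha> b) x u" using iI finI by simp
    finally show ?thesis ..
  qed
  \<comment> \<open>A vector in the kernel has no transversal component and annihilates all \<open>dy\<close>; by \<open>darboux\<close> it is in
    the kernel of every \<open>\<omega> \<alpha>\<close>.\<close>
  have inj_D\<Psi>: "inj (fderiv \<Psi> 0)"
  proof -
    have x: "0 \<in> ball (0::'e) R" using R by simp
    have lin: "linear (fderiv \<Psi> 0)" by (rule linear_fderiv_smooth_on[OF smooth_\<Psi> x])
    show ?thesis
      unfolding linear_injective_0[OF lin]
    proof (intro allI impI)
      fix u assume u: "fderiv \<Psi> 0 u = 0"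
      then have "proj B (fderiv \<Psi> 0 u) = 0" by (simp add: linear_0[OF linear_proj])
      then have Pu: "proj B u = u" using D\<Psi>[OF x, of u] proj_D\<Psi>[OF x, of u] u by simp
      have ub: "u \<bullet> b = 0" if "b \<in> Basis - B" for b
        using proj_inner[OF B(1), of b u] that Pu by auto
      have "w \<alpha> 0 u v = 0" if \<alpha>: "\<alpha> \<in> {1..k}" for \<alpha> v
        unfolding darboux[OF \<alpha> x] by (rule sum.neutral) (simp add: ub D\<Psi>_y[OF x \<alpha>] u)
      then have w0: "\<omega> \<alpha> p (coord_vec A c p u) (coord_vec A c p v) = 0" if "\<alpha> \<in> {1..k}" for \<alpha> v
        using w_eq[OF c(2), of \<alpha> u v] c(3) that by simp
      let ?v = "coord_vec A c p u"
      have "?v \<in> form2_ker A (\<omega> \<alpha>) p" if \<alpha>: "\<alpha> \<in> {1..k}" for \<alpha>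
        unfolding form2_ker_def
      proof (intro CollectI conjI ballI)
        show "?v \<in> tangent_space A p" by (rule coord_vec_in_tangent[OF c(1,2)])
        fix t assume "t \<in> tangent_space A p"
        from coord_vec_tangent[OF c(1,2) this] show "\<omega> \<alpha> p ?v t = 0" using w0[OF \<alpha>, of "t c"] by simp
      qed
      then have "?v \<in> (\<Inter>\<alpha>\<in>{1..k}. form2_ker A (\<omega> \<alpha>) p)" by blast
      then have "?v = 0" unfolding nondegenerate[OF p] by blast
      then have "?v c = 0" by simp
      then show "u = 0" using c by simp
    qed
  qed
  have z: "0 \<in> ball (0::'e) R" using R by simp
  obtain S T g where S: "open S" "S \<subseteq> ball 0 R" "0 \<in> S" and T: "open T" and hom: "homeomorphism S T \<Psi> g"
    and smg: "smooth_on g T"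
    by (rule smooth_inverse_function[OF open_ball z smooth_\<Psi> inj_D\<Psi>]) (rule that)
  have S_sub: "S \<subseteq> snd c ` fst c" using S R by simp
  define d where "d = ({q \<in> fst c. snd c q \<in> S}, \<lambda>q. \<Psi> (snd c q))"
  note ch = change_of_chart[OF c(1) S(1) S_sub T hom smooth_on_subset[OF smooth_\<Psi> S(2)] smg, folded d_def]
  have d: "d \<in> A" by (rule ch(1))
  have sub: "q \<in> fst c" "snd c q \<in> ball 0 R" if "q \<in> fst d" for q
    using that S by (auto simp: d_def)
  have vd: "v d = fderiv \<Psi> (snd c q) (v c)" if "v \<in> tangent_space A q" "q \<in> fst d" for v q
    using tangent_deriv[OF that(1) c(1) d sub(1)[OF that(2)] that(2)] ch(3)[OF that(2)] by simp
  have Vd: "V q = chart_distribution d B q" if q: "q \<in> fst d" for q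
  proof -
    have "v c \<in> span B \<longleftrightarrow> v d \<in> span B" if v: "v \<in> tangent_space A q" for v
    proof -
      have e: "v d - proj B (v d) = v c - proj B (v c)"
        unfolding vd[OF v q] proj_D\<Psi>[OF sub(2)[OF q]] unfolding D\<Psi>[OF sub(2)[OF q]] by simp
      have fixed: "proj B z = z \<longleftrightarrow> z - proj B z = 0" for z :: 'e by auto
      show ?thesis unfolding span_Basis_iff[OF B(1)] fixed e ..
    qed
    then show ?thesis unfolding V[OF sub(1)[OF q]] chart_distribution_def by blast
  qed
  let ?V' = "chart_distribution d (Basis - B)"
  have "supplementary_on A (fst d) V ?V'"
    unfolding supplementary_on_def
  proof (intro ballI conjI)
    fix q assume q: "q \<in> fst d"
    note img = chart_distribution_eq_image[OF d q]
    show "V q \<inter> ?V' q = {0}"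
    proof (intro equalityI subsetI)
      fix v assume v: "v \<in> V q \<inter> ?V' q"
      then have t: "v \<in> tangent_space A q" and "v d \<in> span B" "v d \<in> span (Basis - B)"
        unfolding Vd[OF q] chart_distribution_def by auto
      then have "v d = (0 :: ('a, 'e) tvec) d"
        using span_Basis_iff[OF B(1), of "v d"] span_Compl_Basis_iff[OF B(1), of "v d"] by simp
      then have "v = 0"
        by (rule tangent_eqI[OF d q t subspace_0[OF subspace_tangent_space]])
      then show "v \<in> {0}" by simp
    next
      fix v :: "('a, 'e) tvec" assume "v \<in> {0}"
      then show "v \<in> V q \<inter> ?V' q"
        unfolding Vd[OF q] chart_distribution_def using subspace_0[OF subspace_tangent_space, of q] by (simp add: span_zero)
    qed
    show "{v + w |v w. v \<in> V q \<and> w \<in> ?V' q} = tangent_space A q"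
    proof (intro equalityI subsetI)
      fix t assume "t \<in> {v + w |v w. v \<in> V q \<and> w \<in> ?V' q}"
      then show "t \<in> tangent_space A q"
        unfolding Vd[OF q] chart_distribution_def using subspace_add[OF subspace_tangent_space] by blast
    next
      fix t assume t: "t \<in> tangent_space A q"
      have "t = coord_vec A d q (proj B (t d) + (t d - proj B (t d)))"
        using coord_vec_tangent[OF d q t] by simp
      also have "\<dots> = coord_vec A d q (proj B (t d)) + coord_vec A d q (t d - proj B (t d))"
        by (rule linear_add[OF linear_coord_vec[OF d q]])
      finally have "t = coord_vec A d q (proj B (t d)) + coord_vec A d q (t d - proj B (t d))" .
      moreover have "coord_vec A d q (proj B (t d)) \<in> V q"
        unfolding Vd[OF q] img using span_Basis_iff[OF B(1)] proj_proj[OF B(1)] by blast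
      moreover have "coord_vec A d q (t d - proj B (t d)) \<in> ?V' q"
        unfolding img using span_Compl_Basis_iff[OF B(1), of "t d - proj B (t d)"] proj_proj[OF B(1)]
        by (simp add: linear_diff[OF linear_proj])
      ultimately show "t \<in> {v + w |v w. v \<in> V q \<and> w \<in> ?V' q}" by blast
    qed
  qed
  moreover have "vanishes_on (fst d) (\<omega> \<alpha>) ?V'" if \<alpha>: "\<alpha> \<in> {1..k}" for \<alpha>
    unfolding vanishes_on_def
  proof (intro ballI)
    fix q u v assume q: "q \<in> fst d" and uv: "u \<in> ?V' q" "v \<in> ?V' q"
    let ?x = "snd c q"
    \<comment> \<open>On \<open>V'\<close> all \<open>dy\<close> vanish, and every term of \<open>darboux\<close> contains one.\<close>
    have dy: "fderiv (y \<alpha> b) ?x (t c) = 0" if t: "t \<in> ?V' q" and b: "b \<in> Basis - B" for t b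
    proof -
      have "proj B (t d) = 0" "t \<in> tangent_space A q"
        using t span_Compl_Basis_iff[OF B(1)] by (auto simp: chart_distribution_def)
      moreover have "(\<alpha>, b) \<in> I" using \<alpha> b by (simp add: I_def)
      ultimately show ?thesis
        using D\<Psi>_y[OF sub(2)[OF q] \<alpha> b, of "t c"] vd[of t q] q
          proj_inner[OF B(1) \<beta>B(2), of "(\<alpha>, b)" "t d"] \<beta>B(1) by simp
    qed
    have "\<omega> \<alpha> q u v = w \<alpha> ?x (u c) (v c)"
      unfolding w_def
      by (rule form2_coeff_eq[OF c(1) sub(1)[OF q]]) (use uv in \<open>auto simp: chart_distribution_def\<close>)
    also have "\<dots> = 0"
      unfolding darboux[OF \<alpha> sub(2)[OF q]] by (rule sum.neutral) (simp add: dy uv)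
    finally show "\<omega> \<alpha> q u v = 0" .
  qed
  moreover have "integrable_distribution X A (fst d) n ?V'"
    using integrable_chart_distribution[OF d, of "Basis - B"] card_Q by simp
  moreover have "p \<in> fst d" using c S by (simp add: d_def)
  ultimately show "\<exists>U V'. openin X U \<and> p \<in> U \<and> integrable_distribution X A U n V' \<and>
      supplementary_on A U V V' \<and> (\<forall>\<alpha>\<in>{1..k}. vanishes_on U (\<omega> \<alpha>) V')"
    using chart_openin[OF d] by (intro exI[of _ "fst d"] exI[of _ ?V'] conjI ballI)
qed

end
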